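(* For all $n\ge2$ and all $d\ge1$, the Itenberg–Viro triangulation $IV^n_d$ of the simplex $\mathrm P^n_d$ is simply integrable. In particular, the Harnack distribution $$h^n(x_1,\dots,x_n)=\sum_{i<j}x_ix_j\in\mathbb F_2$$ on the lattice points of $\mathrm P^n_d$ is a solution of the equation $\nabla^2\varepsilon|_{X_0}=\rho$ associated to $IV^n_d$.
   Context: Simplices and triangulations. $\mathrm P^n_d\subset\mathbb R^n$ is the convex hull of $\{0,de_1,\dots,de_n\}$, with $(e_i)$ the canonical basis of $M=\mathbb Z^n$ and $e_0:=0$; $\mathbb R^m$ is identified with $\{x_{m+1}=0\}\subset\mathbb R^{m+1}$. $[a_0,\dots,a_k]$ denotes a convex hull, $*$ a join. A triangulation is primitive if it consists of lattice simplices and its maximal simplices have minimal volume $1/(\text{dimension})!$. Given triangulations $K$ of $\mathrm P^{m+1}_d$ and $L$ of $\mathrm P^m_{d+1}$: - $K+L$ is the unique triangulation of $\mathrm P^{m+1}_{d+1}$ whose restriction to $\{x_{m+1}\ge1\}$ is the translate $K+e_{m+1}$ and such that, for all $0\le i\le m$, its restriction to $[e_{m+1},e_{m+1}+de_1,\dots,e_{m+1}+de_i]*[(d+1)e_i,\dots,(d+1)e_m]$ is the join of the restriction of $K+e_{m+1}$ to the first simplex with the restriction of $L$ to the second; - $K+(-1)L$ is the unique triangulation of $\mathrm P^{m+1}_{d+1}$ whose restriction to $\{x_{m+1}\ge1\}$ is $K+e_{m+1}$ and such that, for all $0\le i\le m$, its restriction to $[e_{m+1}+de_i,\dots,e_{m+1}+de_m]*[0,(d+1)e_1,\dots,(d+1)e_i]$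 is the join of the restriction of $K+e_{m+1}$ to the first simplex with the restriction of $L$ to the second. The Itenberg–Viro triangulations are defined by: $IV^1_d$ is the only primitive triangulation of $\mathrm P^1_d$ ($d\ge1$); $IV^m_1=\mathrm P^m_1$ (a single maximal simplex); $IV^{m+1}_{d+1}=IV^{m+1}_d+(-1)^dIV^m_{d+1}$ for $m,d\ge1$. Complexes. Let $K$ be a primitive triangulation of a lattice polytope $P\subset M\otimes\mathbb R$ (here $P=\mathrm P^n_d$), $N$ the dual lattice of $M$, $M_2=M\otimes\mathbb F_2$, $N_2=N\otimes\mathbb F_2$. A simplex is interior if not contained in $\partial P$. For $\sigma\le\tau$ in $K$, $[\sigma,\tau]$ is the union of the simplices of the barycentric subdivision given by flags between $\sigma$ and $\tau$; for $\sigma$ contained in a face $Q$ of $P$, $[\sigma,Q]=\bigcup_{\sigma\le\tau\subset Q}[\sigma,\tau]$ is a ball of dimension $\dim Q-\dim\sigma$. These are the closed cells of a regular CW structure $Y$ on $P$, with $[\sigma',Q']\le[\sigma,Q]$ iff $\sigma'\ge\sigma$, $Q'\subset Q$. $X\le Y$ is the subcomplex of cells with $\dim\sigma\ge1$. Put $\sigma^*=[\sigma,P]$ and $X_0=X\cap\bigcup_{v\text{ interior vertex}}v^*$. Waves and Hessian. A cellular sheaf $\mathcal G$ has functorial maps $\mathcal G(e')\to\mathcal G(e)$ for $e'\le e$, and $H^q(-;\mathcal G)$ is its cellular cohomology. $\mathcal W_1$ is the sheaf on $X$ with $\mathcal W_1(\sigma,Q)=((T\sigma)^\perp\cap N)\otimes\mathbb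 F_2\subset N_2$ ($T\sigma$ the linear tangent space) and inclusions as transition maps. $\mathcal Z^1$ is the sheaf $[\sigma,Q]\mapsto Z^1(\sigma;\mathbb F_2)$ (simplicial 1-cocycles, restrictions). There is a short exact sequence $0\to\mathcal W_1\to N_2\xrightarrow{z}\mathcal Z^1|_X\to0$ with $N_2$ constant and $z(u)(\sigma^1)=\langle v_0-v_1,u\rangle$ for an edge $\sigma^1$ with endpoints $v_0,v_1$. For $\varepsilon\in C^0(K;\mathbb F_2)$ (a sign distribution), $\nabla^2\varepsilon\in H^1(X;\mathcal W_1)$ is the image under the connecting morphism $H^0(X;\mathcal Z^1)\to H^1(X;\mathcal W_1)$ of the section $[\sigma,Q]\mapsto\mathrm d\varepsilon|_\sigma$. $K$ is $\rho$-uniform if there is a (necessarily unique) $\rho\in H^1(X_0;\mathcal W_1)$ with $\rho|_{\partial v^*}=\nabla^2\chi_v|_{\partial v^*}$ for every interior vertex $v$ of $K$, where $\chi_v$ is $1$ on $v$ and $0$ elsewhere. $K$ is simply integrable if it is $\rho$-uniform and the equation $\nabla^2\varepsilon|_{X_0}=\rho$ has a solution $\varepsilon\in C^0(K;\mathbb F_2)$. *)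

theory Defs
  imports "HOL-Analysis.Analysis" "HOL-Library.Function_Algebras" "HOL-Library.Z2"
begin

section \<open>Ambient space\<close>

text \<open>
  The space \<open>R\<^sup>n\<close> is the set of functions \<^typ>\<open>nat \<Rightarrow> real\<close> vanishing outside \<open>{1..n}\<close>, so that the
  identification of \<open>R\<^sup>m\<close> with the hyperplane \<open>x\<^sub>m\<^sub>+\<^sub>1 = 0\<close> of \<open>R\<^sup>m\<^sup>+\<^sup>1\<close> is an inclusion. The real vector
  space structure is pointwise.
\<close>

instantiation "fun" :: (type, scaleR) scaleR
begin

definition "scaleR r f = (\<lambda>x. r *\<^sub>R f x)"

instance ..

end

instance "fun" :: (type, real_vector) real_vector
  by standard (auto simp: scaleR_fun_def fun_eq_iff scaleR_add_right scaleR_add_left)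

type_synonym lpoint = "nat \<Rightarrow> int"
type_synonym rpoint = "nat \<Rightarrow> real"

definition lattice_pts :: "nat \<Rightarrow> lpoint set" where
  "lattice_pts n = {v. \<forall>i. i \<notin> {1..n} \<longrightarrow> v i = 0}"

definition emb :: "lpoint \<Rightarrow> rpoint" where
  "emb v = (\<lambda>i. real_of_int (v i))"

text \<open>\<open>sbasis s i\<close> is \<open>s e\<^sub>i\<close>, with the convention \<open>e\<^sub>0 = 0\<close>.\<close>

definition sbasis :: "nat \<Rightarrow> nat \<Rightarrow> lpoint" where
  "sbasis s i = (\<lambda>j. if j = i \<and> 1 \<le> i then int s else 0)"

text \<open>
  A lattice simplex is represented by its set of vertices; \<open>geom\<close> is the simplex as a set of points.
\<close>

definition geom :: "lpoint set \<Rightarrow> rpoint set" where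
  "geom \<sigma> = convex hull (emb ` \<sigma>)"

definition PP :: "nat \<Rightarrow> nat \<Rightarrow> rpoint set" where
  "PP n d = geom (sbasis d ` {0..n})"

section \<open>Triangulations\<close>

definition triangulation :: "nat \<Rightarrow> rpoint set \<Rightarrow> lpoint set set \<Rightarrow> bool" where
  "triangulation n P K \<longleftrightarrow>
     finite K \<and>
     (\<forall>\<sigma>\<in>K. finite \<sigma> \<and> \<sigma> \<noteq> {} \<and> \<sigma> \<subseteq> lattice_pts n \<and> inj_on emb \<sigma> \<and> \<not> affine_dependent (emb ` \<sigma>)) \<and>
     (\<forall>\<sigma>\<in>K. \<forall>\<tau>. \<tau> \<subseteq> \<sigma> \<and> \<tau> \<noteq> {} \<longrightarrow> \<tau> \<in> K) \<and>
     (\<forall>\<sigma>\<in>K. \<forall>\<tau>\<in>K. geom \<sigma> \<inter> geom \<tau> = geom (\<sigma> \<inter> \<tau>)) \<and>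
     (\<Union>\<sigma>\<in>K. geom \<sigma>) = P"

text \<open>
  \<open>vol n\<close> is Lebesgue measure on \<open>R\<^sup>n\<close>; elements of the product space are functions that are
  \<^const>\<open>undefined\<close> outside \<open>{1..n}\<close>, whence the \<^const>\<open>restrict\<close>.
\<close>

definition vol :: "nat \<Rightarrow> rpoint set \<Rightarrow> real" where
  "vol n S = measure (Pi\<^sub>M {1..n} (\<lambda>_. lborel)) ((\<lambda>x. restrict x {1..n}) ` S)"

text \<open>
  Only used for \<open>P\<close> of dimension \<open>n\<close>, in which case all maximal simplices have dimension \<open>n\<close>.
\<close>

definition primitive_triangulation :: "nat \<Rightarrow> rpoint set \<Rightarrow> lpoint set set \<Rightarrow> bool" where
  "primitive_triangulation n P K \<longleftrightarrow>
     triangulation n P K \<and>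
     (\<forall>\<sigma>\<in>K. (\<forall>\<tau>\<in>K. \<sigma> \<subseteq> \<tau> \<longrightarrow> \<tau> = \<sigma>) \<longrightarrow> vol n (geom \<sigma>) = 1 / fact n)"

definition restr :: "lpoint set set \<Rightarrow> rpoint set \<Rightarrow> lpoint set set" where
  "restr K R = {\<sigma>\<in>K. geom \<sigma> \<subseteq> R}"

definition join :: "lpoint set set \<Rightarrow> lpoint set set \<Rightarrow> lpoint set set" where
  "join A B = A \<union> B \<union> {\<sigma> \<union> \<tau> |\<sigma> \<tau>. \<sigma> \<in> A \<and> \<tau> \<in> B}"

definition translate :: "lpoint \<Rightarrow> lpoint set set \<Rightarrow> lpoint set set" where
  "translate v K = (\<lambda>\<sigma>. (\<lambda>x. x + v) ` \<sigma>) ` K"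

text \<open>
  \<open>top_vtx m d j\<close> is \<open>e\<^sub>m\<^sub>+\<^sub>1 + d e\<^sub>j\<close>; the vertices of \<open>PP m (d+1)\<close> are \<open>sbasis (d+1) j\<close>. In both operations
  \<open>K\<close> is a triangulation of \<open>PP (m+1) d\<close> and \<open>L\<close> one of \<open>PP m (d+1)\<close>.
\<close>

definition top_vtx :: "nat \<Rightarrow> nat \<Rightarrow> nat \<Rightarrow> lpoint" where
  "top_vtx m d j = sbasis 1 (m+1) + sbasis d j"

definition is_glued ::
  "nat \<Rightarrow> nat \<Rightarrow> (nat \<Rightarrow> nat set) \<Rightarrow> (nat \<Rightarrow> nat set) \<Rightarrow> lpoint set set \<Rightarrow> lpoint set set
     \<Rightarrow> lpoint set set \<Rightarrow> bool" where
  "is_glued m d I J K L T \<longleftrightarrow>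
     triangulation (m+1) (PP (m+1) (d+1)) T \<and>
     restr T {x. x (m+1) \<ge> 1} = translate (sbasis 1 (m+1)) K \<and>
     (\<forall>i\<in>{0..m}.
        restr T (geom (top_vtx m d ` I i \<union> sbasis (d+1) ` J i)) =
          join (restr (translate (sbasis 1 (m+1)) K) (geom (top_vtx m d ` I i)))
               (restr L (geom (sbasis (d+1) ` J i))))"

definition plus_tri :: "nat \<Rightarrow> nat \<Rightarrow> lpoint set set \<Rightarrow> lpoint set set \<Rightarrow> lpoint set set" where
  "plus_tri m d K L = (THE T. is_glued m d (\<lambda>i. {0..i}) (\<lambda>i. {i..m}) K L T)"

definition minus_tri :: "nat \<Rightarrow> nat \<Rightarrow> lpoint set set \<Rightarrow> lpoint set set \<Rightarrow> lpoint set set" where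
  "minus_tri m d K L = (THE T. is_glued m d (\<lambda>i. {i..m}) (\<lambda>i. {0..i}) K L T)"

text \<open>The values for \<open>n = 0\<close> or \<open>d = 0\<close> are irrelevant.\<close>

fun IV :: "nat \<Rightarrow> nat \<Rightarrow> lpoint set set" where
  "IV 0 d = {}"
| "IV (Suc m) 0 = {}"
| "IV (Suc 0) (Suc d) = (THE K. primitive_triangulation 1 (PP 1 (Suc d)) K)"
| "IV (Suc (Suc m)) (Suc 0) = {\<sigma>. \<sigma> \<noteq> {} \<and> \<sigma> \<subseteq> sbasis 1 ` {0..Suc (Suc m)}}"
| "IV (Suc (Suc m)) (Suc (Suc d)) =
     (if even (Suc d) then plus_tri else minus_tri) (Suc m) (Suc d)
       (IV (Suc (Suc m)) (Suc d)) (IV (Suc m) (Suc (Suc d)))"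

section \<open>The cell complex\<close>

text \<open>
  The closed cell \<open>[\<sigma>,Q]\<close> of the regular CW structure \<open>Y\<close> is represented by the pair \<open>(\<sigma>,Q)\<close>. Inclusion
  of closed cells is \<open>cell_le\<close>, and a subcomplex is a set of cells closed under \<open>cell_le\<close>.
\<close>

type_synonym cell = "lpoint set \<times> rpoint set"

definition tangent :: "rpoint set \<Rightarrow> rpoint set" where
  "tangent S = span {x - y |x y. x \<in> S \<and> y \<in> S}"

definition cell_le :: "cell \<Rightarrow> cell \<Rightarrow> bool" where
  "cell_le e' e \<longleftrightarrow> fst e \<subseteq> fst e' \<and> snd e' \<subseteq> snd e"

definition cdim :: "cell \<Rightarrow> nat" where
  "cdim e = dim (tangent (snd e)) - dim (tangent (geom (fst e)))"

definition YY :: "rpoint set \<Rightarrow> lpoint set set \<Rightarrow> cell set" where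
  "YY P K = {(\<sigma>, Q). \<sigma> \<in> K \<and> Q face_of P \<and> geom \<sigma> \<subseteq> Q}"

definition XX :: "rpoint set \<Rightarrow> lpoint set set \<Rightarrow> cell set" where
  "XX P K = {e \<in> YY P K. dim (tangent (geom (fst e))) \<ge> 1}"

text \<open>The boundary of a polytope is the union of its proper faces.\<close>

definition bdry :: "rpoint set \<Rightarrow> rpoint set" where
  "bdry P = \<Union>{Q. Q face_of P \<and> Q \<noteq> P}"

definition interior_vertices :: "rpoint set \<Rightarrow> lpoint set set \<Rightarrow> lpoint set" where
  "interior_vertices P K = {v. {v} \<in> K \<and> \<not> geom {v} \<subseteq> bdry P}"

definition dual_cell :: "rpoint set \<Rightarrow> lpoint set set \<Rightarrow> lpoint \<Rightarrow> cell set" where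
  "dual_cell P K v = {e \<in> YY P K. cell_le e ({v}, P)}"

definition bdry_dual_cell :: "rpoint set \<Rightarrow> lpoint set set \<Rightarrow> lpoint \<Rightarrow> cell set" where
  "bdry_dual_cell P K v = dual_cell P K v - {({v}, P)}"

definition X0 :: "rpoint set \<Rightarrow> lpoint set set \<Rightarrow> cell set" where
  "X0 P K = XX P K \<inter> (\<Union>v\<in>interior_vertices P K. dual_cell P K v)"

section \<open>Cellular sheaves of vector spaces over the field with two elements\<close>

text \<open>
  \<open>trans G e' e\<close> is the map \<open>G(e') \<Rightarrow> G(e)\<close> for \<open>e' \<le> e\<close>. Incidence numbers of a regular CW complex
  are \<open>\<plusminus>1\<close>, hence \<open>1\<close> over the field with two elements. Cochains on \<open>A\<close> of degree \<open>q\<close> are extended by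
  \<open>0\<close> to all cells. A cohomology class is a coset of the coboundaries.
\<close>

record 'g sheaf =
  stalk :: "cell \<Rightarrow> 'g set"
  trans :: "cell \<Rightarrow> cell \<Rightarrow> 'g \<Rightarrow> 'g"

definition cochains :: "cell set \<Rightarrow> 'g::ab_group_add sheaf \<Rightarrow> nat \<Rightarrow> (cell \<Rightarrow> 'g) set" where
  "cochains A G q = {a. \<forall>e. if e \<in> A \<and> cdim e = q then a e \<in> stalk G e else a e = 0}"

definition cobdry ::
  "cell set \<Rightarrow> 'g::ab_group_add sheaf \<Rightarrow> nat \<Rightarrow> (cell \<Rightarrow> 'g) \<Rightarrow> cell \<Rightarrow> 'g" where
  "cobdry A G q a = (\<lambda>e. if e \<in> A \<and> cdim e = Suc q
     then \<Sum>e' | e' \<in> A \<and> cell_le e' e \<and> cdim e' = q. trans G e' e (a e') else 0)"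

definition cocycles :: "cell set \<Rightarrow> 'g::ab_group_add sheaf \<Rightarrow> nat \<Rightarrow> (cell \<Rightarrow> 'g) set" where
  "cocycles A G q = {a \<in> cochains A G q. cobdry A G q a = 0}"

fun coboundaries :: "cell set \<Rightarrow> 'g::ab_group_add sheaf \<Rightarrow> nat \<Rightarrow> (cell \<Rightarrow> 'g) set" where
  "coboundaries A G 0 = {0}"
| "coboundaries A G (Suc q) = cobdry A G q ` cochains A G q"

definition coh_class ::
  "cell set \<Rightarrow> 'g::ab_group_add sheaf \<Rightarrow> nat \<Rightarrow> (cell \<Rightarrow> 'g) \<Rightarrow> (cell \<Rightarrow> 'g) set" where
  "coh_class A G q a = {a + b |b. b \<in> coboundaries A G q}"

definition cohomology ::
  "cell set \<Rightarrow> 'g::ab_group_add sheaf \<Rightarrow> nat \<Rightarrow> (cell \<Rightarrow> 'g) set set" where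
  "cohomology A G q = coh_class A G q ` cocycles A G q"

text \<open>
  Restriction of a class \<open>\<kappa>\<close> to a subcomplex \<open>B\<close>: all representatives restrict to the same class, so
  the union below is that class.
\<close>

definition coh_restrict ::
  "cell set \<Rightarrow> 'g::ab_group_add sheaf \<Rightarrow> nat \<Rightarrow> (cell \<Rightarrow> 'g) set \<Rightarrow> (cell \<Rightarrow> 'g) set" where
  "coh_restrict B G q \<kappa> = (\<Union>a\<in>\<kappa>. coh_class B G q (\<lambda>e. if e \<in> B then a e else 0))"

text \<open>
  Connecting morphism of a short exact sequence \<open>0 \<Rightarrow> F \<Rightarrow> G \<Rightarrow> H \<Rightarrow> 0\<close> with maps \<open>\<iota>\<close> and \<open>\<pi>\<close>: lift a
  representative \<open>c\<close> of \<open>\<kappa>\<close> to a cochain \<open>b\<close> of \<open>G\<close> and pull its coboundary back to \<open>F\<close>. Letting the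
  lift vary over all possible choices yields exactly one full coset.
\<close>

definition connecting ::
  "cell set \<Rightarrow> 'f::ab_group_add sheaf \<Rightarrow> 'g::ab_group_add sheaf
     \<Rightarrow> (cell \<Rightarrow> 'f \<Rightarrow> 'g) \<Rightarrow> (cell \<Rightarrow> 'g \<Rightarrow> 'h) \<Rightarrow> nat
     \<Rightarrow> (cell \<Rightarrow> 'h::ab_group_add) set \<Rightarrow> (cell \<Rightarrow> 'f) set" where
  "connecting A F G \<iota> \<pi> q \<kappa> =
     {a \<in> cocycles A F (Suc q). \<exists>c\<in>\<kappa>. \<exists>b\<in>cochains A G q.
        (\<lambda>e. \<pi> e (b e)) = c \<and> (\<lambda>e. \<iota> e (a e)) = cobdry A G q b}"

section \<open>Wave sheaf and Hessian\<close>

text \<open>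
  \<open>M\<close> and its dual \<open>N\<close> are both \<open>lattice_pts n\<close>, paired by the standard bilinear form. The tensor
  product of \<open>(T\<sigma>)\<^sup>\<bottom> \<inter> N\<close> with the field with two elements is taken as its image in \<open>N2 n\<close> by reduction
  mod 2.
\<close>

definition N2 :: "nat \<Rightarrow> (nat \<Rightarrow> bit) set" where
  "N2 n = {u. \<forall>i. i \<notin> {1..n} \<longrightarrow> u i = 0}"

definition pairing2 :: "nat \<Rightarrow> lpoint \<Rightarrow> (nat \<Rightarrow> bit) \<Rightarrow> bit" where
  "pairing2 n v u = (\<Sum>i\<in>{1..n}. of_int (v i) * u i)"

definition N2_sheaf :: "nat \<Rightarrow> (nat \<Rightarrow> bit) sheaf" where
  "N2_sheaf n = \<lparr>stalk = (\<lambda>_. N2 n), trans = (\<lambda>_ _ u. u)\<rparr>"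

definition W1 :: "nat \<Rightarrow> (nat \<Rightarrow> bit) sheaf" where
  "W1 n = \<lparr>stalk = (\<lambda>e. {(\<lambda>i. of_int (w i)) |w. w \<in> lattice_pts n \<and>
              (\<forall>t\<in>tangent (geom (fst e)). (\<Sum>i\<in>{1..n}. t i * real_of_int (w i)) = 0)}),
           trans = (\<lambda>_ _ u. u)\<rparr>"

text \<open>
  A simplicial 1-cochain of \<open>\<sigma>\<close> is a function of the edges of \<open>\<sigma>\<close>, which are its two-element subsets,
  extended by \<open>0\<close>. \<open>dsimp \<sigma> f\<close> is the coboundary on \<open>\<sigma>\<close> of the 0-cochain \<open>f\<close>.
\<close>

definition edges :: "lpoint set \<Rightarrow> lpoint set set" where
  "edges \<sigma> = {s. s \<subseteq> \<sigma> \<and> card s = 2}"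

definition Z1 :: "lpoint set \<Rightarrow> (lpoint set \<Rightarrow> bit) set" where
  "Z1 \<sigma> = {c. (\<forall>s. s \<notin> edges \<sigma> \<longrightarrow> c s = 0) \<and>
              (\<forall>t. t \<subseteq> \<sigma> \<and> card t = 3 \<longrightarrow> (\<Sum>s\<in>edges t. c s) = 0)}"

definition dsimp :: "lpoint set \<Rightarrow> (lpoint \<Rightarrow> bit) \<Rightarrow> lpoint set \<Rightarrow> bit" where
  "dsimp \<sigma> f = (\<lambda>s. if s \<in> edges \<sigma> then \<Sum>v\<in>s. f v else 0)"

definition Z1_sheaf :: "(lpoint set \<Rightarrow> bit) sheaf" where
  "Z1_sheaf = \<lparr>stalk = (\<lambda>e. Z1 (fst e)),
               trans = (\<lambda>_ e c. (\<lambda>s. if s \<in> edges (fst e) then c s else 0))\<rparr>"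

text \<open>
  On an edge with endpoints \<open>v\<^sub>0\<close>, \<open>v\<^sub>1\<close> this is the pairing of \<open>v\<^sub>0 - v\<^sub>1\<close> with \<open>u\<close>, since \<open>- = +\<close> mod 2.
\<close>

definition zmap :: "nat \<Rightarrow> cell \<Rightarrow> (nat \<Rightarrow> bit) \<Rightarrow> lpoint set \<Rightarrow> bit" where
  "zmap n e u = dsimp (fst e) (\<lambda>v. pairing2 n v u)"

text \<open>
  The global section \<open>[\<sigma>,Q] \<mapsto> d\<epsilon>|\<^sub>\<sigma>\<close>, as a cellular 0-cocycle, i.e. through its values on the 0-cells.
\<close>

definition dsection :: "cell set \<Rightarrow> (lpoint \<Rightarrow> bit) \<Rightarrow> cell \<Rightarrow> lpoint set \<Rightarrow> bit" where
  "dsection A \<epsilon> = (\<lambda>e. if e \<in> A \<and> cdim e = 0 then dsimp (fst e) \<epsilon> else 0)"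

text \<open>
  Sign distributions are functions on all lattice points; only their values at the vertices of \<open>K\<close>
  matter.
\<close>

definition hessian ::
  "nat \<Rightarrow> rpoint set \<Rightarrow> lpoint set set \<Rightarrow> (lpoint \<Rightarrow> bit) \<Rightarrow> (cell \<Rightarrow> nat \<Rightarrow> bit) set" where
  "hessian n P K \<epsilon> =
     connecting (XX P K) (W1 n) (N2_sheaf n) (\<lambda>_ w. w) (zmap n) 0
       (coh_class (XX P K) Z1_sheaf 0 (dsection (XX P K) \<epsilon>))"

definition chi :: "lpoint \<Rightarrow> lpoint \<Rightarrow> bit" where
  "chi v = (\<lambda>x. if x = v then 1 else 0)"

definition uniform ::
  "nat \<Rightarrow> rpoint set \<Rightarrow> lpoint set set \<Rightarrow> (cell \<Rightarrow> nat \<Rightarrow> bit) set \<Rightarrow> bool" where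
  "uniform n P K \<rho> \<longleftrightarrow>
     \<rho> \<in> cohomology (X0 P K) (W1 n) 1 \<and>
     (\<forall>v\<in>interior_vertices P K.
        coh_restrict (bdry_dual_cell P K v) (W1 n) 1 \<rho> =
        coh_restrict (bdry_dual_cell P K v) (W1 n) 1 (hessian n P K (chi v)))"

definition hessian_solution ::
  "nat \<Rightarrow> rpoint set \<Rightarrow> lpoint set set \<Rightarrow> (cell \<Rightarrow> nat \<Rightarrow> bit) set \<Rightarrow> (lpoint \<Rightarrow> bit) \<Rightarrow> bool" where
  "hessian_solution n P K \<rho> \<epsilon> \<longleftrightarrow> coh_restrict (X0 P K) (W1 n) 1 (hessian n P K \<epsilon>) = \<rho>"

text \<open>For \<open>K\<close> a primitive triangulation of the \<open>n\<close>-dimensional lattice polytope \<open>P\<close>.\<close>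

definition simply_integrable :: "nat \<Rightarrow> rpoint set \<Rightarrow> lpoint set set \<Rightarrow> bool" where
  "simply_integrable n P K \<longleftrightarrow> (\<exists>\<rho>. uniform n P K \<rho> \<and> (\<exists>\<epsilon>. hessian_solution n P K \<rho> \<epsilon>))"

definition harnack :: "nat \<Rightarrow> lpoint \<Rightarrow> bit" where
  "harnack n x = (\<Sum>(i, j) | i \<in> {1..n} \<and> j \<in> {1..n} \<and> i < j. of_int (x i) * of_int (x j))"

end

theory Submission
  imports Defs
begin

text \<open>
  \<^bold>\<open>Reduction to a local statement.\<close> An interior vertex \<open>v\<close> lies in no proper face, so the cells of
  \<open>X\<^sub>0\<close> are the pairs \<open>(\<tau>, P)\<close> for which \<open>\<tau>\<close> has dimension at least one and an interior vertex. Over a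
  0-cell the simplex \<open>\<tau>\<close> is full-dimensional and the stalk of the wave sheaf vanishes
  (\<open>conormal_full\<close>); hence there are no coboundaries in degree one, a class on \<open>X\<^sub>0\<close> is the same as a
  cocycle, and it is determined by its restrictions to the spheres \<open>\<partial>v\<^sup>*\<close>, which cover \<open>X\<^sub>0\<close>. The value
  of the Hessian of \<open>\<epsilon>\<close> at a simplex \<open>\<tau>\<close> of codimension one is the difference of the gradients of \<open>\<epsilon>\<close>
  on the two maximal simplices \<open>\<tau> \<union> {a}\<close> and \<open>\<tau> \<union> {b}\<close>. Consequently two distributions have the same
  Hessian at \<open>\<tau>\<close> as soon as their sum is affine modulo 2 on \<open>\<tau> \<union> {a, b}\<close> (\<open>hessian_eq\<close>), and the theorem
  follows if, with \<open>h\<close> the Harnack distribution, \<open>h + \<chi>\<^sub>v\<close> is affine modulo 2 on \<open>\<tau> \<union> {a, b}\<close> whenever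
  \<open>v \<in> \<tau>\<close> is interior (\<open>harnack_flat\<close>, \<open>flat_imp_uniform\<close>).

  \<^bold>\<open>The local statement.\<close> It is proved by induction (\<open>harnack_flat_step\<close>). The triangulation of
  \<open>P\<^sup>m\<^sup>+\<^sup>1\<^sub>d\<^sub>+\<^sub>1\<close> consists of a raised copy of the one of \<open>P\<^sup>m\<^sup>+\<^sup>1\<^sub>d\<close> and of a layer of height one. Around an
  interior vertex of height at least two only the raised copy is visible, and raising changes \<open>h\<close> by an
  affine function. Around an interior vertex \<open>v\<close> of height one there are two layers, one on each side
  of the horizontal slice through \<open>v\<close>, built from staircases of opposite directions. As \<open>v\<close> is interior
  in the slice, a simplex containing it has at most one vertex outside the slice, namely the lower apex
  \<open>(d+1) e\<^sub>M\<close> or the upper apex \<open>2 e\<^sub>m\<^sub>+\<^sub>1 + (d-1) e\<^sub>M\<close>, with the same \<open>M\<close> (\<open>star_of_layer_vertex\<close>). Either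
  \<open>\<tau>\<close> contains an apex, and the assertion is the cone over the assertion for the slice
  (\<open>affine_mod2_cone\<close>); or \<open>\<tau>\<close> lies in the slice, and \<open>a\<close>, \<open>b\<close> are the two apexes. Those are congruent
  modulo 2 and \<open>h + \<chi>\<^sub>v\<close> vanishes on both, so an affine function that fits on \<open>\<tau> \<union> {a}\<close> also fits at \<open>b\<close>.

  \<^bold>\<open>The triangulations.\<close> \<open>itenberg_viro\<close> is an explicit recursive description. That it yields
  triangulations is shown with nonnegative weights instead of points: a complex triangulates the
  polytope iff each point of the cone over the polytope has exactly one weight supported on a simplex
  (\<open>simplicial_fan\<close>). In a layer, such a weight splits into an upper and a lower part, and the
  staircase condition makes the splitting of a point unique (\<open>fan_glue\<close>). The conditions defining
  \<open>K + L\<close> and \<open>K + (-1)L\<close> prescribe the restrictions to pieces covering the polytope, and a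
  triangulation is determined by these (\<open>is_glued_unique\<close>, \<open>IV_eq_itenberg_viro\<close>).

  \<^bold>\<open>The Hessian is a cocycle.\<close> Gradients exist because each simplex is unimodular in the dual sense:
  every integer function on its vertices extends to an integer affine function (\<open>unimodular\<close>). Their
  coboundary has values in the wave sheaf because each 1-cell has exactly two ends (\<open>facet_count\<close>,
  \<open>two_ends\<close>), and it is closed because each 2-cell has the diamond property (\<open>diamond\<close>).
\<close>


section \<open>Conical weights and barycentric coordinates\<close>

text \<open>
  Barycentric coordinates of the simplex of size \<open>r\<close>, scaled to have sum \<open>r\<close>. The coordinate of
  index \<open>0\<close> belongs to the vertex \<open>0\<close>; it is the only one that depends on \<open>r\<close>.
\<close>

definition bcoord :: "nat \<Rightarrow> real \<Rightarrow> nat \<Rightarrow> rpoint \<Rightarrow> real" where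
  "bcoord n r j x = (if j = 0 then r - (\<Sum>i\<in>{1..n}. x i) else x j)"

text \<open>
  The slice at mass \<open>s\<close> of the cone over \<open>P\<^sup>n\<^sub>d\<close>. Working with all \<open>s\<close> at once avoids divisions
  when a point of a layer is split into an upper and a lower part, either of which may have mass \<open>0\<close>.
\<close>

definition dilate :: "nat \<Rightarrow> nat \<Rightarrow> real \<Rightarrow> rpoint set" where
  "dilate n d s = {x. (\<forall>i. i \<notin> {1..n} \<longrightarrow> x i = 0) \<and> (\<forall>j\<le>n. 0 \<le> bcoord n (real d * s) j x)}"

text \<open>
  The vanishing of \<open>w\<close> outside \<open>\<sigma>\<close> makes weights on different simplices comparable as functions.
\<close>

definition conic_rep :: "lpoint set \<Rightarrow> (lpoint \<Rightarrow> real) \<Rightarrow> real \<Rightarrow> rpoint \<Rightarrow> bool" where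
  "conic_rep \<sigma> w s x \<longleftrightarrow> (\<forall>v. 0 \<le> w v) \<and> (\<forall>v. v \<notin> \<sigma> \<longrightarrow> w v = 0) \<and> (\<Sum>v\<in>\<sigma>. w v) = s \<and>
     (\<forall>i. (\<Sum>v\<in>\<sigma>. w v * real_of_int (v i)) = x i)"

text \<open>
  The two last clauses say that each point of the cone over \<open>P\<^sup>n\<^sub>d\<close> has exactly one weight
  supported on a simplex of \<open>K\<close>. This single uniqueness statement contains both that the vertices of a
  simplex are affinely independent and that two simplices meet in a common face. The empty simplex is
  needed for the apex of the cone.
\<close>

definition simplicial_fan :: "nat \<Rightarrow> nat \<Rightarrow> lpoint set set \<Rightarrow> bool" where
  "simplicial_fan n d K \<longleftrightarrow> finite K \<and> {} \<notin> K \<and>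
     (\<forall>\<sigma>\<in>K. finite \<sigma> \<and> emb ` \<sigma> \<subseteq> dilate n d 1) \<and>
     (\<forall>\<sigma>\<in>K. \<forall>\<tau>. \<tau> \<subseteq> \<sigma> \<and> \<tau> \<noteq> {} \<longrightarrow> \<tau> \<in> K) \<and>
     (\<forall>s\<ge>0. \<forall>x\<in>dilate n d s. \<exists>\<sigma>\<in>insert {} K. \<exists>w. conic_rep \<sigma> w s x) \<and>
     (\<forall>\<sigma>\<in>insert {} K. \<forall>\<sigma>'\<in>insert {} K. \<forall>w w' s x.
        conic_rep \<sigma> w s x \<longrightarrow> conic_rep \<sigma>' w' s x \<longrightarrow> w = w')"

lemma inj_emb: "inj emb"
  by (auto simp: inj_def emb_def fun_eq_iff)

lemma sum_apply: "(\<Sum>i\<in>A. f i) x = (\<Sum>i\<in>A. f i x)"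
  by (induction A rule: infinite_finite_induct) auto

lemma scaleR_apply: "(r *\<^sub>R f) x = r *\<^sub>R f x"
  by (simp add: scaleR_fun_def)

lemma conic_repI:
  assumes "\<And>v. 0 \<le> w v" "\<And>v. v \<notin> \<sigma> \<Longrightarrow> w v = 0" "(\<Sum>v\<in>\<sigma>. w v) = s"
    "\<And>i. (\<Sum>v\<in>\<sigma>. w v * real_of_int (v i)) = x i"
  shows "conic_rep \<sigma> w s x"
  using assms by (auto simp: conic_rep_def)

lemma conic_repD:
  assumes "conic_rep \<sigma> w s x"
  shows "0 \<le> w v" "v \<notin> \<sigma> \<Longrightarrow> w v = 0" "(\<Sum>v\<in>\<sigma>. w v) = s"
    "(\<Sum>v\<in>\<sigma>. w v * real_of_int (v i)) = x i"
  using assms by (auto simp: conic_rep_def)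

lemma conic_rep_mono:
  assumes "conic_rep \<sigma> w s x" "\<sigma> \<subseteq> \<tau>" "finite \<tau>"
  shows "conic_rep \<tau> w s x"
  using assms unfolding conic_rep_def
  by (auto simp: sum.mono_neutral_left[of \<tau> \<sigma>] sum.mono_neutral_right[of \<tau> \<sigma>])

lemma conic_rep_support:
  assumes "conic_rep \<sigma> w s x" "finite \<sigma>"
  shows "conic_rep {v \<in> \<sigma>. 0 < w v} w s x"
proof -
  have *: "w v = 0" if "v \<notin> {v \<in> \<sigma>. 0 < w v}" for v
    using that conic_repD(1,2)[OF assms(1), of v] by force
  have "sum w {v \<in> \<sigma>. 0 < w v} = sum w \<sigma>"
    using * assms(2) by (intro sum.mono_neutral_left) auto
  moreover have "(\<Sum>v\<in>{v \<in> \<sigma>. 0 < w v}. w v * real_of_int (v i)) =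
      (\<Sum>v\<in>\<sigma>. w v * real_of_int (v i))" for i
    using * assms(2) by (intro sum.mono_neutral_left) auto
  ultimately show ?thesis
    using * conic_repD(1,3,4)[OF assms(1)] unfolding conic_rep_def by metis
qed

lemma bcoord_conic_rep:
  assumes "conic_rep \<sigma> w s x"
  shows "bcoord n (r * s) j x = (\<Sum>v\<in>\<sigma>. w v * bcoord n r j (emb v))"
proof (cases "j = 0")
  case True
  have "(\<Sum>i\<in>{1..n}. x i) = (\<Sum>i\<in>{1..n}. \<Sum>v\<in>\<sigma>. w v * real_of_int (v i))"
    using conic_repD(4)[OF assms] by simp
  also have "\<dots> = (\<Sum>v\<in>\<sigma>. \<Sum>i\<in>{1..n}. w v * real_of_int (v i))" by (rule sum.swap)
  finally show ?thesis using True conic_repD(3)[OF assms]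
    by (simp add: bcoord_def emb_def right_diff_distrib sum_subtractf sum_distrib_left mult.commute
        flip: conic_repD(3)[OF assms])
next
  case False
  then show ?thesis using conic_repD(4)[OF assms, of j] by (simp add: bcoord_def emb_def)
qed

lemma conic_rep_dilate:
  assumes "conic_rep \<sigma> w s x" "emb ` \<sigma> \<subseteq> dilate n d 1"
  shows "x \<in> dilate n d s"
proof -
  have "x i = 0" if "i \<notin> {1..n}" for i
  proof -
    have "real_of_int (v i) = 0" if "v \<in> \<sigma>" for v
      using assms(2) that \<open>i \<notin> {1..n}\<close> by (force simp: dilate_def emb_def)
    then have "(\<Sum>v\<in>\<sigma>. w v * real_of_int (v i)) = 0" by (intro sum.neutral) auto
    then show ?thesis using conic_repD(4)[OF assms(1), of i] by simp
  qed
  moreover have "0 \<le> bcoord n (real d * s) j x" if "j \<le> n" for j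
    unfolding bcoord_conic_rep[OF assms(1)] using assms(2) that conic_repD(1)[OF assms(1)]
    by (intro sum_nonneg mult_nonneg_nonneg) (auto simp: dilate_def)
  ultimately show ?thesis by (auto simp: dilate_def)
qed

lemma geom_eq_conic_rep:
  assumes "finite \<sigma>"
  shows "x \<in> geom \<sigma> \<longleftrightarrow> (\<exists>w. conic_rep \<sigma> w 1 x)"
proof
  assume "x \<in> geom \<sigma>"
  then obtain u where u: "\<And>y. y \<in> emb ` \<sigma> \<Longrightarrow> 0 \<le> u y" "sum u (emb ` \<sigma>) = 1"
     "(\<Sum>y\<in>emb ` \<sigma>. u y *\<^sub>R y) = x"
    unfolding geom_def convex_hull_finite[OF finite_imageI[OF assms]] by blast
  have inj: "inj_on emb \<sigma>" using inj_emb by (rule inj_on_subset) simp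
  define w where "w v = (if v \<in> \<sigma> then u (emb v) else 0)" for v
  have "conic_rep \<sigma> w 1 x"
  proof (rule conic_repI)
    show "sum w \<sigma> = 1" using u(2) by (simp add: sum.reindex[OF inj] w_def)
    have "x i = (\<Sum>v\<in>\<sigma>. u (emb v) *\<^sub>R emb v) i" for i
      using u(3) by (simp add: sum.reindex[OF inj])
    then show "(\<Sum>v\<in>\<sigma>. w v * real_of_int (v i)) = x i" for i
      by (simp add: w_def scaleR_apply emb_def sum_apply)
  qed (use u(1) in \<open>auto simp: w_def\<close>)
  then show "\<exists>w. conic_rep \<sigma> w 1 x" by blast
next
  assume "\<exists>w. conic_rep \<sigma> w 1 x"
  then obtain w where w: "conic_rep \<sigma> w 1 x" ..
  have "(\<Sum>v\<in>\<sigma>. w v *\<^sub>R emb v) \<in> geom \<sigma>" unfolding geom_def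
    using conic_repD(1,3)[OF w] assms
    by (intro convex_sum convex_convex_hull) (auto intro: hull_inc)
  moreover have "(\<Sum>v\<in>\<sigma>. w v *\<^sub>R emb v) = x"
    using conic_repD(4)[OF w] by (auto simp: fun_eq_iff sum_apply scaleR_apply emb_def)
  ultimately show "x \<in> geom \<sigma>" by simp
qed

lemma bcoord_affine:
  assumes "u + v = 1"
  shows "bcoord n r j (u *\<^sub>R x + v *\<^sub>R y) = u * bcoord n r j x + v * bcoord n r j y"
proof -
  have "r = u * r + v * r" using assms by (simp flip: distrib_right)
  then show ?thesis
    by (simp add: bcoord_def scaleR_fun_def sum.distrib algebra_simps flip: sum_distrib_left)
qed

lemma sum_bcoord: "(\<Sum>j\<le>n. bcoord n r j x) = r"
proof -
  have "(\<Sum>j\<le>n. bcoord n r j x) = bcoord n r 0 x + (\<Sum>j\<in>{1..n}. bcoord n r j x)"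
    by (simp add: atMost_atLeast0 sum.atLeast_Suc_atMost)
  also have "(\<Sum>j\<in>{1..n}. bcoord n r j x) = (\<Sum>j\<in>{1..n}. x j)"
    by (intro sum.cong) (auto simp: bcoord_def)
  finally show ?thesis by (simp add: bcoord_def)
qed

lemma bcoord_sbasis:
  assumes "i \<le> n" "j \<le> n"
  shows "bcoord n (real d) j (emb (sbasis d i)) = (if i = j then real d else 0)"
proof -
  have "(\<Sum>k\<in>{1..n}. emb (sbasis d i) k) = (\<Sum>k\<in>{1..n}. if k = i then real d else 0)"
    by (intro sum.cong) (auto simp: emb_def sbasis_def)
  then show ?thesis using assms by (auto simp: bcoord_def emb_def sbasis_def)
qed

lemma bcoord_ext:
  assumes "\<And>i. i \<notin> {1..n} \<Longrightarrow> x i = y i" "\<And>j. j \<in> {1..n} \<Longrightarrow> bcoord n r j x = bcoord n r j y"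
  shows "x = y"
proof
  fix i show "x i = y i" using assms[of i] by (cases "i \<in> {1..n}") (auto simp: bcoord_def)
qed

lemma geom_sbasis:
  assumes "d \<ge> 1" "I \<subseteq> {0..n}"
  shows "geom (sbasis d ` I) = {x \<in> dilate n d 1. \<forall>j\<le>n. j \<notin> I \<longrightarrow> bcoord n d j x = 0}" (is "_ = ?R")
proof
  have "convex ?R"
    unfolding convex_def dilate_def
    by (auto simp: bcoord_affine scaleR_apply)
  moreover have "emb ` sbasis d ` I \<subseteq> ?R"
    using assms by (auto simp: dilate_def bcoord_sbasis subset_iff) (auto simp: emb_def sbasis_def)
  ultimately show "geom (sbasis d ` I) \<subseteq> ?R" unfolding geom_def by (rule hull_minimal[rotated])
  show "?R \<subseteq> geom (sbasis d ` I)"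
  proof
    fix x assume x: "x \<in> ?R"
    have fin: "finite I" using assms(2) finite_subset by blast
    have s: "(\<Sum>j\<in>I. bcoord n d j x) = d"
    proof -
      have "(\<Sum>j\<in>I. bcoord n d j x) = (\<Sum>j\<le>n. bcoord n d j x)"
        using assms(2) x by (intro sum.mono_neutral_left) auto
      then show ?thesis by (simp add: sum_bcoord)
    qed
    have mem: "(\<Sum>j\<in>I. (bcoord n d j x / d) *\<^sub>R emb (sbasis d j)) \<in> geom (sbasis d ` I)"
      unfolding geom_def
    proof (rule convex_sum[OF fin convex_convex_hull])
      show "(\<Sum>j\<in>I. bcoord n d j x / d) = 1"
        using s assms(1) by (simp flip: sum_divide_distrib)
      show "0 \<le> bcoord n d j x / d" if "j \<in> I" for j
        using that x assms by (auto simp: dilate_def subset_iff)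
    qed (auto intro: hull_inc)
    have "(\<Sum>j\<in>I. (bcoord n d j x / d) *\<^sub>R emb (sbasis d j)) = x"
    proof
      fix i
      have "(\<Sum>j\<in>I. (bcoord n d j x / d) *\<^sub>R emb (sbasis d j)) i =
        (\<Sum>j\<in>I. if j = i then (if i = 0 then 0 else bcoord n d i x) else 0)"
        unfolding sum_apply using assms(1)
        by (intro sum.cong) (auto simp: scaleR_fun_def emb_def sbasis_def)
      also have "\<dots> = x i"
        using x fin assms(2) by (cases "i \<in> {1..n}") (auto simp: dilate_def bcoord_def split: if_splits)
      finally show "(\<Sum>j\<in>I. (bcoord n d j x / d) *\<^sub>R emb (sbasis d j)) i = x i" .
    qed
    with mem show "x \<in> geom (sbasis d ` I)" by simp
  qed
qed

lemma PP_eq: "d \<ge> 1 \<Longrightarrow> PP n d = dilate n d 1"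
  unfolding PP_def by (subst geom_sbasis[where n = n]) auto

lemma fanD:
  assumes "simplicial_fan n d K"
  shows "finite K" "{} \<notin> K" "\<sigma> \<in> K \<Longrightarrow> finite \<sigma>" "\<sigma> \<in> K \<Longrightarrow> emb ` \<sigma> \<subseteq> dilate n d 1"
    "\<sigma> \<in> K \<Longrightarrow> \<tau> \<subseteq> \<sigma> \<Longrightarrow> \<tau> \<noteq> {} \<Longrightarrow> \<tau> \<in> K"
proof -
  have 1: "finite K \<and> {} \<notin> K \<and> (\<forall>\<sigma>\<in>K. finite \<sigma> \<and> emb ` \<sigma> \<subseteq> dilate n d 1) \<and>
     (\<forall>\<sigma>\<in>K. \<forall>\<tau>. \<tau> \<subseteq> \<sigma> \<and> \<tau> \<noteq> {} \<longrightarrow> \<tau> \<in> K)"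
    using assms(1) unfolding simplicial_fan_def by (elim conjE) (intro conjI; assumption)
  show "finite K" "{} \<notin> K" using 1 by simp_all
  show "finite \<sigma>" "emb ` \<sigma> \<subseteq> dilate n d 1" if "\<sigma> \<in> K" using 1 that by simp_all
  show "\<tau> \<in> K" if "\<sigma> \<in> K" "\<tau> \<subseteq> \<sigma>" "\<tau> \<noteq> {}" using 1 that by metis
qed

lemma fan_ex:
  assumes "simplicial_fan n d K" "0 \<le> s" "x \<in> dilate n d s"
  obtains \<sigma> w where "\<sigma> \<in> insert {} K" "conic_rep \<sigma> w s x"
proof -
  have "\<forall>s\<ge>0. \<forall>x\<in>dilate n d s. \<exists>\<sigma>\<in>insert {} K. \<exists>w. conic_rep \<sigma> w s x"
    using assms(1) unfolding simplicial_fan_def by (elim conjE) assumption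
  then show ?thesis using assms(2,3) that by blast
qed

lemma fan_ex_support:
  assumes "simplicial_fan n d K" "0 \<le> s" "x \<in> dilate n d s"
  obtains \<sigma> w where "\<sigma> \<in> insert {} K" "conic_rep \<sigma> w s x" "\<And>v. v \<in> \<sigma> \<Longrightarrow> 0 < w v"
proof -
  obtain \<sigma> w where 1: "\<sigma> \<in> insert {} K" "conic_rep \<sigma> w s x" by (rule fan_ex[OF assms])
  then have "finite \<sigma>" using fanD(3)[OF assms(1)] by auto
  then have "conic_rep {v \<in> \<sigma>. 0 < w v} w s x" using 1 by (intro conic_rep_support)
  moreover have "{v \<in> \<sigma>. 0 < w v} \<in> insert {} K"
    using 1(1) fanD(5)[OF assms(1), of \<sigma> "{v \<in> \<sigma>. 0 < w v}"] by auto
  ultimately show ?thesis using that by blast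
qed

lemma fan_unique:
  assumes "simplicial_fan n d K" "\<sigma> \<in> insert {} K" "\<sigma>' \<in> insert {} K"
    "conic_rep \<sigma> w s x" "conic_rep \<sigma>' w' s x"
  shows "w = w'"
proof -
  have "\<forall>\<sigma>\<in>insert {} K. \<forall>\<sigma>'\<in>insert {} K. \<forall>w w' s x.
      conic_rep \<sigma> w s x \<longrightarrow> conic_rep \<sigma>' w' s x \<longrightarrow> w = w'"
    using assms(1) unfolding simplicial_fan_def by (elim conjE) assumption
  then show ?thesis using assms(2-5) by blast
qed

text \<open>
  Moving the negative coefficients to the other side turns a linear relation between the vertices
  of a simplex into an equality of two weights.
\<close>

lemma fan_independent:
  assumes fan: "simplicial_fan n d K" and \<sigma>: "\<sigma> \<in> K" and "(\<Sum>v\<in>\<sigma>. c v) = 0"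
    and "\<And>i. (\<Sum>v\<in>\<sigma>. c v * real_of_int (v i)) = 0" and "v \<in> \<sigma>"
  shows "c v = 0"
proof -
  define p where "p v = (if v \<in> \<sigma> then max 0 (c v) else 0)" for v
  define q where "q v = (if v \<in> \<sigma> then max 0 (- c v) else 0)" for v
  have pq: "c v = p v - q v" if "v \<in> \<sigma>" for v using that by (auto simp: p_def q_def)
  have "sum p \<sigma> = sum q \<sigma>" using assms(3) pq by (simp add: sum_subtractf)
  moreover have "(\<Sum>v\<in>\<sigma>. p v * real_of_int (v i)) = (\<Sum>v\<in>\<sigma>. q v * real_of_int (v i))" for i
    using assms(4)[of i] pq by (simp add: sum_subtractf left_diff_distrib)
  ultimately have "conic_rep \<sigma> p (sum q \<sigma>) (\<lambda>i. \<Sum>v\<in>\<sigma>. q v * real_of_int (v i))"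
    "conic_rep \<sigma> q (sum q \<sigma>) (\<lambda>i. \<Sum>v\<in>\<sigma>. q v * real_of_int (v i))"
    by (auto intro!: conic_repI simp: p_def q_def)
  then have "p = q" using fan_unique[OF fan] \<sigma> by blast
  then show ?thesis using pq[OF \<open>v \<in> \<sigma>\<close>] by simp
qed

lemma fan_affine_independent:
  assumes fan: "simplicial_fan n d K" and \<sigma>: "\<sigma> \<in> K"
  shows "\<not> affine_dependent (emb ` \<sigma>)"
proof
  have inj: "inj_on emb \<sigma>" using inj_emb by (rule inj_on_subset) simp
  assume "affine_dependent (emb ` \<sigma>)"
  then obtain U where U: "sum U (emb ` \<sigma>) = 0" "\<exists>v\<in>emb ` \<sigma>. U v \<noteq> 0"
    "(\<Sum>v\<in>emb ` \<sigma>. U v *\<^sub>R v) = 0"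
    using affine_dependent_explicit_finite[of "emb ` \<sigma>"] fanD(3)[OF fan \<sigma>] by auto
  have "(\<Sum>v\<in>\<sigma>. U (emb v) *\<^sub>R emb v) i = 0" for i
    using U(3) by (simp add: sum.reindex[OF inj])
  then have "(\<Sum>v\<in>\<sigma>. U (emb v) * real_of_int (v i)) = 0" for i
    by (simp add: sum_apply scaleR_apply emb_def)
  moreover have "(\<Sum>v\<in>\<sigma>. U (emb v)) = 0" using U(1) by (simp add: sum.reindex[OF inj])
  ultimately have "U (emb v) = 0" if "v \<in> \<sigma>" for v
    using fan_independent[OF fan \<sigma>] that by blast
  then show False using U(2) by auto
qed

text \<open>
  At mass \<open>1\<close> the weights are barycentric coordinates in simplices, and uniqueness of weights is
  exactly what the intersection condition of a triangulation asks for.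
\<close>

lemma fan_triangulation:
  assumes fan: "simplicial_fan n d K" and "d \<ge> 1"
  shows "triangulation n (PP n d) K"
  unfolding triangulation_def
proof (intro conjI ballI allI impI)
  show "finite K" by (rule fanD(1)[OF fan])
  fix \<sigma> assume \<sigma>: "\<sigma> \<in> K"
  show f\<sigma>: "finite \<sigma>" by (rule fanD(3)[OF fan \<sigma>])
  show "\<sigma> \<noteq> {}" using fanD(2)[OF fan] \<sigma> by auto
  show "\<sigma> \<subseteq> lattice_pts n"
    using fanD(4)[OF fan \<sigma>] by (force simp: dilate_def lattice_pts_def emb_def)
  show "inj_on emb \<sigma>" using inj_emb by (rule inj_on_subset) simp
  show "\<not> affine_dependent (emb ` \<sigma>)" by (rule fan_affine_independent[OF fan \<sigma>])
  show "\<tau> \<in> K" if "\<tau> \<subseteq> \<sigma> \<and> \<tau> \<noteq> {}" for \<tau> using that fanD(5)[OF fan \<sigma>] by blast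
  fix \<tau> assume \<tau>: "\<tau> \<in> K"
  show "geom \<sigma> \<inter> geom \<tau> = geom (\<sigma> \<inter> \<tau>)"
  proof
    show "geom (\<sigma> \<inter> \<tau>) \<subseteq> geom \<sigma> \<inter> geom \<tau>" unfolding geom_def
      using hull_mono by (metis Int_lower1 Int_lower2 image_mono le_inf_iff)
    show "geom \<sigma> \<inter> geom \<tau> \<subseteq> geom (\<sigma> \<inter> \<tau>)"
    proof
      fix x assume "x \<in> geom \<sigma> \<inter> geom \<tau>"
      then obtain w w' where w: "conic_rep \<sigma> w 1 x" "conic_rep \<tau> w' 1 x"
        using geom_eq_conic_rep fanD(3)[OF fan] \<sigma> \<tau> by auto
      then have "w = w'" using fan_unique[OF fan] \<sigma> \<tau> by blast
      have "{v \<in> \<sigma>. 0 < w v} \<subseteq> \<sigma> \<inter> \<tau>"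
        using conic_repD(2)[OF w(2)] \<open>w = w'\<close> by force
      then have "conic_rep (\<sigma> \<inter> \<tau>) w 1 x"
        using conic_rep_mono[OF conic_rep_support[OF w(1) f\<sigma>]] f\<sigma> by blast
      then show "x \<in> geom (\<sigma> \<inter> \<tau>)" using geom_eq_conic_rep[of "\<sigma> \<inter> \<tau>"] f\<sigma> by blast
    qed
  qed
next
  show "(\<Union>\<sigma>\<in>K. geom \<sigma>) = PP n d"
    unfolding PP_eq[OF \<open>d \<ge> 1\<close>]
  proof
    show "(\<Union>\<sigma>\<in>K. geom \<sigma>) \<subseteq> dilate n d 1"
    proof
      fix x assume "x \<in> (\<Union>\<sigma>\<in>K. geom \<sigma>)"
      then obtain \<sigma> where \<sigma>: "\<sigma> \<in> K" "x \<in> geom \<sigma>" by blast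
      then obtain w where "conic_rep \<sigma> w 1 x" using geom_eq_conic_rep fanD(3)[OF fan] by auto
      then show "x \<in> dilate n d 1" using conic_rep_dilate fanD(4)[OF fan \<sigma>(1)] by blast
    qed
    show "dilate n d 1 \<subseteq> (\<Union>\<sigma>\<in>K. geom \<sigma>)"
    proof
      fix x assume "x \<in> dilate n d 1"
      then obtain \<sigma> w where w: "\<sigma> \<in> insert {} K" "conic_rep \<sigma> w 1 x"
        using fan_ex[OF fan, of 1 x] by auto
      then have "\<sigma> \<noteq> {}" using conic_repD(3)[OF w(2)] by auto
      then show "x \<in> (\<Union>\<sigma>\<in>K. geom \<sigma>)"
        using w geom_eq_conic_rep fanD(3)[OF fan] by blast
    qed
  qed
qed

text \<open>
  The barycentre of a simplex of the larger complex lies in some simplex of the smaller one, hence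
  in the intersection of the two; being in the relative interior, it forces the inclusion.
\<close>

lemma triangulation_subset_eq:
  assumes T: "triangulation n P T" and T': "triangulation n P T'" and "T \<subseteq> T'"
  shows "T = T'"
proof
  show "T' \<subseteq> T"
  proof
    fix \<sigma> assume \<sigma>: "\<sigma> \<in> T'"
    then have fin: "finite \<sigma>" "\<sigma> \<noteq> {}" and aff: "\<not> affine_dependent (emb ` \<sigma>)"
      using T' by (auto simp: triangulation_def)
    have inj: "inj_on emb \<sigma>" using inj_emb by (rule inj_on_subset) simp
    define w where "w v = (if v \<in> \<sigma> then 1 / real (card \<sigma>) else 0)" for v
    define x where "x i = (\<Sum>v\<in>\<sigma>. w v * real_of_int (v i))" for i
    have w: "conic_rep \<sigma> w 1 x"
      using fin by (intro conic_repI) (auto simp: w_def x_def)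
    then have x: "x \<in> geom \<sigma>" using geom_eq_conic_rep fin by blast
    then have "x \<in> P" using T' \<sigma> by (auto simp: triangulation_def)
    then obtain \<tau> where \<tau>: "\<tau> \<in> T" "x \<in> geom \<tau>" using T by (auto simp: triangulation_def)
    then have "x \<in> geom (\<sigma> \<inter> \<tau>)" using T' \<sigma> x \<open>T \<subseteq> T'\<close> unfolding triangulation_def by blast
    then obtain w' where "conic_rep (\<sigma> \<inter> \<tau>) w' 1 x" using geom_eq_conic_rep fin by blast
    then have w': "conic_rep \<sigma> w' 1 x" and z: "\<And>v. v \<notin> \<tau> \<Longrightarrow> w' v = 0"
      using conic_rep_mono[of _ w' 1 x \<sigma>] fin by (auto dest: conic_repD(2))
    have "\<sigma> \<subseteq> \<tau>"
    proof (rule ccontr)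
      assume "\<not> \<sigma> \<subseteq> \<tau>"
      then obtain v where v: "v \<in> \<sigma>" "v \<notin> \<tau>" by blast
      define U where "U y = w (inv emb y) - w' (inv emb y)" for y
      have U: "U (emb u) = w u - w' u" for u by (simp add: U_def inj_emb)
      have "sum U (emb ` \<sigma>) = 0"
        using conic_repD(3)[OF w] conic_repD(3)[OF w']
        by (simp add: sum.reindex[OF inj] U sum_subtractf)
      moreover have "(\<Sum>y\<in>emb ` \<sigma>. U y *\<^sub>R y) = 0"
      proof -
        have "(\<Sum>y\<in>emb ` \<sigma>. U y *\<^sub>R y) = (\<Sum>u\<in>\<sigma>. (w u - w' u) *\<^sub>R emb u)"
          by (simp add: sum.reindex[OF inj] U)
        also have "\<dots> = 0"
          using conic_repD(4)[OF w] conic_repD(4)[OF w']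
          by (simp add: fun_eq_iff sum_apply scaleR_apply emb_def left_diff_distrib sum_subtractf)
        finally show ?thesis .
      qed
      moreover have "U (emb v) \<noteq> 0" using v z fin by (auto simp: U w_def)
      ultimately have "affine_dependent (emb ` \<sigma>)"
        using v fin affine_dependent_explicit_finite[of "emb ` \<sigma>"] by blast
      then show False using aff by simp
    qed
    then show "\<sigma> \<in> T" using T \<tau>(1) fin(2) unfolding triangulation_def by blast
  qed
qed fact


section \<open>Gluing along staircases\<close>

definition raise :: "nat \<Rightarrow> lpoint \<Rightarrow> lpoint" where
  "raise m v = v + sbasis 1 (m+1)"

definition bottom :: "nat \<Rightarrow> lpoint set set \<Rightarrow> lpoint set set" where
  "bottom m K = {\<sigma> \<in> K. \<forall>v\<in>\<sigma>. v (m+1) = 0}"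

text \<open>
  Here \<open>\<alpha>\<close> is the upper part of a simplex of the layer, lowered to height \<open>0\<close>, and \<open>\<beta>\<close> its lower
  part. The condition says that some index separates the coordinates used by \<open>\<alpha>\<close> from those used by \<open>\<beta>\<close>
  (\<open>staircase_index\<close> below), that is, the simplex lies in one of the joins of faces in the definition
  of the two operations: \<open>s\<close> is increasing for \<open>K + L\<close> and decreasing for \<open>K + (-1)L\<close>.
\<close>

definition staircase :: "nat \<Rightarrow> nat \<Rightarrow> (nat \<Rightarrow> int) \<Rightarrow> lpoint set \<Rightarrow> lpoint set \<Rightarrow> bool" where
  "staircase m d s \<alpha> \<beta> \<longleftrightarrow> (\<forall>v\<in>\<alpha>. \<forall>u\<in>\<beta>. \<forall>j\<le>m. \<forall>k\<le>m.
     0 < bcoord m (real d) j (emb v) \<longrightarrow> 0 < bcoord m (real (d+1)) k (emb u) \<longrightarrow> s j \<le> s k)"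

text \<open>
  The raised copy of \<open>K\<close>, together with the joins of an upper simplex, taken from the bottom facet
  of \<open>K\<close>, with a lower simplex from \<open>L\<close>; either part may be empty.
\<close>

definition glue ::
  "(nat \<Rightarrow> int) \<Rightarrow> nat \<Rightarrow> nat \<Rightarrow> lpoint set set \<Rightarrow> lpoint set set \<Rightarrow> lpoint set set" where
  "glue s m d K L = (`) (raise m) ` K \<union>
     {raise m ` \<alpha> \<union> \<beta> |\<alpha> \<beta>. \<alpha> \<in> insert {} (bottom m K) \<and> \<beta> \<in> insert {} L \<and>
        raise m ` \<alpha> \<union> \<beta> \<noteq> {} \<and> staircase m d s \<alpha> \<beta>}"

lemma raise_apply: "raise m v i = (if i = m+1 then v i + 1 else v i)"
  by (auto simp: raise_def sbasis_def)

lemma inj_raise: "inj (raise m)"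
  by (auto simp: inj_def raise_def)

lemma inj_on_raise: "inj_on (raise m) A"
  using inj_raise by (rule inj_on_subset) simp

lemma conic_rep_raise:
  assumes "conic_rep \<sigma> w s x"
  shows "conic_rep (raise m ` \<sigma>) (\<lambda>v. w (v - sbasis 1 (m+1))) s (x(m+1 := x (m+1) + s))"
proof (rule conic_repI)
  have [simp]: "raise m v - sbasis 1 (m+1) = v" for v by (simp add: raise_def)
  show "0 \<le> w (v - sbasis 1 (m+1))" for v using conic_repD(1)[OF assms] .
  show "w (v - sbasis 1 (m+1)) = 0" if "v \<notin> raise m ` \<sigma>" for v
  proof (rule conic_repD(2)[OF assms])
    have "v = raise m (v - sbasis 1 (m+1))" by (simp add: raise_def)
    then show "v - sbasis 1 (m+1) \<notin> \<sigma>" using that by blast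
  qed
  show "(\<Sum>v\<in>raise m ` \<sigma>. w (v - sbasis 1 (m+1))) = s"
    using conic_repD(3)[OF assms] by (simp add: sum.reindex[OF inj_on_raise] del: One_nat_def)
  show "(\<Sum>v\<in>raise m ` \<sigma>. w (v - sbasis 1 (m+1)) * real_of_int (v i)) = (x(m+1 := x (m+1) + s)) i" for i
    using conic_repD(3)[OF assms] conic_repD(4)[OF assms, of i]
    by (cases "i = m+1")
      (simp_all add: sum.reindex[OF inj_on_raise] raise_apply distrib_left sum.distrib del: One_nat_def)
qed

lemma conic_rep_lower:
  assumes "conic_rep (raise m ` \<sigma>) w s x"
  shows "conic_rep \<sigma> (\<lambda>v. w (raise m v)) s (x(m+1 := x (m+1) - s))"
proof (rule conic_repI)
  show "0 \<le> w (raise m v)" for v using conic_repD(1)[OF assms] .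
  show "w (raise m v) = 0" if "v \<notin> \<sigma>" for v
    using that inj_raise by (intro conic_repD(2)[OF assms]) (auto simp: inj_def)
  show s: "(\<Sum>v\<in>\<sigma>. w (raise m v)) = s"
    using conic_repD(3)[OF assms] by (simp add: sum.reindex[OF inj_on_raise])
  show "(\<Sum>v\<in>\<sigma>. w (raise m v) * real_of_int (v i)) = (x(m+1 := x (m+1) - s)) i" for i
    using s conic_repD(4)[OF assms, of i]
    by (cases "i = m+1")
      (simp_all add: sum.reindex[OF inj_on_raise] raise_apply distrib_left sum.distrib)
qed

lemma conic_rep_add:
  assumes "conic_rep \<sigma> w s x" "conic_rep \<tau> w' s' x'" "finite \<sigma>" "finite \<tau>"
  shows "conic_rep (\<sigma> \<union> \<tau>) (\<lambda>v. w v + w' v) (s + s') (\<lambda>i. x i + x' i)"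
proof -
  have 1: "conic_rep (\<sigma> \<union> \<tau>) w s x" "conic_rep (\<sigma> \<union> \<tau>) w' s' x'"
    using conic_rep_mono[OF assms(1)] conic_rep_mono[OF assms(2)] assms(3,4) by simp_all
  show ?thesis
    by (rule conic_repI)
      (simp_all add: conic_repD[OF 1(1)] conic_repD[OF 1(2)] sum.distrib distrib_right)
qed

lemma conic_rep_zero_mass:
  assumes "conic_rep \<sigma> w 0 x" "finite \<sigma>"
  shows "w = (\<lambda>_. 0)"
proof
  fix v
  have "\<forall>v\<in>\<sigma>. w v = 0"
    using conic_repD(3)[OF assms(1)] conic_repD(1)[OF assms(1)] assms(2)
    by (simp add: sum_nonneg_eq_0_iff)
  then show "w v = 0" using conic_repD(2)[OF assms(1)] by (cases "v \<in> \<sigma>") auto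
qed

text \<open>
  Restricting to a fixed height turns the barycentric coordinates of \<open>P\<^sup>m\<^sup>+\<^sup>1\<close> into those of a smaller
  \<open>P\<^sup>m\<close>; this is why only the latter appear in the staircase condition.
\<close>

lemma bcoord_slice:
  "j \<le> m \<Longrightarrow> bcoord (m+1) r j x = bcoord m (r - x (m+1)) j x"
  by (simp add: bcoord_def)

lemma bcoord_cong:
  assumes "\<And>i. i \<in> {1..m} \<Longrightarrow> x i = y i" "j \<le> m"
  shows "bcoord m r j x = bcoord m r j y"
  using assms by (auto simp: bcoord_def intro!: sum.cong)

lemma bcoord_raise: "j \<le> m \<Longrightarrow> bcoord m r j (emb (raise m v)) = bcoord m r j (emb v)"
  by (rule bcoord_cong) (auto simp: emb_def raise_apply)

lemma dilate_slice:
  assumes "x (m+1) = 0"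
  shows "x \<in> dilate (m+1) d s \<longleftrightarrow> x \<in> dilate m d s"
proof -
  have *: "(\<forall>j\<le>m+1. 0 \<le> bcoord (m+1) (real d * s) j x) \<longleftrightarrow> (\<forall>j\<le>m. 0 \<le> bcoord m (real d * s) j x)"
    using assms bcoord_slice[of _ m "real d * s" x]
    by (auto simp: le_Suc_eq) (simp add: bcoord_def)
  have "(\<forall>i. i \<notin> {1..m+1} \<longrightarrow> x i = 0) \<longleftrightarrow> (\<forall>i. i \<notin> {1..m} \<longrightarrow> x i = 0)"
    using assms by (auto simp: le_Suc_eq)
  then show ?thesis using * by (simp add: dilate_def)
qed

lemma dilate_height:
  assumes "x \<in> dilate (m+1) d s"
  shows "0 \<le> x (m+1)"
  using assms by (auto simp: dilate_def bcoord_def dest: spec[of _ "m+1"])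

text \<open>
  If the two splittings differ, then \<open>f\<close> is larger than \<open>f'\<close> at some \<open>j\<close> and smaller at some \<open>k\<close>.
  The first splitting then gives \<open>s j \<le> s k\<close> and the second one \<open>s k \<le> s j\<close>.
\<close>

lemma staircase_split_unique:
  fixes f g f' g' :: "nat \<Rightarrow> real" and s :: "nat \<Rightarrow> int"
  assumes "finite A" "inj_on s A"
    and nn: "\<And>j. j \<in> A \<Longrightarrow> 0 \<le> f j" "\<And>j. j \<in> A \<Longrightarrow> 0 \<le> g j"
      "\<And>j. j \<in> A \<Longrightarrow> 0 \<le> f' j" "\<And>j. j \<in> A \<Longrightarrow> 0 \<le> g' j"
    and eq: "\<And>j. j \<in> A \<Longrightarrow> f j + g j = f' j + g' j" and sum: "sum f A = sum f' A"
    and st: "\<And>j k. j \<in> A \<Longrightarrow> k \<in> A \<Longrightarrow> 0 < f j \<Longrightarrow> 0 < g k \<Longrightarrow> s j \<le> s k"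
      "\<And>j k. j \<in> A \<Longrightarrow> k \<in> A \<Longrightarrow> 0 < f' j \<Longrightarrow> 0 < g' k \<Longrightarrow> s j \<le> s k"
    and "j \<in> A"
  shows "f j = f' j"
proof -
  have *: False if j: "j \<in> A" "f' j < f j" for j
  proof -
    have "\<exists>k\<in>A. f k < f' k"
    proof (rule ccontr)
      assume "\<not> ?thesis"
      then have "sum f' A < sum f A" using j \<open>finite A\<close> by (intro sum_strict_mono_ex1) force+
      then show False using sum by simp
    qed
    then obtain k where k: "k \<in> A" "f k < f' k" by blast
    have "s j \<le> s k" using j k nn(3)[of j] nn(4)[of k] eq[of k] by (intro st(1)) auto
    moreover have "s k \<le> s j" using j k nn(1)[of k] nn(2)[of j] eq[of j] by (intro st(2)) auto
    ultimately have "j = k" using inj_onD[OF \<open>inj_on s A\<close>] j k by simp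
    then show False using j k by simp
  qed
  have **: False if k: "k \<in> A" "f k < f' k" for k
  proof -
    have "\<exists>j\<in>A. f' j < f j"
    proof (rule ccontr)
      assume "\<not> ?thesis"
      then have "sum f A < sum f' A" using k \<open>finite A\<close> by (intro sum_strict_mono_ex1) force+
      then show False using sum by simp
    qed
    then show False using * by blast
  qed
  show ?thesis using *[OF \<open>j \<in> A\<close>] **[OF \<open>j \<in> A\<close>] by (meson linorder_neqE)
qed

text \<open>
  The mass \<open>c\<close> is filled greedily into the entries of \<open>y\<close> in the order given by \<open>s\<close> (the northwest
  corner rule).
\<close>

lemma staircase_split_exists:
  fixes y :: "nat \<Rightarrow> real" and s :: "nat \<Rightarrow> int"
  assumes "finite A" "\<And>j. j \<in> A \<Longrightarrow> 0 \<le> y j" "0 \<le> c" "c \<le> sum y A"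
  shows "\<exists>f g. (\<forall>j\<in>A. 0 \<le> f j \<and> 0 \<le> g j \<and> f j + g j = y j) \<and> sum f A = c \<and>
    (\<forall>j\<in>A. \<forall>k\<in>A. 0 < f j \<longrightarrow> 0 < g k \<longrightarrow> s j \<le> s k)"
  using assms
proof (induction A arbitrary: c rule: finite_ranking_induct[where f = s])
  case empty
  then show ?case by auto
next
  case (insert M A)
  show ?case
  proof (cases "M \<in> A")
    case True
    then show ?thesis using insert by (simp add: insert_absorb)
  next
    case False
    show ?thesis
    proof (cases "c \<le> sum y A")
      case True
      then obtain f g where fg: "\<forall>j\<in>A. 0 \<le> f j \<and> 0 \<le> g j \<and> f j + g j = y j" "sum f A = c"
        "\<forall>j\<in>A. \<forall>k\<in>A. 0 < f j \<longrightarrow> 0 < g k \<longrightarrow> s j \<le> s k"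
        using insert.IH[of c] insert.prems by auto
      have "sum (f(M := 0)) A = sum f A" using False by (intro sum.cong) auto
      then show ?thesis
        using fg False insert by (intro exI[of _ "f(M := 0)"] exI[of _ "g(M := y M)"]) auto
    next
      case c: False
      (* everything below the last index is filled, the rest goes to that index *)
      define f where "f = (\<lambda>j. if j = M then c - sum y A else y j)"
      define g where "g = (\<lambda>j. if j = M then sum y A + y M - c else 0)"
      have "sum f A = sum y A" using False by (intro sum.cong) (auto simp: f_def)
      then have "sum f (insert M A) = c" using False insert by (simp add: f_def)
      then show ?thesis
        using c False insert by (intro exI[of _ f] exI[of _ g]) (auto simp: f_def g_def)
    qed
  qed
qed

lemma staircase_mono:
  "staircase m d s \<alpha> \<beta> \<Longrightarrow> \<alpha>' \<subseteq> \<alpha> \<Longrightarrow> \<beta>' \<subseteq> \<beta> \<Longrightarrow> staircase m d s \<alpha>' \<beta>'"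
  unfolding staircase_def by blast

lemma bottom_dilate:
  assumes "simplicial_fan (m+1) d K" "\<alpha> \<in> insert {} (bottom m K)"
  shows "emb ` \<alpha> \<subseteq> dilate m d 1"
proof
  fix x assume "x \<in> emb ` \<alpha>"
  then obtain v where v: "v \<in> \<alpha>" "x = emb v" by blast
  then have \<alpha>: "\<alpha> \<in> K" "v (m+1) = 0" using assms(2) by (auto simp: bottom_def)
  then have "x \<in> dilate (m+1) d 1" using fanD(4)[OF assms(1)] v by blast
  then show "x \<in> dilate m d 1" using dilate_slice[of x m d 1] v \<alpha> by (simp add: emb_def)
qed

text \<open>
  The vertices of the upper part have height one and those of the lower part height zero, so the mass
  of the upper part is the height of the point.
\<close>

lemma layer_split:
  assumes w: "conic_rep (raise m ` \<alpha> \<union> \<beta>) w s x" and fin: "finite \<alpha>" "finite \<beta>"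
    and flat: "\<forall>v\<in>\<alpha>. v (m+1) = 0" "\<forall>v\<in>\<beta>. v (m+1) = 0"
  obtains p q where
    "conic_rep \<alpha> (\<lambda>v. if v \<in> \<alpha> then w (raise m v) else 0) (x (m+1)) p"
    "conic_rep \<beta> (\<lambda>v. if v \<in> \<beta> then w v else 0) (s - x (m+1)) q"
    "\<forall>i. i \<noteq> m+1 \<longrightarrow> x i = p i + q i"
proof -
  note h = flat[rule_format]
  define p where "p i = (\<Sum>v\<in>\<alpha>. w (raise m v) * real_of_int (v i))" for i
  define q where "q i = (\<Sum>v\<in>\<beta>. w v * real_of_int (v i))" for i
  have disj: "raise m ` \<alpha> \<inter> \<beta> = {}"
  proof -
    have "raise m v \<notin> \<beta>" if "v \<in> \<alpha>" for v
      using h(1)[OF that] h(2)[of "raise m v"] by (auto simp: raise_apply)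
    then show ?thesis by blast
  qed
  have split: "(\<Sum>v\<in>raise m ` \<alpha> \<union> \<beta>. f v) = (\<Sum>v\<in>\<alpha>. f (raise m v)) + sum f \<beta>"
    for f :: "lpoint \<Rightarrow> real"
    using fin disj by (simp add: sum.union_disjoint sum.reindex[OF inj_on_raise])
  have x: "x i = (\<Sum>v\<in>\<alpha>. w (raise m v) * real_of_int (raise m v i)) + q i" for i
    using conic_repD(4)[OF w, of i] by (simp add: split q_def)
  have q0: "q (m+1) = 0" unfolding q_def using h(2) by (intro sum.neutral) auto
  have t: "(\<Sum>v\<in>\<alpha>. w (raise m v)) = x (m+1)"
  proof -
    have "x (m+1) = (\<Sum>v\<in>\<alpha>. w (raise m v) * real_of_int (raise m v (m+1)))"
      using x[of "m+1"] q0 by simp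
    also have "\<dots> = (\<Sum>v\<in>\<alpha>. w (raise m v))"
      using h(1) by (intro sum.cong) (auto simp: raise_apply)
    finally show ?thesis by simp
  qed
  have 1: "conic_rep \<alpha> (\<lambda>v. if v \<in> \<alpha> then w (raise m v) else 0) (x (m+1)) p"
    using conic_repD(1)[OF w] t by (intro conic_repI) (auto simp: p_def)
  have "(\<Sum>v\<in>\<beta>. w v) = s - x (m+1)" using conic_repD(3)[OF w] t by (simp add: split)
  then have 2: "conic_rep \<beta> (\<lambda>v. if v \<in> \<beta> then w v else 0) (s - x (m+1)) q"
    using conic_repD(1)[OF w] by (intro conic_repI) (auto simp: q_def)
  have 3: "x i = p i + q i" if "i \<noteq> m+1" for i
    using x[of i] that by (simp add: raise_apply p_def)
  show ?thesis using that 1 2 3 by blast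
qed

lemma bcoord_pos_vertex:
  assumes "conic_rep \<sigma> w s x" "0 < bcoord m (r * s) j x"
  obtains v where "v \<in> \<sigma>" "0 < bcoord m r j (emb v)"
proof -
  have "\<not> (\<forall>v\<in>\<sigma>. w v * bcoord m r j (emb v) \<le> 0)"
    using assms(2) sum_nonpos[of \<sigma> "\<lambda>v. w v * bcoord m r j (emb v)"]
    unfolding bcoord_conic_rep[OF assms(1)] by force
  then obtain v where "v \<in> \<sigma>" "0 < w v * bcoord m r j (emb v)" by force
  then show ?thesis using that conic_repD(1)[OF assms(1), of v] by (auto simp: zero_less_mult_iff)
qed

text \<open>
  Both weights split the point into an upper and a lower point. By the staircase condition the two
  splittings agree, and each half has a unique weight in \<open>K\<close> or in \<open>L\<close>.
\<close>

lemma layer_unique: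
  assumes K: "simplicial_fan (m+1) d K" and L: "simplicial_fan m (d+1) L" and s: "inj_on s {..m}"
    and \<alpha>: "\<alpha> \<in> insert {} (bottom m K)" "\<alpha>' \<in> insert {} (bottom m K)"
    and \<beta>: "\<beta> \<in> insert {} L" "\<beta>' \<in> insert {} L"
    and st: "staircase m d s \<alpha> \<beta>" "staircase m d s \<alpha>' \<beta>'"
    and w: "conic_rep (raise m ` \<alpha> \<union> \<beta>) w r x" and w': "conic_rep (raise m ` \<alpha>' \<union> \<beta>') w' r x"
  shows "w = w'"
proof -
  have \<alpha>K: "\<alpha> \<in> insert {} K" "\<alpha>' \<in> insert {} K" using \<alpha> by (auto simp: bottom_def)
  have fin: "finite \<alpha>" "finite \<alpha>'" "finite \<beta>" "finite \<beta>'"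
    using \<alpha>K \<beta> fanD(3)[OF K] fanD(3)[OF L] by auto
  have d: "emb ` \<alpha> \<subseteq> dilate m d 1" "emb ` \<alpha>' \<subseteq> dilate m d 1"
    using bottom_dilate[OF K] \<alpha> by blast+
  have e: "emb ` \<beta> \<subseteq> dilate m (d+1) 1" "emb ` \<beta>' \<subseteq> dilate m (d+1) 1"
    using fanD(4)[OF L] \<beta> by auto
  have h: "v (m+1) = 0" if "v \<in> \<alpha> \<or> v \<in> \<alpha>' \<or> v \<in> \<beta> \<or> v \<in> \<beta>'" for v
  proof -
    have "emb v \<in> dilate m d 1 \<or> emb v \<in> dilate m (d+1) 1" using that d e by blast
    then show ?thesis by (force simp: dilate_def emb_def)
  qed
  define t where "t = x (m+1)"
  have ha: "\<forall>v\<in>\<alpha>. v (m+1) = 0" "\<forall>v\<in>\<beta>. v (m+1) = 0"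
    "\<forall>v\<in>\<alpha>'. v (m+1) = 0" "\<forall>v\<in>\<beta>'. v (m+1) = 0"
    using h by blast+
  obtain p q where S1: "conic_rep \<alpha> (\<lambda>v. if v \<in> \<alpha> then w (raise m v) else 0) t p"
    "conic_rep \<beta> (\<lambda>v. if v \<in> \<beta> then w v else 0) (r - t) q"
    "\<forall>i. i \<noteq> m+1 \<longrightarrow> x i = p i + q i"
    unfolding t_def by (rule layer_split[OF w fin(1,3) ha(1,2)])
  obtain p' q' where S1': "conic_rep \<alpha>' (\<lambda>v. if v \<in> \<alpha>' then w' (raise m v) else 0) t p'"
    "conic_rep \<beta>' (\<lambda>v. if v \<in> \<beta>' then w' v else 0) (r - t) q'"
    "\<forall>i. i \<noteq> m+1 \<longrightarrow> x i = p' i + q' i"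
    unfolding t_def by (rule layer_split[OF w' fin(2,4) ha(3,4)])
  have dp: "p \<in> dilate m d t" "p' \<in> dilate m d t" "q \<in> dilate m (d+1) (r-t)" "q' \<in> dilate m (d+1) (r-t)"
    using conic_rep_dilate[OF S1(1) d(1)] conic_rep_dilate[OF S1'(1) d(2)]
      conic_rep_dilate[OF S1(2) e(1)] conic_rep_dilate[OF S1'(2) e(2)] by blast+
  have add: "bcoord m a j p + bcoord m b j q = bcoord m (a+b) j x"
    "bcoord m a j p' + bcoord m b j q' = bcoord m (a+b) j x" if "j \<le> m" for a b j
  proof -
    have "(\<Sum>i\<in>{1..m}. x i) = (\<Sum>i\<in>{1..m}. p i) + (\<Sum>i\<in>{1..m}. q i)"
      "(\<Sum>i\<in>{1..m}. x i) = (\<Sum>i\<in>{1..m}. p' i) + (\<Sum>i\<in>{1..m}. q' i)"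
      unfolding sum.distrib[symmetric] by (auto intro!: sum.cong S1(3)[rule_format] S1'(3)[rule_format])
    then show "bcoord m a j p + bcoord m b j q = bcoord m (a+b) j x"
      "bcoord m a j p' + bcoord m b j q' = bcoord m (a+b) j x"
      using S1(3)[rule_format, of j] S1'(3)[rule_format, of j] that by (auto simp: bcoord_def)
  qed
  (* both pairs of coordinate vectors are staircase splittings of the same vector *)
  have bp: "bcoord m (d * t) j p = bcoord m (d * t) j p'" if "j \<in> {..m}" for j
  proof (rule staircase_split_unique[OF finite_atMost s _ _ _ _ _ _ _ _ that])
    show "(\<Sum>j\<le>m. bcoord m (d * t) j p) = (\<Sum>j\<le>m. bcoord m (d * t) j p')"
      by (simp only: sum_bcoord)
    show "bcoord m (d * t) j p + bcoord m ((d+1) * (r - t)) j q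
        = bcoord m (d * t) j p' + bcoord m ((d+1) * (r - t)) j q'" if "j \<in> {..m}" for j
      using add[of j] that by simp
    show "s j \<le> s k" if jk: "j \<in> {..m}" "k \<in> {..m}" "0 < bcoord m (d * t) j p"
      "0 < bcoord m ((d+1) * (r - t)) k q" for j k
    proof -
      obtain v where "v \<in> \<alpha>" "0 < bcoord m d j (emb v)"
        by (rule bcoord_pos_vertex[OF S1(1) jk(3)])
      moreover obtain u where "u \<in> \<beta>" "0 < bcoord m (real (d+1)) k (emb u)"
        by (rule bcoord_pos_vertex[OF S1(2) jk(4)])
      ultimately show ?thesis using st(1) jk(1,2) unfolding staircase_def by blast
    qed
    show "s j \<le> s k" if jk: "j \<in> {..m}" "k \<in> {..m}" "0 < bcoord m (d * t) j p'"
      "0 < bcoord m ((d+1) * (r - t)) k q'" for j k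
    proof -
      obtain v where "v \<in> \<alpha>'" "0 < bcoord m d j (emb v)"
        by (rule bcoord_pos_vertex[OF S1'(1) jk(3)])
      moreover obtain u where "u \<in> \<beta>'" "0 < bcoord m (real (d+1)) k (emb u)"
        by (rule bcoord_pos_vertex[OF S1'(2) jk(4)])
      ultimately show ?thesis using st(2) jk(1,2) unfolding staircase_def by blast
    qed
  qed (use dp in \<open>auto simp: dilate_def\<close>)
  have "p = p'"
  proof (rule bcoord_ext[of m p p' "d * t"])
    show "p i = p' i" if "i \<notin> {1..m}" for i using dp(1,2) that by (simp add: dilate_def)
  qed (use bp in auto)
  moreover have "q = q'"
  proof
    fix i show "q i = q' i"
    proof (cases "i = m+1")
      case True
      then show ?thesis using dp(3,4) by (simp add: dilate_def)
    next
      case False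
      then show ?thesis using S1(3)[rule_format, of i] S1'(3)[rule_format, of i] \<open>p = p'\<close> by simp
    qed
  qed
  ultimately have wa: "(\<lambda>v. if v \<in> \<alpha> then w (raise m v) else 0) = (\<lambda>v. if v \<in> \<alpha>' then w' (raise m v) else 0)"
    and wb: "(\<lambda>v. if v \<in> \<beta> then w v else 0) = (\<lambda>v. if v \<in> \<beta>' then w' v else 0)"
    using fan_unique[OF K \<alpha>K S1(1)] S1'(1) fan_unique[OF L \<beta> S1(2)] S1'(2) by simp_all
  show "w = w'"
  proof
    fix v
    have *: "u v = (if v \<in> B then u v else 0) +
        (if v - sbasis 1 (m+1) \<in> A then u (raise m (v - sbasis 1 (m+1))) else 0)"
      if "conic_rep (raise m ` A \<union> B) u r x" "\<And>v. v \<in> A \<Longrightarrow> v (m+1) = 0" "\<And>v. v \<in> B \<Longrightarrow> v (m+1) = 0"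
      for u A B
    proof -
      have r: "raise m (v - sbasis 1 (m+1)) = v" by (simp add: raise_def)
      show ?thesis
      proof (cases "v \<in> B")
        case True
        have "v - sbasis 1 (m+1) \<notin> A"
          using that(2)[of "v - sbasis 1 (m+1)"] that(3)[OF True] by (auto simp: sbasis_def)
        then show ?thesis using True by simp
      next
        case False
        then show ?thesis
        proof (cases "v - sbasis 1 (m+1) \<in> A")
          case False
          then have "v \<notin> raise m ` A" by (auto simp: raise_def)
          then show ?thesis using False \<open>v \<notin> B\<close> conic_repD(2)[OF that(1), of v] by simp
        qed (use r \<open>v \<notin> B\<close> in simp)
      qed
    qed
    show "w v = w' v"
      using *[OF w] *[OF w'] h fun_cong[OF wa, of "v - sbasis 1 (m+1)"] fun_cong[OF wb, of v] by simp
  qed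
qed


lemma glue_cases:
  assumes "\<sigma> \<in> glue s m d K L"
  obtains \<sigma>0 where "\<sigma>0 \<in> K" "\<sigma> = raise m ` \<sigma>0"
  | \<alpha> \<beta> where "\<sigma> = raise m ` \<alpha> \<union> \<beta>" "\<alpha> \<in> insert {} (bottom m K)" "\<beta> \<in> insert {} L"
      "staircase m d s \<alpha> \<beta>" "raise m ` \<alpha> \<union> \<beta> \<noteq> {}"
  using assms unfolding glue_def by blast

lemma glue_layerI:
  assumes "\<alpha> \<in> insert {} (bottom m K)" "\<beta> \<in> insert {} L" "staircase m d s \<alpha> \<beta>"
  shows "raise m ` \<alpha> \<union> \<beta> \<in> insert {} (glue s m d K L)"
  using assms unfolding glue_def by blast

lemma glue_raiseI: "\<sigma> \<in> K \<Longrightarrow> raise m ` \<sigma> \<in> glue s m d K L"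
  unfolding glue_def by blast

lemma dilate_raise:
  assumes "x \<in> dilate (m+1) d r" "0 \<le> r"
  shows "x(m+1 := x (m+1) + r) \<in> dilate (m+1) (d+1) r"
proof -
  let ?y = "x(m+1 := x (m+1) + r)"
  have s: "(\<Sum>i\<in>{1..m+1}. ?y i) = (\<Sum>i\<in>{1..m+1}. x i) + r" by simp
  have "0 \<le> bcoord (m+1) (real (d+1) * r) j ?y" if "j \<le> m+1" for j
  proof (cases "j = 0")
    case True
    have "0 \<le> bcoord (m+1) (real d * r) 0 x" using assms by (auto simp: dilate_def)
    then show ?thesis using s True by (simp add: bcoord_def algebra_simps)
  next
    case False
    have "0 \<le> bcoord (m+1) (real d * r) j x" using assms that by (auto simp: dilate_def)
    then show ?thesis using False assms(2) by (cases "j = m+1") (simp_all add: bcoord_def)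
  qed
  then show ?thesis using assms by (auto simp: dilate_def)
qed

lemma dilate_lower:
  assumes "x \<in> dilate (m+1) (d+1) r" "r \<le> x (m+1)"
  shows "x(m+1 := x (m+1) - r) \<in> dilate (m+1) d r"
proof -
  let ?y = "x(m+1 := x (m+1) - r)"
  have s: "(\<Sum>i\<in>{1..m+1}. ?y i) = (\<Sum>i\<in>{1..m+1}. x i) - r" by simp
  have "0 \<le> bcoord (m+1) (real d * r) j ?y" if "j \<le> m+1" for j
  proof (cases "j = 0")
    case True
    have "0 \<le> bcoord (m+1) (real (d+1) * r) 0 x" using assms by (auto simp: dilate_def)
    then show ?thesis using s True by (simp add: bcoord_def algebra_simps)
  next
    case False
    have "0 \<le> bcoord (m+1) (real (d+1) * r) j x" using assms that by (auto simp: dilate_def)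
    then show ?thesis using False assms(2) by (simp add: bcoord_def)
  qed
  then show ?thesis using assms by (auto simp: dilate_def)
qed

lemma raise_emb: "emb (raise m v) = (emb v)(m+1 := emb v (m+1) + 1)"
  by (auto simp: fun_eq_iff emb_def raise_apply)

lemma raise_dilate:
  assumes "emb ` \<sigma> \<subseteq> dilate (m+1) d 1"
  shows "emb ` raise m ` \<sigma> \<subseteq> dilate (m+1) (d+1) 1"
  using assms dilate_raise[of _ m d 1] by (auto simp: raise_emb)

lemma dilate_slice_subset: "dilate m d s \<subseteq> dilate (m+1) d s"
proof
  fix x assume x: "x \<in> dilate m d s"
  then have "x (m+1) = 0" by (auto simp: dilate_def)
  then show "x \<in> dilate (m+1) d s" using x dilate_slice by blast
qed

text \<open>
  The coordinates of the point are split greedily into an upper and a lower point, which are then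
  represented in the bottom facet of \<open>K\<close> and in \<open>L\<close>. A coordinate of one of these points is positive as
  soon as it is positive at a vertex of positive weight, so the vertices inherit the staircase
  condition.
\<close>

lemma layer_exists:
  assumes K: "simplicial_fan (m+1) d K" and L: "simplicial_fan m (d+1) L"
    and x: "x \<in> dilate (m+1) (d+1) r" "x (m+1) \<le> r"
  obtains \<alpha> \<beta> w where "\<alpha> \<in> insert {} (bottom m K)" "\<beta> \<in> insert {} L" "staircase m d s \<alpha> \<beta>"
    "conic_rep (raise m ` \<alpha> \<union> \<beta>) w r x"
proof -
  define t where "t = x (m+1)"
  define y where "y j = bcoord (m+1) (real (d+1) * r) j x" for j
  have t: "0 \<le> t" using dilate_height[OF x(1)] by (simp add: t_def)
  have y: "y j = bcoord m (d * t + (d+1) * (r - t)) j x" if "j \<le> m" for j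
    using bcoord_slice[OF that, of "real (d+1) * r" x] unfolding y_def t_def
    by (simp add: algebra_simps)
  have "0 \<le> y j" if "j \<in> {..m}" for j using x(1) that by (auto simp: y_def dilate_def)
  moreover have sy: "sum y {..m} = d * t + (d+1) * (r - t)"
    using y sum_bcoord[of m "d * t + (d+1) * (r - t)" x] by simp
  moreover have "0 \<le> (d+1) * (r - t)" using x(2) by (simp add: t_def)
  ultimately have "\<exists>f g. (\<forall>j\<in>{..m}. 0 \<le> f j \<and> 0 \<le> g j \<and> f j + g j = y j) \<and>
      sum f {..m} = d * t \<and> (\<forall>j\<in>{..m}. \<forall>k\<in>{..m}. 0 < f j \<longrightarrow> 0 < g k \<longrightarrow> s j \<le> s k)"
    using t by (intro staircase_split_exists) auto
  then obtain f g where F: "\<forall>j\<in>{..m}. 0 \<le> f j \<and> 0 \<le> g j \<and> f j + g j = y j"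
    and sf: "sum f {..m} = d * t"
    and S: "\<forall>j\<in>{..m}. \<forall>k\<in>{..m}. 0 < f j \<longrightarrow> 0 < g k \<longrightarrow> s j \<le> s k"
    by blast
  have fg: "0 \<le> f j" "0 \<le> g j" "f j + g j = y j" if "j \<le> m" for j using F that by auto
  have st: "s j \<le> s k" if "j \<le> m" "k \<le> m" "0 < f j" "0 < g k" for j k using S that by auto
  have sg: "sum g {..m} = (d+1) * (r - t)"
  proof -
    have "sum f {..m} + sum g {..m} = sum y {..m}"
      unfolding sum.distrib[symmetric] using fg(3) by (intro sum.cong) auto
    then show ?thesis using sf sy by simp
  qed
  (* the coordinate of index 0 is recovered from the total mass *)
  define p where "p i = (if i \<in> {1..m} then f i else 0)" for i
  define q where "q i = (if i \<in> {1..m} then g i else 0)" for i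
  have split0: "sum h {..m} = h 0 + (\<Sum>i\<in>{1..m}. h i)" for h :: "nat \<Rightarrow> real"
    by (simp add: atMost_atLeast0 sum.atLeast_Suc_atMost)
  have bp: "bcoord m (d * t) j p = f j" if "j \<le> m" for j
    using that sf split0[of f] by (auto simp: bcoord_def p_def)
  have bq: "bcoord m ((d+1) * (r - t)) j q = g j" if "j \<le> m" for j
    using that sg split0[of g] by (auto simp: bcoord_def q_def)
  have "p \<in> dilate m d t" using bp fg(1) by (auto simp: dilate_def p_def)
  then have "p \<in> dilate (m+1) d t" using dilate_slice_subset by blast
  then obtain \<alpha> w1 where \<alpha>: "\<alpha> \<in> insert {} K" "conic_rep \<alpha> w1 t p" "\<And>v. v \<in> \<alpha> \<Longrightarrow> 0 < w1 v"
    by (rule fan_ex_support[OF K t]) blast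
  have "q \<in> dilate m (d+1) (r - t)" using bq fg(2) by (auto simp: dilate_def q_def)
  moreover have "0 \<le> r - t" using x(2) by (simp add: t_def)
  ultimately obtain \<beta> w2 where \<beta>: "\<beta> \<in> insert {} L" "conic_rep \<beta> w2 (r - t) q" "\<And>v. v \<in> \<beta> \<Longrightarrow> 0 < w2 v"
    using fan_ex_support[OF L] by metis
  have fin: "finite \<alpha>" "finite \<beta>" using \<alpha>(1) \<beta>(1) fanD(3)[OF K] fanD(3)[OF L] by auto
  have \<alpha>d: "emb v \<in> dilate (m+1) d 1" if "v \<in> \<alpha>" for v
    using fanD(4)[OF K, of \<alpha>] \<alpha>(1) that by auto
  have \<alpha>b: "\<alpha> \<in> insert {} (bottom m K)"
  proof -
    have nn: "0 \<le> real_of_int (v (m+1))" if "v \<in> \<alpha>" for v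
      using dilate_height[OF \<alpha>d[OF that]] by (simp add: emb_def)
    have "(\<Sum>v\<in>\<alpha>. w1 v * real_of_int (v (m+1))) = 0"
      using conic_repD(4)[OF \<alpha>(2), of "m+1"] by (simp add: p_def)
    then have "\<forall>v\<in>\<alpha>. w1 v * real_of_int (v (m+1)) = 0"
      using nn conic_repD(1)[OF \<alpha>(2)] fin(1) by (subst (asm) sum_nonneg_eq_0_iff) auto
    then have "v (m+1) = 0" if "v \<in> \<alpha>" for v using \<alpha>(3)[OF that] that by auto
    then show ?thesis using \<alpha>(1) by (auto simp: bottom_def)
  qed
  have "staircase m d s \<alpha> \<beta>"
    unfolding staircase_def
  proof (intro ballI allI impI)
    fix v u j k assume v: "v \<in> \<alpha>" and u: "u \<in> \<beta>" and j: "j \<le> m" and k: "k \<le> m"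
      and pos: "0 < bcoord m (real d) j (emb v)" "0 < bcoord m (real (d+1)) k (emb u)"
    have "emb ` \<alpha> \<subseteq> dilate m d 1" by (rule bottom_dilate[OF K \<alpha>b])
    then have "0 < (\<Sum>v\<in>\<alpha>. w1 v * bcoord m (real d) j (emb v))"
      using v pos(1) \<alpha>(3) fin(1) j by (intro sum_pos2[of \<alpha> v]) (auto simp: dilate_def less_imp_le)
    then have "0 < f j" using bcoord_conic_rep[OF \<alpha>(2), of m "real d" j] bp[OF j] by simp
    moreover have "emb ` \<beta> \<subseteq> dilate m (d+1) 1" using fanD(4)[OF L, of \<beta>] \<beta>(1) by auto
    then have "0 < (\<Sum>v\<in>\<beta>. w2 v * bcoord m (real (d+1)) k (emb v))"
      using u pos(2) \<beta>(3) fin(2) k by (intro sum_pos2[of \<beta> u]) (auto simp: dilate_def less_imp_le)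
    then have "0 < g k" using bcoord_conic_rep[OF \<beta>(2), of m "real (d+1)" k] bq[OF k] by simp
    ultimately show "s j \<le> s k" by (intro st j k)
  qed
  moreover have "(\<lambda>i. (p(m+1 := p (m+1) + t)) i + q i) = x"
  proof
    fix i show "(p(m+1 := p (m+1) + t)) i + q i = x i"
    proof (cases "i \<in> {1..m}")
      case True
      then show ?thesis using fg(3)[of i] by (auto simp: p_def q_def y_def bcoord_def)
    next
      case False
      then show ?thesis using x(1) by (auto simp: p_def q_def t_def dilate_def)
    qed
  qed
  then have "conic_rep (raise m ` \<alpha> \<union> \<beta>) (\<lambda>v. w1 (v - sbasis 1 (m+1)) + w2 v) r x"
    using conic_rep_add[OF conic_rep_raise[OF \<alpha>(2), of m] \<beta>(2)] fin by simp
  ultimately show ?thesis using that \<alpha>b \<beta>(1) by blast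
qed

text \<open>
  A point whose height is at least its mass is represented in the raised copy of \<open>K\<close>, a lower one in
  the layer; a point represented in both has height equal to its mass, whence the lower part of its
  weight vanishes and both weights live in the raised copy.
\<close>

theorem fan_glue:
  assumes K: "simplicial_fan (m+1) d K" and L: "simplicial_fan m (d+1) L" and s: "inj_on s {..m}"
  shows "simplicial_fan (m+1) (d+1) (glue s m d K L)"
  unfolding simplicial_fan_def
proof (intro conjI)
  let ?T = "glue s m d K L"
  have bot: "\<alpha> \<in> insert {} K" if "\<alpha> \<in> insert {} (bottom m K)" for \<alpha>
    using that by (auto simp: bottom_def)
  have "?T \<subseteq> (`) (raise m) ` K \<union> (\<lambda>(\<alpha>, \<beta>). raise m ` \<alpha> \<union> \<beta>) ` (insert {} (bottom m K) \<times> insert {} L)"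
    unfolding glue_def by auto
  moreover have "finite (bottom m K)" using fanD(1)[OF K] by (auto simp: bottom_def)
  ultimately show "finite ?T"
    using fanD(1)[OF K] fanD(1)[OF L] by (auto intro: finite_subset)
  show "{} \<notin> ?T" using fanD(2)[OF K] by (auto simp: glue_def)
  show "\<forall>\<sigma>\<in>?T. finite \<sigma> \<and> emb ` \<sigma> \<subseteq> dilate (m+1) (d+1) 1"
  proof
    fix \<sigma> assume "\<sigma> \<in> ?T"
    then show "finite \<sigma> \<and> emb ` \<sigma> \<subseteq> dilate (m+1) (d+1) 1"
    proof (cases rule: glue_cases)
      case (1 \<sigma>0)
      then show ?thesis using fanD(3,4)[OF K] raise_dilate[of \<sigma>0 m d] by simp
    next
      case (2 \<alpha> \<beta>)
      have "finite \<alpha>" "emb ` \<alpha> \<subseteq> dilate (m+1) d 1"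
        using bot[OF 2(2)] fanD(3,4)[OF K] by auto
      moreover have "finite \<beta>" "emb ` \<beta> \<subseteq> dilate m (d+1) 1" using 2(3) fanD(3,4)[OF L] by auto
      ultimately show ?thesis
        using raise_dilate[of \<alpha> m d] dilate_slice_subset[of m "d+1" 1] unfolding 2(1) image_Un by blast
    qed
  qed
  show "\<forall>\<sigma>\<in>?T. \<forall>\<tau>. \<tau> \<subseteq> \<sigma> \<and> \<tau> \<noteq> {} \<longrightarrow> \<tau> \<in> ?T"
  proof (intro ballI allI impI)
    fix \<sigma> \<tau> assume \<sigma>: "\<sigma> \<in> ?T" and \<tau>: "\<tau> \<subseteq> \<sigma> \<and> \<tau> \<noteq> {}"
    from \<sigma> show "\<tau> \<in> ?T"
    proof (cases rule: glue_cases)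
      case (1 \<sigma>0)
      then obtain \<tau>0 where "\<tau>0 \<subseteq> \<sigma>0" "\<tau> = raise m ` \<tau>0" using \<tau> by (auto simp: subset_image_iff)
      then show ?thesis using fanD(5)[OF K 1(1), of \<tau>0] \<tau> glue_raiseI by auto
    next
      case (2 \<alpha> \<beta>)
      define \<alpha>' where "\<alpha>' = {v \<in> \<alpha>. raise m v \<in> \<tau>}"
      have e: "\<tau> = raise m ` \<alpha>' \<union> (\<tau> \<inter> \<beta>)" using \<tau> 2(1) by (auto simp: \<alpha>'_def)
      have "\<alpha>' \<in> insert {} (bottom m K)"
      proof (cases "\<alpha>' = {}")
        case False
        then have "\<alpha> \<in> bottom m K" using 2(2) by (auto simp: \<alpha>'_def)
        then show ?thesis using fanD(5)[OF K, of \<alpha> \<alpha>'] False by (auto simp: bottom_def \<alpha>'_def)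
      qed simp
      moreover have "\<tau> \<inter> \<beta> \<in> insert {} L"
        using 2(3) fanD(5)[OF L, of \<beta> "\<tau> \<inter> \<beta>"] by auto
      moreover have "staircase m d s \<alpha>' (\<tau> \<inter> \<beta>)"
        by (rule staircase_mono[OF 2(4)]) (auto simp: \<alpha>'_def)
      ultimately have "\<tau> \<in> insert {} ?T" using glue_layerI[of \<alpha>' m K "\<tau> \<inter> \<beta>" L d s] e by metis
      then show ?thesis using \<tau> by blast
    qed
  qed
  show "\<forall>r\<ge>0. \<forall>x\<in>dilate (m+1) (d+1) r. \<exists>\<sigma>\<in>insert {} ?T. \<exists>w. conic_rep \<sigma> w r x"
  proof (intro allI impI ballI)
    fix r :: real and x assume r: "0 \<le> r" and x: "x \<in> dilate (m+1) (d+1) r"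
    show "\<exists>\<sigma>\<in>insert {} ?T. \<exists>w. conic_rep \<sigma> w r x"
    proof (cases "x (m+1) \<le> r")
      case True
      obtain \<alpha> \<beta> w where "\<alpha> \<in> insert {} (bottom m K)" "\<beta> \<in> insert {} L" "staircase m d s \<alpha> \<beta>"
        "conic_rep (raise m ` \<alpha> \<union> \<beta>) w r x"
        by (rule layer_exists[OF K L x True])
      then show ?thesis using glue_layerI by blast
    next
      case False
      then have "x(m+1 := x (m+1) - r) \<in> dilate (m+1) d r" using dilate_lower[OF x] by simp
      then obtain \<sigma> w where \<sigma>: "\<sigma> \<in> insert {} K" "conic_rep \<sigma> w r (x(m+1 := x (m+1) - r))"
        by (rule fan_ex[OF K r])
      have "raise m ` \<sigma> \<in> insert {} ?T" using \<sigma>(1) glue_raiseI by auto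
      moreover have "conic_rep (raise m ` \<sigma>) (\<lambda>v. w (v - sbasis 1 (m+1))) r x"
        using conic_rep_raise[OF \<sigma>(2), of m] by simp
      ultimately show ?thesis by blast
    qed
  qed
  have AA: "w = w'" if "conic_rep (raise m ` \<sigma>) w r x" "conic_rep (raise m ` \<sigma>') w' r x"
    "\<sigma> \<in> insert {} K" "\<sigma>' \<in> insert {} K" for w w' r x \<sigma> \<sigma>'
  proof -
    have e: "(\<lambda>v. w (raise m v)) = (\<lambda>v. w' (raise m v))"
      by (rule fan_unique[OF K that(3,4) conic_rep_lower[OF that(1)] conic_rep_lower[OF that(2)]])
    show ?thesis
    proof
      fix v
      have "raise m (v - sbasis 1 (m+1)) = v" by (simp add: raise_def)
      then show "w v = w' v" using fun_cong[OF e, of "v - sbasis 1 (m+1)"] by simp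
    qed
  qed
  have AB: "w = w'" if w: "conic_rep (raise m ` \<sigma>) w r x" and w': "conic_rep (raise m ` \<alpha> \<union> \<beta>) w' r x"
    and \<sigma>: "\<sigma> \<in> K" and \<alpha>: "\<alpha> \<in> insert {} (bottom m K)" and \<beta>: "\<beta> \<in> insert {} L"
    for w w' r x \<sigma> \<alpha> \<beta>
  proof -
    have fin: "finite \<alpha>" "finite \<beta>" "finite \<sigma>"
      using bot[OF \<alpha>] \<beta> \<sigma> fanD(3)[OF K] fanD(3)[OF L] by auto
    have "emb ` \<beta> \<subseteq> dilate m (d+1) 1" using fanD(4)[OF L] \<beta> by auto
    then have \<beta>0: "\<forall>v\<in>\<beta>. v (m+1) = 0" by (force simp: dilate_def emb_def)
    have \<alpha>0: "\<forall>v\<in>\<alpha>. v (m+1) = 0" using \<alpha> by (auto simp: bottom_def)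
    obtain p q where q: "conic_rep \<beta> (\<lambda>v. if v \<in> \<beta> then w' v else 0) (r - x (m+1)) q"
      by (rule layer_split[OF w' fin(1,2) \<alpha>0 \<beta>0])
    have "x(m+1 := x (m+1) - r) \<in> dilate (m+1) d r"
      using conic_rep_dilate[OF conic_rep_lower[OF w]] fanD(4)[OF K \<sigma>] by blast
    from dilate_height[OF this] have "r \<le> x (m+1)" by simp
    moreover have "0 \<le> r - x (m+1)"
      unfolding conic_repD(3)[OF q, symmetric] using conic_repD(1)[OF q] by (intro sum_nonneg)
    ultimately have "conic_rep \<beta> (\<lambda>v. if v \<in> \<beta> then w' v else 0) 0 q" using q by simp
    from conic_rep_zero_mass[OF this fin(2)] have z: "w' v = 0" if "v \<in> \<beta>" for v
      using that by (metis (full_types))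
    have "conic_rep {v \<in> raise m ` \<alpha> \<union> \<beta>. 0 < w' v} w' r x"
      using conic_rep_support[OF w'] fin by simp
    then have "conic_rep (raise m ` \<alpha>) w' r x"
      by (rule conic_rep_mono) (use z fin in auto)
    then show ?thesis using AA[OF w] bot[OF \<alpha>] \<sigma> by blast
  qed
  show "\<forall>\<sigma>\<in>insert {} ?T. \<forall>\<sigma>'\<in>insert {} ?T. \<forall>w w' r x.
      conic_rep \<sigma> w r x \<longrightarrow> conic_rep \<sigma>' w' r x \<longrightarrow> w = w'"
  proof (intro ballI allI impI)
    fix \<sigma> \<sigma>' w w' r x assume \<sigma>: "\<sigma> \<in> insert {} ?T" "\<sigma>' \<in> insert {} ?T"
      and w: "conic_rep \<sigma> w r x" "conic_rep \<sigma>' w' r x"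
    have cases: "(\<exists>\<sigma>0\<in>K. \<sigma> = raise m ` \<sigma>0) \<or> (\<exists>\<alpha> \<beta>. \<sigma> = raise m ` \<alpha> \<union> \<beta> \<and>
       \<alpha> \<in> insert {} (bottom m K) \<and> \<beta> \<in> insert {} L \<and> staircase m d s \<alpha> \<beta>)"
      if "\<sigma> \<in> insert {} ?T" for \<sigma>
    proof (cases "\<sigma> = {}")
      case True
      then show ?thesis by (intro disjI2 exI[of _ "{}"]) (auto simp: staircase_def)
    next
      case False
      then have "\<sigma> \<in> ?T" using that by blast
      then show ?thesis by (cases rule: glue_cases) blast+
    qed
    consider (raised) \<sigma>0 \<sigma>1 where "\<sigma>0 \<in> K" "\<sigma> = raise m ` \<sigma>0" "\<sigma>1 \<in> K" "\<sigma>' = raise m ` \<sigma>1"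
      | (mixed) \<sigma>0 \<alpha> \<beta> where "\<sigma>0 \<in> K" "\<sigma> = raise m ` \<sigma>0" "\<sigma>' = raise m ` \<alpha> \<union> \<beta>"
         "\<alpha> \<in> insert {} (bottom m K)" "\<beta> \<in> insert {} L"
      | (mixed') \<sigma>0 \<alpha> \<beta> where "\<sigma>0 \<in> K" "\<sigma>' = raise m ` \<sigma>0" "\<sigma> = raise m ` \<alpha> \<union> \<beta>"
         "\<alpha> \<in> insert {} (bottom m K)" "\<beta> \<in> insert {} L"
      | (layer) \<alpha> \<beta> \<alpha>' \<beta>' where "\<sigma> = raise m ` \<alpha> \<union> \<beta>" "\<sigma>' = raise m ` \<alpha>' \<union> \<beta>'"
        "\<alpha> \<in> insert {} (bottom m K)" "\<alpha>' \<in> insert {} (bottom m K)"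
        "\<beta> \<in> insert {} L" "\<beta>' \<in> insert {} L"
        "staircase m d s \<alpha> \<beta>" "staircase m d s \<alpha>' \<beta>'"
      using cases[OF \<sigma>(1)] cases[OF \<sigma>(2)] by (elim disjE bexE exE conjE)
    then show "w = w'"
    proof cases
      case raised
      then show ?thesis using AA[of \<sigma>0 w r x \<sigma>1 w'] raised w by blast
    next
      case mixed
      then show ?thesis using AB[of \<sigma>0 w r x \<alpha> \<beta> w'] mixed w by blast
    next
      case mixed'
      then show ?thesis using AB[of \<sigma>0 w' r x \<alpha> \<beta> w] mixed' w by blast
    next
      case layer
      show ?thesis by (rule layer_unique[OF K L s layer(3-8) w[unfolded layer(1,2)]])
    qed
  qed
qed


section \<open>The recursive description of the Itenberg--Viro triangulations\<close>

text \<open>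
  The order of the staircases in the layer \<open>IV\<^sup>m\<^sup>+\<^sup>1\<^sub>d + (-1)\<^sup>d IV\<^sup>m\<^sub>d\<^sub>+\<^sub>1\<close>.
\<close>

definition stair_key :: "nat \<Rightarrow> nat \<Rightarrow> int" where
  "stair_key d j = (if even d then int j else - int j)"

text \<open>
  Dimension \<open>0\<close> and degree \<open>0\<close> both give a single point. With this convention the segments and the
  standard simplices are themselves obtained by gluing, so that the recursion has no other base case.
\<close>

fun itenberg_viro :: "nat \<Rightarrow> nat \<Rightarrow> lpoint set set" where
  "itenberg_viro 0 d = {{0}}"
| "itenberg_viro (Suc m) 0 = {{0}}"
| "itenberg_viro (Suc m) (Suc d) =
     glue (stair_key d) m d (itenberg_viro (Suc m) d) (itenberg_viro m (Suc d))"

lemma inj_stair_key: "inj_on (stair_key d) A"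
  by (auto simp: inj_on_def stair_key_def)

lemma fan_point:
  assumes "n = 0 \<or> d = 0"
  shows "simplicial_fan n d {{0}}"
proof -
  have z: "x = 0" if "x \<in> dilate n d s" for x s
  proof
    fix i
    show "x i = 0 i"
    proof (cases "i \<in> {1..n}")
      case True
      then have "d = 0" using assms by auto
      have nn: "0 \<le> x j" if "j \<in> {1..n}" for j
        using \<open>x \<in> dilate n d s\<close> that by (force simp: dilate_def bcoord_def)
      have "(\<Sum>i\<in>{1..n}. x i) \<le> 0"
        using \<open>x \<in> dilate n d s\<close> \<open>d = 0\<close> by (force simp: dilate_def bcoord_def)
      then have "(\<Sum>i\<in>{1..n}. x i) = 0" using nn by (intro antisym sum_nonneg) auto
      then show ?thesis using nn True by (subst (asm) sum_nonneg_eq_0_iff) auto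
    next
      case False
      then show ?thesis using that by (simp add: dilate_def)
    qed
  qed
  have emb0: "emb 0 = 0" by (auto simp: emb_def fun_eq_iff)
  have rep: "\<exists>w. conic_rep {0} w s x" if "x \<in> dilate n d s" "0 \<le> s" for x s
    using z[OF that(1)] that(2)
    by (intro exI[of _ "\<lambda>v. if v = 0 then s else 0"] conic_repI) auto
  have uniq: "w = w'" if "\<sigma> \<in> insert {} {{0}}" "\<sigma>' \<in> insert {} {{0}}"
    "conic_rep \<sigma> w s x" "conic_rep \<sigma>' w' s x" for \<sigma> \<sigma>' w w' s x
  proof -
    have 1: "conic_rep {0} w s x" "conic_rep {0} w' s x"
      using conic_rep_mono[OF that(3), of "{0}"] conic_rep_mono[OF that(4), of "{0}"] that(1,2) by auto
    show ?thesis
    proof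
      fix v show "w v = w' v"
        using conic_repD(2)[OF 1(1), of v] conic_repD(2)[OF 1(2), of v]
          conic_repD(3)[OF 1(1)] conic_repD(3)[OF 1(2)] by (cases "v = 0") auto
    qed
  qed
  show ?thesis
    unfolding simplicial_fan_def
  proof (intro conjI)
    show "\<forall>\<sigma>\<in>{{0}}. finite \<sigma> \<and> emb ` \<sigma> \<subseteq> dilate n d 1"
      by (auto simp: emb0 dilate_def bcoord_def)
    show "\<forall>s\<ge>0. \<forall>x\<in>dilate n d s. \<exists>\<sigma>\<in>insert {} {{0}}. \<exists>w. conic_rep \<sigma> w s x"
      using rep by blast
    show "\<forall>\<sigma>\<in>insert {} {{0}}. \<forall>\<sigma>'\<in>insert {} {{0}}. \<forall>w w' s x.
       conic_rep \<sigma> w s x \<longrightarrow> conic_rep \<sigma>' w' s x \<longrightarrow> w = w'"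
      using uniq by (intro ballI allI impI)
  qed auto
qed

lemma fan_itenberg_viro: "simplicial_fan n d (itenberg_viro n d)"
proof (induction n d rule: itenberg_viro.induct)
  case (3 m d)
  then show ?case using fan_glue[of m d _ _ "stair_key d"] inj_stair_key by simp
qed (auto intro: fan_point)

text \<open>
  The facets \<open>x\<^sub>m\<^sub>+\<^sub>1 = 0\<close> of these triangulations form the analogous family one dimension lower; so the
  two layers on either side of a horizontal slice induce the same triangulation of it.
\<close>

lemma bottom_itenberg_viro: "bottom m (itenberg_viro (Suc m) d) = itenberg_viro m d"
proof (cases d)
  case 0
  then show ?thesis by (cases m) (auto simp: bottom_def)
next
  case (Suc e)
  let ?K = "itenberg_viro (Suc m) e" and ?L = "itenberg_viro m (Suc e)"
  have K: "simplicial_fan (m+1) e ?K" and L: "simplicial_fan m (e+1) ?L"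
    using fan_itenberg_viro[of "Suc m" e] fan_itenberg_viro[of m "Suc e"] by simp_all
  have "bottom m (glue (stair_key e) m e ?K ?L) = ?L"
  proof
    show "bottom m (glue (stair_key e) m e ?K ?L) \<subseteq> ?L"
    proof
      fix \<sigma> assume "\<sigma> \<in> bottom m (glue (stair_key e) m e ?K ?L)"
      then have \<sigma>: "\<sigma> \<in> glue (stair_key e) m e ?K ?L" and h: "\<And>v. v \<in> \<sigma> \<Longrightarrow> v (m+1) = 0"
        by (auto simp: bottom_def)
      from \<sigma> show "\<sigma> \<in> ?L"
      proof (cases rule: glue_cases)
        case (1 \<sigma>0)
        then obtain v where v: "v \<in> \<sigma>0" using fanD(2)[OF K] by fastforce
        have "0 \<le> emb v (m+1)" using dilate_height fanD(4)[OF K 1(1)] v by blast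
        moreover have "v (m+1) + 1 = 0" using h[of "raise m v"] 1(2) v by (simp add: raise_apply)
        ultimately show ?thesis by (simp add: emb_def)
      next
        case (2 \<alpha> \<beta>)
        have "\<alpha> = {}"
        proof (rule ccontr)
          assume "\<alpha> \<noteq> {}"
          then obtain v where v: "v \<in> \<alpha>" by blast
          then have "v (m+1) = 0" using 2(2) by (auto simp: bottom_def)
          moreover have "v (m+1) + 1 = 0" using h[of "raise m v"] 2(1) v by (simp add: raise_apply)
          ultimately show False by simp
        qed
        then show ?thesis using 2 by auto
      qed
    qed
    show "?L \<subseteq> bottom m (glue (stair_key e) m e ?K ?L)"
    proof
      fix \<sigma> assume \<sigma>: "\<sigma> \<in> ?L"
      have "raise m ` {} \<union> \<sigma> \<in> insert {} (glue (stair_key e) m e ?K ?L)"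
        by (rule glue_layerI) (use \<sigma> in \<open>auto simp: staircase_def\<close>)
      moreover have "\<sigma> \<noteq> {}" using fanD(2)[OF L] \<sigma> by auto
      moreover have "v (m+1) = 0" if "v \<in> \<sigma>" for v
      proof -
        have "emb v \<in> dilate m (e+1) 1" using fanD(4)[OF L \<sigma>] that by blast
        then show ?thesis by (simp add: dilate_def emb_def)
      qed
      ultimately show "\<sigma> \<in> bottom m (glue (stair_key e) m e ?K ?L)" by (simp add: bottom_def)
    qed
  qed
  then show ?thesis using Suc by simp
qed

section \<open>Unimodularity\<close>

text \<open>
  Unimodularity in the dual form: each integer function on the vertices is the restriction of an
  integer affine function. In this form it passes to faces and is easy to check for joins, and it is
  what the existence of gradients and the description of the wave sheaf use.
\<close>

definition unimodular :: "nat \<Rightarrow> lpoint set \<Rightarrow> bool" where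
  "unimodular n \<sigma> \<longleftrightarrow> (\<forall>f :: lpoint \<Rightarrow> int. \<exists>w c. \<forall>v\<in>\<sigma>. (\<Sum>i\<in>{1..n}. v i * w i) + c = f v)"

lemma staircase_index:
  assumes "staircase m d s \<alpha> \<beta>"
  obtains i where "i \<le> m"
    "\<forall>v\<in>\<alpha>. \<forall>j\<le>m. 0 < bcoord m (real d) j (emb v) \<longrightarrow> s j \<le> s i"
    "\<forall>u\<in>\<beta>. \<forall>k\<le>m. 0 < bcoord m (real (d+1)) k (emb u) \<longrightarrow> s i \<le> s k"
proof -
  define A where "A = {j. j \<le> m \<and> (\<exists>v\<in>\<alpha>. 0 < bcoord m (real d) j (emb v))}"
  show ?thesis
  proof (cases "A = {}")
    case True
    have "Min (s ` {..m}) \<in> s ` {..m}" by (intro Min_in) auto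
    then obtain i where i: "i \<le> m" "s i = Min (s ` {..m})"
      by (metis atMost_iff imageE)
    have "s i \<le> s k" if "k \<le> m" for k using i(2) that by simp
    then show ?thesis using True that[of i] i(1) by (auto simp: A_def)
  next
    case False
    have fin: "finite A" by (auto simp: A_def)
    then have "Max (s ` A) \<in> s ` A" using False by (intro Max_in) auto
    then obtain i where i: "i \<in> A" "s i = Max (s ` A)" by auto
    have "s j \<le> s i" if "j \<in> A" for j using i(2) fin that by simp
    then show ?thesis using that[of i] i(1) assms unfolding A_def staircase_def by blast
  qed
qed

lemma unimodular_raise:
  assumes "unimodular (m+1) \<sigma>"
  shows "unimodular (m+1) (raise m ` \<sigma>)"
  unfolding unimodular_def
proof
  fix f :: "lpoint \<Rightarrow> int"
  obtain w c where w: "\<And>v. v \<in> \<sigma> \<Longrightarrow> (\<Sum>i\<in>{1..m+1}. v i * w i) + c = f (raise m v)"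
    using assms[unfolded unimodular_def, rule_format, of "\<lambda>v. f (raise m v)"] by blast
  have "(\<Sum>i\<in>{1..m+1}. raise m v i * w i) = (\<Sum>i\<in>{1..m+1}. v i * w i) + w (m+1)" for v
    by (simp add: raise_apply algebra_simps)
  then have "\<forall>v\<in>raise m ` \<sigma>. (\<Sum>i\<in>{1..m+1}. v i * w i) + (c - w (m+1)) = f v"
    using w by fastforce
  then show "\<exists>w c. \<forall>v\<in>raise m ` \<sigma>. (\<Sum>i\<in>{1..m+1}. v i * w i) + c = f v" by blast
qed

text \<open>
  \<^const>\<open>bcoord\<close> at lattice points, kept in the integers.
\<close>

definition int_bcoord :: "nat \<Rightarrow> int \<Rightarrow> nat \<Rightarrow> lpoint \<Rightarrow> int" where
  "int_bcoord m r j v = (if j = 0 then r - (\<Sum>i\<in>{1..m}. v i) else v j)"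

lemma bcoord_int: "bcoord m (real d) j (emb v) = real_of_int (int_bcoord m (int d) j v)"
  by (simp add: bcoord_def int_bcoord_def emb_def)

lemma sum_int_bcoord:
  "(\<Sum>j\<le>m. g j * int_bcoord m r j v) = g 0 * r + (\<Sum>i\<in>{1..m}. v i * (g i - g 0))"
proof -
  have "(\<Sum>j\<le>m. g j * int_bcoord m r j v) =
      g 0 * int_bcoord m r 0 v + (\<Sum>j\<in>{1..m}. g j * int_bcoord m r j v)"
    by (simp add: atMost_atLeast0 sum.atLeast_Suc_atMost)
  also have "(\<Sum>j\<in>{1..m}. g j * int_bcoord m r j v) = (\<Sum>j\<in>{1..m}. g j * v j)"
    by (intro sum.cong) (auto simp: int_bcoord_def)
  finally show ?thesis
    by (simp add: int_bcoord_def algebra_simps sum_subtractf sum_distrib_left)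
qed

text \<open>
  Let \<open>i\<close> be an index separating the coordinates used by \<open>\<alpha>\<close> from those used by \<open>\<beta>\<close>. The given
  affine functions on \<open>\<alpha>\<close> and \<open>\<beta>\<close> are written as linear forms in the barycentric coordinates. Since the
  coordinates have constant sum on \<open>\<beta>\<close>, the form on \<open>\<beta>\<close> may be shifted so that both have the same
  coefficient at \<open>i\<close>; then they combine to one form, and the difference of the constants is absorbed
  by the height.
\<close>

lemma unimodular_layer:
  assumes \<alpha>: "unimodular (m+1) \<alpha>" "emb ` \<alpha> \<subseteq> dilate m d 1"
    and \<beta>: "unimodular m \<beta>" "emb ` \<beta> \<subseteq> dilate m (d+1) 1"
    and st: "staircase m d s \<alpha> \<beta>" and s: "inj_on s {..m}"
  shows "unimodular (m+1) (raise m ` \<alpha> \<union> \<beta>)"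
  unfolding unimodular_def
proof
  fix f :: "lpoint \<Rightarrow> int"
  obtain i where i: "i \<le> m"
    and i\<alpha>: "\<forall>v\<in>\<alpha>. \<forall>j\<le>m. 0 < bcoord m (real d) j (emb v) \<longrightarrow> s j \<le> s i"
    and i\<beta>: "\<forall>u\<in>\<beta>. \<forall>k\<le>m. 0 < bcoord m (real (d+1)) k (emb u) \<longrightarrow> s i \<le> s k"
    by (rule staircase_index[OF st])
  have h: "v (m+1) = 0" if "v \<in> \<alpha> \<or> v \<in> \<beta>" for v
  proof -
    have "emb v \<in> dilate m d 1 \<or> emb v \<in> dilate m (d+1) 1" using that \<alpha>(2) \<beta>(2) by blast
    then show ?thesis by (force simp: dilate_def emb_def)
  qed
  obtain w a where wa: "\<And>v. v \<in> \<alpha> \<Longrightarrow> (\<Sum>i\<in>{1..m+1}. v i * w i) + a = f (raise m v)"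
    using \<alpha>(1)[unfolded unimodular_def, rule_format, of "\<lambda>v. f (raise m v)"] by blast
  have w: "(\<Sum>i\<in>{1..m}. v i * w i) + a = f (raise m v)" if "v \<in> \<alpha>" for v
    using wa[OF that] that h[of v] by simp
  obtain w' b where w': "\<And>v. v \<in> \<beta> \<Longrightarrow> (\<Sum>i\<in>{1..m}. v i * w' i) + b = f v"
    using \<beta>(1)[unfolded unimodular_def, rule_format, of f] by blast
  define A where "A j = (if j = 0 then 0 else w j)" for j
  define B0 where "B0 j = (if j = 0 then 0 else w' j)" for j
  (* the shift that makes the coefficients at the separating index equal *)
  define t where "t = A i - B0 i"
  define B where "B j = B0 j + t" for j
  define g where "g j = (if s j \<le> s i then A j else B j)" for j
  have g\<alpha>: "(\<Sum>j\<le>m. g j * int_bcoord m (int d) j v) = (\<Sum>i\<in>{1..m}. v i * w i)" if "v \<in> \<alpha>" for v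
  proof -
    have "g j * int_bcoord m (int d) j v = A j * int_bcoord m (int d) j v" if "j \<le> m" for j
    proof (cases "s j \<le> s i")
      case False
      have "emb v \<in> dilate m d 1" using \<alpha>(2) \<open>v \<in> \<alpha>\<close> by blast
      then have "0 \<le> int_bcoord m (int d) j v" using \<open>j \<le> m\<close> by (simp add: dilate_def bcoord_int)
      moreover have "\<not> 0 < int_bcoord m (int d) j v"
        using i\<alpha> \<open>v \<in> \<alpha>\<close> \<open>j \<le> m\<close> False by (force simp: bcoord_int)
      ultimately show ?thesis by simp
    qed (simp add: g_def)
    then have "(\<Sum>j\<le>m. g j * int_bcoord m (int d) j v) = (\<Sum>j\<le>m. A j * int_bcoord m (int d) j v)"
      by (intro sum.cong) auto
    also have "\<dots> = (\<Sum>i\<in>{1..m}. v i * w i)" unfolding sum_int_bcoord by (simp add: A_def)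
    finally show ?thesis .
  qed
  have bi: "bcoord m (real (d+1)) j (emb v) = real_of_int (int_bcoord m (int d + 1) j v)" for j v
    using bcoord_int[of m "d+1" j v] by (simp add: add.commute)
  have g\<beta>: "(\<Sum>j\<le>m. g j * int_bcoord m (int d + 1) j v) = (\<Sum>i\<in>{1..m}. v i * w' i) + t * (int d + 1)"
    if "v \<in> \<beta>" for v
  proof -
    have "g j * int_bcoord m (int d + 1) j v = B j * int_bcoord m (int d + 1) j v" if "j \<le> m" for j
    proof (cases "0 < int_bcoord m (int d + 1) j v")
      case True
      then have "0 < bcoord m (real (d+1)) j (emb v)" by (simp only: bi of_int_0_less_iff)
      then have "s i \<le> s j" using i\<beta> \<open>v \<in> \<beta>\<close> \<open>j \<le> m\<close> by blast
      then have "s j \<le> s i \<Longrightarrow> j = i" using inj_onD[OF s, of j i] \<open>j \<le> m\<close> i by simp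
      then show ?thesis by (auto simp: g_def B_def t_def)
    next
      case False
      have "emb v \<in> dilate m (d+1) 1" using \<beta>(2) \<open>v \<in> \<beta>\<close> by blast
      then have "0 \<le> bcoord m (real (d+1)) j (emb v)" using \<open>j \<le> m\<close> by (simp add: dilate_def)
      then have "0 \<le> int_bcoord m (int d + 1) j v" by (simp only: bi of_int_0_le_iff)
      then show ?thesis using False by simp
    qed
    then have "(\<Sum>j\<le>m. g j * int_bcoord m (int d + 1) j v) = (\<Sum>j\<le>m. B j * int_bcoord m (int d + 1) j v)"
      by (intro sum.cong) auto
    also have "\<dots> = (\<Sum>i\<in>{1..m}. v i * w' i) + t * (int d + 1)"
      unfolding sum_int_bcoord by (simp add: B_def B0_def)
    finally show ?thesis .
  qed
  (* back from barycentric to affine coordinates: C makes the values on the lower part right, and the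
     coefficient of the height corrects those on the upper part *)
  define C where "C = b - t * (int d + 1) + g 0 * (int d + 1)"
  define W where "W j = (if j = m+1 then a + g 0 * int d - C else g j - g 0)" for j
  have W: "(\<Sum>i\<in>{1..m+1}. v i * W i) = (\<Sum>i\<in>{1..m}. v i * (g i - g 0)) + v (m+1) * (a + g 0 * int d - C)" for v
  proof -
    have "(\<Sum>i\<in>{1..m}. v i * W i) = (\<Sum>i\<in>{1..m}. v i * (g i - g 0))"
      by (intro sum.cong) (auto simp: W_def)
    then show ?thesis by (simp add: W_def)
  qed
  have "(\<Sum>i\<in>{1..m+1}. v i * W i) + C = f v" if "v \<in> raise m ` \<alpha> \<union> \<beta>" for v
    using that
  proof
    assume "v \<in> \<beta>"
    then show ?thesis
      using W[of v] w'[of v] g\<beta>[of v] h[of v] sum_int_bcoord[of g m "int d + 1" v]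
      by (simp add: C_def algebra_simps)
  next
    assume "v \<in> raise m ` \<alpha>"
    then obtain u where u: "u \<in> \<alpha>" "v = raise m u" by blast
    have "(\<Sum>i\<in>{1..m}. v i * (g i - g 0)) = (\<Sum>i\<in>{1..m}. u i * (g i - g 0))"
      unfolding u(2) by (intro sum.cong) (auto simp: raise_apply)
    moreover have "v (m+1) = 1" using h[of u] u by (simp add: raise_apply)
    ultimately show ?thesis
      using W[of v] w[of u] g\<alpha>[of u] u sum_int_bcoord[of g m "int d" u]
      by (simp add: algebra_simps)
  qed
  then show "\<exists>w c. \<forall>v\<in>raise m ` \<alpha> \<union> \<beta>. (\<Sum>i\<in>{1..m+1}. v i * w i) + c = f v" by blast
qed

lemma unimodular_itenberg_viro: "\<sigma> \<in> itenberg_viro n d \<Longrightarrow> unimodular n \<sigma>"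
proof (induction n d arbitrary: \<sigma> rule: itenberg_viro.induct)
  case (1 d)
  then show ?case by (auto simp: unimodular_def)
next
  case (2 m)
  then show ?case by (auto simp: unimodular_def)
next
  case (3 m d)
  have K: "simplicial_fan (m+1) d (itenberg_viro (Suc m) d)"
    and L: "simplicial_fan m (d+1) (itenberg_viro m (Suc d))"
    using fan_itenberg_viro[of "Suc m" d] fan_itenberg_viro[of m "Suc d"] by simp_all
  have "\<sigma> \<in> glue (stair_key d) m d (itenberg_viro (Suc m) d) (itenberg_viro m (Suc d))"
    using 3(3) by simp
  then show ?case
  proof (cases rule: glue_cases)
    case (1 \<sigma>0)
    then show ?thesis using 3(1) unimodular_raise[of m \<sigma>0] by simp
  next
    case (2 \<alpha> \<beta>)
    have e: "unimodular k {}" for k by (simp add: unimodular_def)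
    have "unimodular (m+1) \<alpha>" using 2(2) 3(1) e by (auto simp: bottom_def)
    moreover have "unimodular m \<beta>" using 2(3) 3(2) e by auto
    moreover have "emb ` \<beta> \<subseteq> dilate m (d+1) 1" using 2(3) fanD(4)[OF L] by auto
    ultimately show ?thesis
      using unimodular_layer[OF _ bottom_dilate[OF K 2(2)] _ _ 2(4) inj_stair_key] 2(1) by simp
  qed
qed


section \<open>Uniqueness of the glued triangulations\<close>

lemma geom_mono: "\<sigma> \<subseteq> \<tau> \<Longrightarrow> geom \<sigma> \<subseteq> geom \<tau>"
  unfolding geom_def by (intro hull_mono image_mono)

lemma emb_in_geom: "v \<in> \<sigma> \<Longrightarrow> emb v \<in> geom \<sigma>"
  unfolding geom_def by (auto intro: hull_inc)

lemma convex_geom: "convex (geom \<sigma>)"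
  by (simp add: geom_def)

lemma geom_subset_convex:
  assumes "convex R"
  shows "geom \<sigma> \<subseteq> R \<longleftrightarrow> (\<forall>v\<in>\<sigma>. emb v \<in> R)"
  using assms emb_in_geom[of _ \<sigma>] hull_minimal[of "emb ` \<sigma>" R convex] unfolding geom_def by blast

lemma translate_raise: "translate (sbasis 1 (m+1)) K = (`) (raise m) ` K"
proof -
  have "raise m = (\<lambda>x. x + sbasis 1 (m+1))" by (simp add: fun_eq_iff raise_def)
  then show ?thesis by (simp add: translate_def)
qed

lemma top_vtx_raise: "top_vtx m d ` A = raise m ` sbasis d ` A"
  by (auto simp: top_vtx_def raise_def image_image add.commute)

lemma emb_geom_raise:
  assumes "finite S"
  shows "emb (raise m v) \<in> geom (raise m ` S) \<longleftrightarrow> emb v \<in> geom S"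
proof -
  have "\<exists>w. conic_rep (raise m ` S) w 1 (emb (raise m v))" if "conic_rep S w 1 (emb v)" for w
    using conic_rep_raise[OF that, of m] unfolding raise_emb by blast
  moreover have "\<exists>w. conic_rep S w 1 (emb v)" if "conic_rep (raise m ` S) w 1 (emb (raise m v))" for w
    using conic_rep_lower[OF that] unfolding raise_emb by (auto simp: fun_upd_triv)
  ultimately show ?thesis using assms by (auto simp: geom_eq_conic_rep)
qed

lemma emb_geom_sbasis:
  assumes "d \<ge> 1" "A \<subseteq> {0..m}"
  shows "emb v \<in> geom (sbasis d ` A) \<longleftrightarrow>
    emb v \<in> dilate m d 1 \<and> (\<forall>j\<le>m. j \<notin> A \<longrightarrow> bcoord m d j (emb v) = 0)"
  by (simp add: geom_sbasis[OF assms])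

text \<open>
  The gluing conditions prescribe the restrictions to the pieces, so a solution all of whose simplices
  lie in pieces is contained in any other solution.
\<close>

lemma is_glued_unique:
  assumes T: "is_glued m d I J K L T" and T': "is_glued m d I J K L T'"
    and cover: "\<And>\<sigma>. \<sigma> \<in> T \<Longrightarrow> geom \<sigma> \<subseteq> {x. x (m+1) \<ge> 1} \<or>
      (\<exists>i\<in>{0..m}. geom \<sigma> \<subseteq> geom (top_vtx m d ` I i \<union> sbasis (d+1) ` J i))"
  shows "T = T'"
proof (rule triangulation_subset_eq)
  show "triangulation (m+1) (PP (m+1) (d+1)) T" "triangulation (m+1) (PP (m+1) (d+1)) T'"
    using T T' by (simp_all add: is_glued_def)
  have eq: "restr T {x. x (m+1) \<ge> 1} = restr T' {x. x (m+1) \<ge> 1}"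
    "\<forall>i\<in>{0..m}. restr T (geom (top_vtx m d ` I i \<union> sbasis (d+1) ` J i)) =
       restr T' (geom (top_vtx m d ` I i \<union> sbasis (d+1) ` J i))"
    using T T' by (simp_all add: is_glued_def)
  show "T \<subseteq> T'"
  proof
    fix \<sigma> assume "\<sigma> \<in> T"
    from cover[OF this] show "\<sigma> \<in> T'"
    proof
      assume "geom \<sigma> \<subseteq> {x. x (m+1) \<ge> 1}"
      then have "\<sigma> \<in> restr T' {x. x (m+1) \<ge> 1}"
        unfolding eq(1)[symmetric] using \<open>\<sigma> \<in> T\<close> by (simp add: restr_def)
      then show ?thesis by (simp add: restr_def)
    next
      assume "\<exists>i\<in>{0..m}. geom \<sigma> \<subseteq> geom (top_vtx m d ` I i \<union> sbasis (d+1) ` J i)"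
      then obtain i where i: "i \<in> {0..m}" "geom \<sigma> \<subseteq> geom (top_vtx m d ` I i \<union> sbasis (d+1) ` J i)"
        by blast
      then have "\<sigma> \<in> restr T (geom (top_vtx m d ` I i \<union> sbasis (d+1) ` J i))"
        using \<open>\<sigma> \<in> T\<close> by (simp add: restr_def)
      then have "\<sigma> \<in> restr T' (geom (top_vtx m d ` I i \<union> sbasis (d+1) ` J i))"
        using eq(2) i(1) by blast
      then show ?thesis by (simp add: restr_def)
    qed
  qed
qed

text \<open>
  A point of the join splits into a point of the upper and a point of the lower simplex, whose masses
  are the height and its complement.
\<close>

lemma layer_piece:
  assumes "d \<ge> 1" and A: "A \<subseteq> {0..m}" and B: "B \<subseteq> {0..m}"
    and x: "x \<in> geom (top_vtx m d ` A \<union> sbasis (d+1) ` B)"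
  shows "0 \<le> x (m+1)" "x (m+1) \<le> 1"
    "x (m+1) = 1 \<Longrightarrow> x \<in> geom (top_vtx m d ` A)"
    "x (m+1) = 0 \<Longrightarrow> x \<in> geom (sbasis (d+1) ` B)"
proof -
  let ?\<alpha> = "sbasis d ` A" and ?\<beta> = "sbasis (d+1) ` B"
  have fin: "finite ?\<alpha>" "finite ?\<beta>"
    using finite_subset[OF A] finite_subset[OF B] by simp_all
  have h: "\<forall>v\<in>?\<alpha>. v (m+1) = 0" "\<forall>v\<in>?\<beta>. v (m+1) = 0"
    using A B by (auto simp: sbasis_def)
  obtain w where w: "conic_rep (raise m ` ?\<alpha> \<union> ?\<beta>) w 1 x"
    using x geom_eq_conic_rep[of "top_vtx m d ` A \<union> sbasis (d+1) ` B"] fin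
    unfolding top_vtx_raise by auto
  obtain p q where p: "conic_rep ?\<alpha> (\<lambda>v. if v \<in> ?\<alpha> then w (raise m v) else 0) (x (m+1)) p"
    and q: "conic_rep ?\<beta> (\<lambda>v. if v \<in> ?\<beta> then w v else 0) (1 - x (m+1)) q"
    by (rule layer_split[OF w fin h])
  show "0 \<le> x (m+1)"
    unfolding conic_repD(3)[OF p, symmetric] using conic_repD(1)[OF p] by (intro sum_nonneg)
  have "0 \<le> 1 - x (m+1)"
    unfolding conic_repD(3)[OF q, symmetric] using conic_repD(1)[OF q] by (intro sum_nonneg)
  then show "x (m+1) \<le> 1" by simp
  have supp: "conic_rep {v \<in> raise m ` ?\<alpha> \<union> ?\<beta>. 0 < w v} w 1 x"
    using conic_rep_support[OF w] fin by simp
  show "x \<in> geom (top_vtx m d ` A)" if "x (m+1) = 1"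
  proof -
    have "(\<lambda>v. if v \<in> ?\<beta> then w v else 0) = (\<lambda>_. 0)"
      using conic_rep_zero_mass[of ?\<beta> _ q] q fin(2) that by auto
    then have "w v = 0" if "v \<in> ?\<beta>" for v using that by metis
    then have "conic_rep (raise m ` ?\<alpha>) w 1 x"
      by (intro conic_rep_mono[OF supp]) (use fin in auto)
    then show ?thesis using geom_eq_conic_rep[of "raise m ` ?\<alpha>"] fin(1)
      unfolding top_vtx_raise by blast
  qed
  show "x \<in> geom ?\<beta>" if "x (m+1) = 0"
  proof -
    have "(\<lambda>v. if v \<in> ?\<alpha> then w (raise m v) else 0) = (\<lambda>_. 0)"
      using conic_rep_zero_mass[of ?\<alpha> _ p] p fin(1) that by auto
    then have "w (raise m v) = 0" if "v \<in> ?\<alpha>" for v using that by metis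
    then have "conic_rep ?\<beta> w 1 x"
      by (intro conic_rep_mono[OF supp]) (use fin in auto)
    then show ?thesis using geom_eq_conic_rep[of ?\<beta>] fin(2) by blast
  qed
qed

lemma convex_height: "convex {x :: rpoint. c \<le> x i}"
proof -
  have "c \<le> u * a + v * b" if "c \<le> a" "c \<le> b" "0 \<le> u" "0 \<le> v" "u + v = 1" for a b u v :: real
  proof -
    have "c = u * c + v * c" using that by (simp flip: distrib_right)
    also have "\<dots> \<le> u * a + v * b" using that by (intro add_mono mult_left_mono)
    finally show ?thesis .
  qed
  then show ?thesis by (simp add: convex_def scaleR_apply)
qed

context
  fixes m d :: nat and s :: "nat \<Rightarrow> int" and K L :: "lpoint set set" and I J :: "nat \<Rightarrow> nat set"
  assumes K: "simplicial_fan (m+1) d K" and L: "simplicial_fan m (d+1) L"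
    and s: "inj_on s {..m}" and d: "d \<ge> 1"
    and I: "\<And>i. i \<le> m \<Longrightarrow> I i = {j. j \<le> m \<and> s j \<le> s i}"
    and J: "\<And>i. i \<le> m \<Longrightarrow> J i = {j. j \<le> m \<and> s i \<le> s j}"
begin

lemma heights:
  "\<sigma> \<in> K \<Longrightarrow> v \<in> \<sigma> \<Longrightarrow> 0 \<le> v (m+1)"
  "\<sigma> \<in> L \<Longrightarrow> v \<in> \<sigma> \<Longrightarrow> v (m+1) = 0"
proof -
  show "0 \<le> v (m+1)" if "\<sigma> \<in> K" "v \<in> \<sigma>"
    using dilate_height[of "emb v" m d 1] fanD(4)[OF K that(1)] that(2) by (auto simp: emb_def)
  show "v (m+1) = 0" if "\<sigma> \<in> L" "v \<in> \<sigma>"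
  proof -
    have "emb v \<in> dilate m (d+1) 1" using fanD(4)[OF L that(1)] that(2) by blast
    then show ?thesis by (simp add: dilate_def emb_def)
  qed
qed

lemma top_geom_iff:
  assumes "i \<le> m"
  shows "emb (raise m v) \<in> geom (top_vtx m d ` I i) \<longleftrightarrow>
    emb v \<in> dilate m d 1 \<and> (\<forall>j\<le>m. 0 < bcoord m d j (emb v) \<longrightarrow> s j \<le> s i)"
proof -
  have "finite (sbasis d ` I i)" using I[OF assms] by simp
  then have "emb (raise m v) \<in> geom (top_vtx m d ` I i) \<longleftrightarrow> emb v \<in> geom (sbasis d ` I i)"
    unfolding top_vtx_raise by (rule emb_geom_raise)
  also have "\<dots> \<longleftrightarrow> emb v \<in> dilate m d 1 \<and> (\<forall>j\<le>m. j \<notin> I i \<longrightarrow> bcoord m d j (emb v) = 0)"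
    using I[OF assms] by (intro emb_geom_sbasis d) auto
  also have "\<dots> \<longleftrightarrow> emb v \<in> dilate m d 1 \<and> (\<forall>j\<le>m. 0 < bcoord m d j (emb v) \<longrightarrow> s j \<le> s i)"
    unfolding I[OF assms] by (auto simp: dilate_def) force+
  finally show ?thesis .
qed

lemma bottom_geom_iff:
  assumes "i \<le> m"
  shows "emb v \<in> geom (sbasis (d+1) ` J i) \<longleftrightarrow>
    emb v \<in> dilate m (d+1) 1 \<and> (\<forall>j\<le>m. 0 < bcoord m (real (d+1)) j (emb v) \<longrightarrow> s i \<le> s j)"
proof -
  have "emb v \<in> geom (sbasis (d+1) ` J i) \<longleftrightarrow>
      emb v \<in> dilate m (d+1) 1 \<and> (\<forall>j\<le>m. j \<notin> J i \<longrightarrow> bcoord m (real (d+1)) j (emb v) = 0)"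
    using J[OF assms] by (intro emb_geom_sbasis) auto
  also have "\<dots> \<longleftrightarrow> emb v \<in> dilate m (d+1) 1 \<and> (\<forall>j\<le>m. 0 < bcoord m (real (d+1)) j (emb v) \<longrightarrow> s i \<le> s j)"
    unfolding J[OF assms] dilate_def by (auto simp del: of_nat_add) force+
  finally show ?thesis .
qed

text \<open>
  Whether a simplex lies in the piece with index \<open>i\<close> is decided by the supports of its vertices; on the
  vertices of a join these are exactly the conditions under which \<open>i\<close> separates the two parts.
\<close>

lemma restr_piece:
  assumes i: "i \<le> m"
  shows "restr (glue s m d K L) (geom (top_vtx m d ` I i \<union> sbasis (d+1) ` J i)) =
    join (restr ((`) (raise m) ` K) (geom (top_vtx m d ` I i))) (restr L (geom (sbasis (d+1) ` J i)))"
    (is "restr ?T ?G = join ?A ?B")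
proof
  have IJ: "I i \<subseteq> {0..m}" "J i \<subseteq> {0..m}" using I[OF i] J[OF i] by auto
  note P = layer_piece[OF d IJ]
  have topI: "emb (raise m v) \<in> geom (top_vtx m d ` I i)" if "emb (raise m v) \<in> ?G" "v (m+1) = 0" for v
    by (rule P(3)[OF that(1)]) (use that(2) in \<open>simp add: emb_def raise_apply\<close>)
  have botI: "emb v \<in> geom (sbasis (d+1) ` J i)" if "emb v \<in> ?G" "v (m+1) = 0" for v
    by (rule P(4)[OF that(1)]) (use that(2) in \<open>simp add: emb_def\<close>)
  show "restr ?T ?G \<subseteq> join ?A ?B"
  proof
    fix \<sigma> assume "\<sigma> \<in> restr ?T ?G"
    then have \<sigma>: "\<sigma> \<in> ?T" and G: "\<And>v. v \<in> \<sigma> \<Longrightarrow> emb v \<in> ?G"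
      using emb_in_geom by (auto simp: restr_def)
    from \<sigma> show "\<sigma> \<in> join ?A ?B"
    proof (cases rule: glue_cases)
      case (1 \<sigma>0)
      have "emb (raise m v) \<in> geom (top_vtx m d ` I i)" if "v \<in> \<sigma>0" for v
      proof (rule topI)
        show "emb (raise m v) \<in> ?G" using G 1(2) that by blast
        from P(2)[OF this] have "v (m+1) \<le> 0" by (simp add: emb_def raise_apply)
        then show "v (m+1) = 0" using heights(1)[OF 1(1) that] by simp
      qed
      then have "\<sigma> \<in> ?A" using 1 by (auto simp: restr_def geom_subset_convex convex_geom)
      then show ?thesis by (simp add: join_def)
    next
      case (2 \<alpha> \<beta>)
      have "emb (raise m v) \<in> geom (top_vtx m d ` I i)" if "v \<in> \<alpha>" for v
        using topI[of v] G[of "raise m v"] 2(1,2) that by (auto simp: bottom_def)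
      then have \<alpha>: "\<alpha> = {} \<or> raise m ` \<alpha> \<in> ?A"
        using 2(2) by (auto simp: restr_def geom_subset_convex convex_geom bottom_def)
      have "emb v \<in> geom (sbasis (d+1) ` J i)" if "v \<in> \<beta>" for v
        using botI[of v] G[of v] 2(1,3) that heights(2) by auto
      then have \<beta>: "\<beta> = {} \<or> \<beta> \<in> ?B"
        using 2(3) by (auto simp: restr_def geom_subset_convex convex_geom)
      show ?thesis using \<alpha> \<beta> 2(1,5) unfolding join_def by auto
    qed
  qed
  have A: "\<exists>\<alpha>\<in>bottom m K. \<sigma> = raise m ` \<alpha> \<and>
      (\<forall>v\<in>\<alpha>. \<forall>j\<le>m. 0 < bcoord m d j (emb v) \<longrightarrow> s j \<le> s i)" if "\<sigma> \<in> ?A" for \<sigma>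
  proof -
    obtain \<alpha> where \<alpha>: "\<alpha> \<in> K" "\<sigma> = raise m ` \<alpha>" using \<open>\<sigma> \<in> ?A\<close> by (auto simp: restr_def)
    have *: "emb v \<in> dilate m d 1 \<and> (\<forall>j\<le>m. 0 < bcoord m d j (emb v) \<longrightarrow> s j \<le> s i)" if "v \<in> \<alpha>" for v
    proof -
      have "raise m v \<in> \<sigma>" using that \<alpha>(2) by simp
      moreover have "geom \<sigma> \<subseteq> geom (top_vtx m d ` I i)" using \<open>\<sigma> \<in> ?A\<close> by (simp add: restr_def)
      ultimately show ?thesis unfolding top_geom_iff[OF i, symmetric] using emb_in_geom by blast
    qed
    then have "v (m+1) = 0" if "v \<in> \<alpha>" for v using that by (simp add: dilate_def emb_def)
    then have "\<alpha> \<in> bottom m K" using \<alpha>(1) by (simp add: bottom_def)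
    then show ?thesis using \<alpha>(2) * by blast
  qed
  have B: "\<beta> \<in> L \<and> (\<forall>u\<in>\<beta>. \<forall>k\<le>m. 0 < bcoord m (real (d+1)) k (emb u) \<longrightarrow> s i \<le> s k)" if "\<beta> \<in> ?B" for \<beta>
  proof -
    have *: "emb v \<in> dilate m (d+1) 1 \<and> (\<forall>j\<le>m. 0 < bcoord m (real (d+1)) j (emb v) \<longrightarrow> s i \<le> s j)" if "v \<in> \<beta>" for v
    proof -
      have "geom \<beta> \<subseteq> geom (sbasis (d+1) ` J i)" using \<open>\<beta> \<in> ?B\<close> by (simp add: restr_def)
      then show ?thesis unfolding bottom_geom_iff[OF i, symmetric] using emb_in_geom that by blast
    qed
    then show ?thesis using \<open>\<beta> \<in> ?B\<close> by (simp add: restr_def)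
  qed
  show "join ?A ?B \<subseteq> restr ?T ?G"
  proof
    fix \<sigma> assume "\<sigma> \<in> join ?A ?B"
    then have "\<exists>\<alpha>' \<beta>. \<sigma> = \<alpha>' \<union> \<beta> \<and> \<sigma> \<noteq> {} \<and> \<alpha>' \<in> insert {} ?A \<and> \<beta> \<in> insert {} ?B"
    proof -
      have ne: "{} \<notin> ?A" "{} \<notin> ?B" using fanD(2)[OF K] fanD(2)[OF L] by (auto simp: restr_def)
      consider "\<sigma> \<in> ?A" | "\<sigma> \<in> ?B"
        | \<alpha>' \<beta> where "\<sigma> = \<alpha>' \<union> \<beta>" "\<alpha>' \<in> ?A" "\<beta> \<in> ?B"
        using \<open>\<sigma> \<in> join ?A ?B\<close> unfolding join_def by blast
      then show ?thesis
      proof cases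
        case 1
        then show ?thesis using ne by (intro exI[of _ \<sigma>] exI[of _ "{}"]) auto
      next
        case 2
        then show ?thesis using ne by (intro exI[of _ "{}"] exI[of _ \<sigma>]) auto
      next
        case 3
        then show ?thesis using ne by (intro exI[of _ \<alpha>'] exI[of _ \<beta>]) auto
      qed
    qed
    then obtain \<alpha>' \<beta> where \<sigma>: "\<sigma> = \<alpha>' \<union> \<beta>" "\<sigma> \<noteq> {}" "\<alpha>' \<in> insert {} ?A" "\<beta> \<in> insert {} ?B" by blast
    obtain \<alpha> where \<alpha>: "\<alpha> \<in> insert {} (bottom m K)" "\<alpha>' = raise m ` \<alpha>"
      "\<forall>v\<in>\<alpha>. \<forall>j\<le>m. 0 < bcoord m d j (emb v) \<longrightarrow> s j \<le> s i"
    proof (cases "\<alpha>' = {}")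
      case True
      then show ?thesis using that[of "{}"] by simp
    next
      case False
      then have "\<alpha>' \<in> ?A" using \<sigma>(3) by simp
      then obtain \<alpha> where "\<alpha> \<in> bottom m K" "\<alpha>' = raise m ` \<alpha>"
        "\<forall>v\<in>\<alpha>. \<forall>j\<le>m. 0 < bcoord m d j (emb v) \<longrightarrow> s j \<le> s i" using A by meson
      then show ?thesis using that[of \<alpha>] by simp
    qed
    have \<beta>: "\<beta> \<in> insert {} L" "\<forall>u\<in>\<beta>. \<forall>k\<le>m. 0 < bcoord m (real (d+1)) k (emb u) \<longrightarrow> s i \<le> s k"
      using B \<sigma>(4) by auto
    have "staircase m d s \<alpha> \<beta>" unfolding staircase_def using \<alpha>(3) \<beta>(2) by (meson order_trans)
    then have "\<sigma> \<in> ?T" using glue_layerI[OF \<alpha>(1) \<beta>(1)] \<sigma>(1,2) \<alpha>(2) by auto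
    moreover have "emb v \<in> ?G" if "v \<in> \<sigma>" for v
    proof -
      have "geom (top_vtx m d ` I i) \<subseteq> ?G" "geom (sbasis (d+1) ` J i) \<subseteq> ?G"
        by (intro geom_mono; blast)+
      moreover have "emb v \<in> geom (top_vtx m d ` I i) \<or> emb v \<in> geom (sbasis (d+1) ` J i)"
        using that \<sigma>(1,3,4) emb_in_geom by (auto simp: restr_def)
      ultimately show ?thesis by blast
    qed
    ultimately show "\<sigma> \<in> restr ?T ?G" by (simp add: restr_def geom_subset_convex convex_geom)
  qed
qed

lemma restr_upper: "restr (glue s m d K L) {x. x (m+1) \<ge> 1} = (`) (raise m) ` K"
proof
  show "(`) (raise m) ` K \<subseteq> restr (glue s m d K L) {x. x (m+1) \<ge> 1}"
    using heights(1) glue_raiseI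
    by (auto simp: restr_def geom_subset_convex[OF convex_height] emb_def raise_apply)
  show "restr (glue s m d K L) {x. x (m+1) \<ge> 1} \<subseteq> (`) (raise m) ` K"
  proof
    fix \<sigma> assume "\<sigma> \<in> restr (glue s m d K L) {x. x (m+1) \<ge> 1}"
    then have \<sigma>: "\<sigma> \<in> glue s m d K L" and h: "\<And>v. v \<in> \<sigma> \<Longrightarrow> 1 \<le> v (m+1)"
      by (auto simp: restr_def geom_subset_convex[OF convex_height] emb_def)
    from \<sigma> show "\<sigma> \<in> (`) (raise m) ` K"
    proof (cases rule: glue_cases)
      case (2 \<alpha> \<beta>)
      have "\<beta> = {}" using h 2(1,3) heights(2) by fastforce
      then show ?thesis using 2 by (auto simp: bottom_def)
    qed blast
  qed
qed

lemma glue_is_glued: "is_glued m d I J K L (glue s m d K L)"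
  unfolding is_glued_def translate_raise
proof (intro conjI ballI)
  show "triangulation (m+1) (PP (m+1) (d+1)) (glue s m d K L)"
    by (rule fan_triangulation[OF fan_glue[OF K L s]]) simp
  show "restr (glue s m d K L) {x. x (m+1) \<ge> 1} = (`) (raise m) ` K" by (rule restr_upper)
  show "restr (glue s m d K L) (geom (top_vtx m d ` I i \<union> sbasis (d+1) ` J i)) =
      join (restr ((`) (raise m) ` K) (geom (top_vtx m d ` I i))) (restr L (geom (sbasis (d+1) ` J i)))"
    if "i \<in> {0..m}" for i
    using that by (intro restr_piece) simp
qed

lemma glue_cover:
  assumes "\<sigma> \<in> glue s m d K L"
  shows "geom \<sigma> \<subseteq> {x. x (m+1) \<ge> 1} \<or>
      (\<exists>i\<in>{0..m}. geom \<sigma> \<subseteq> geom (top_vtx m d ` I i \<union> sbasis (d+1) ` J i))"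
  using assms
proof (cases rule: glue_cases)
  case (1 \<sigma>0)
  then have "\<sigma> \<in> restr (glue s m d K L) {x. x (m+1) \<ge> 1}" unfolding restr_upper by blast
  then show ?thesis by (simp add: restr_def)
next
  case (2 \<alpha> \<beta>)
  obtain i where i: "i \<le> m"
    and i\<alpha>: "\<forall>v\<in>\<alpha>. \<forall>j\<le>m. 0 < bcoord m (real d) j (emb v) \<longrightarrow> s j \<le> s i"
    and i\<beta>: "\<forall>u\<in>\<beta>. \<forall>k\<le>m. 0 < bcoord m (real (d+1)) k (emb u) \<longrightarrow> s i \<le> s k"
    by (rule staircase_index[OF 2(4)])
  let ?G = "geom (top_vtx m d ` I i \<union> sbasis (d+1) ` J i)"
  have G: "geom (top_vtx m d ` I i) \<subseteq> ?G" "geom (sbasis (d+1) ` J i) \<subseteq> ?G"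
    by (rule geom_mono, simp)+
  have "emb v \<in> ?G" if v: "v \<in> \<sigma>" for v
  proof (cases "v \<in> \<beta>")
    case True
    have "emb v \<in> geom (sbasis (d+1) ` J i)"
      using fanD(4)[OF L, of \<beta>] 2(3) i\<beta> True unfolding bottom_geom_iff[OF i] by blast
    then show ?thesis using G(2) by blast
  next
    case False
    then obtain u where u: "u \<in> \<alpha>" "v = raise m u" using v 2(1) by blast
    have "emb (raise m u) \<in> geom (top_vtx m d ` I i)"
      using bottom_dilate[OF K 2(2)] i\<alpha> u(1) unfolding top_geom_iff[OF i] by blast
    then show ?thesis using G(1) u(2) by blast
  qed
  then have "geom \<sigma> \<subseteq> ?G" by (simp add: geom_subset_convex convex_geom)
  then show ?thesis using i by auto
qed

lemma the_glued: "(THE T. is_glued m d I J K L T) = glue s m d K L"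
proof (rule the_equality)
  show "is_glued m d I J K L (glue s m d K L)" by (rule glue_is_glued)
  fix T assume T: "is_glued m d I J K L T"
  show "T = glue s m d K L"
    by (rule is_glued_unique[OF glue_is_glued T, symmetric]) (rule glue_cover)
qed

end

text \<open>
  The index sets in the definition of the two operations are the initial and the final segments of
  the order \<open>stair_key d\<close>.
\<close>

lemma plus_minus_tri_eq_glue:
  assumes K: "simplicial_fan (m+1) d K" and L: "simplicial_fan m (d+1) L" and "d \<ge> 1"
  shows "(if even d then plus_tri else minus_tri) m d K L = glue (stair_key d) m d K L"
proof (cases "even d")
  case True
  have "(THE T. is_glued m d (\<lambda>i. {0..i}) (\<lambda>i. {i..m}) K L T) = glue (stair_key d) m d K L"
    using True by (intro the_glued K L assms inj_stair_key) (auto simp: stair_key_def)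
  then show ?thesis using True by (simp add: plus_tri_def)
next
  case False
  have "(THE T. is_glued m d (\<lambda>i. {i..m}) (\<lambda>i. {0..i}) K L T) = glue (stair_key d) m d K L"
    using False by (intro the_glued K L assms inj_stair_key) (auto simp: stair_key_def)
  then show ?thesis using False by (simp add: minus_tri_def)
qed


section \<open>The base cases of the recursion\<close>

text \<open>
  Nonnegative integer barycentric coordinates of sum \<open>1\<close>.
\<close>

lemma unit_lattice_points:
  assumes "emb v \<in> dilate n 1 1"
  shows "v \<in> sbasis 1 ` {0..n}"
proof -
  have nn: "0 \<le> int_bcoord n 1 j v" if "j \<le> n" for j
  proof -
    have "0 \<le> bcoord n (real 1) j (emb v)" using assms that by (simp add: dilate_def)
    then show ?thesis unfolding bcoord_int by simp
  qed
  have sum: "(\<Sum>j\<le>n. int_bcoord n 1 j v) = 1"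
    using sum_int_bcoord[of "\<lambda>_. 1" n 1 v] by simp
  obtain j where j: "j \<le> n" "0 < int_bcoord n 1 j v"
  proof -
    have "\<exists>j\<le>n. 0 < int_bcoord n 1 j v"
    proof (rule ccontr)
      assume "\<not> ?thesis"
      then have "(\<Sum>j\<le>n. int_bcoord n 1 j v) \<le> 0" by (intro sum_nonpos) (auto simp: not_less)
      then show False using sum by simp
    qed
    then show ?thesis using that by blast
  qed
  have "int_bcoord n 1 j v + (\<Sum>k\<in>{..n} - {j}. int_bcoord n 1 k v) = 1"
    using sum j(1) by (subst (asm) sum.remove[of _ j]) auto
  moreover have "0 \<le> (\<Sum>k\<in>{..n} - {j}. int_bcoord n 1 k v)" using nn by (intro sum_nonneg) auto
  ultimately have one: "int_bcoord n 1 j v = 1" "(\<Sum>k\<in>{..n} - {j}. int_bcoord n 1 k v) = 0"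
    using j(2) by linarith+
  have other: "int_bcoord n 1 k v = 0" if "k \<le> n" "k \<noteq> j" for k
    using one(2) nn that by (subst (asm) sum_nonneg_eq_0_iff) auto
  have "v = sbasis 1 j"
  proof
    fix i show "v i = sbasis 1 j i"
    proof (cases "i \<in> {1..n}")
      case True
      then show ?thesis using one(1) other[of i] by (auto simp: int_bcoord_def sbasis_def)
    next
      case False
      then have "v i = 0" using assms by (auto simp: dilate_def emb_def)
      then show ?thesis using False j(1) by (auto simp: sbasis_def)
    qed
  qed
  then show ?thesis using j(1) by auto
qed

text \<open>
  The simplex containing the barycentre must have all vertices of the polytope.
\<close>

lemma itenberg_viro_unit:
  "itenberg_viro n 1 = {\<sigma>. \<sigma> \<noteq> {} \<and> \<sigma> \<subseteq> sbasis 1 ` {0..n}}"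
proof
  have K: "simplicial_fan n 1 (itenberg_viro n 1)" by (rule fan_itenberg_viro)
  show "itenberg_viro n 1 \<subseteq> {\<sigma>. \<sigma> \<noteq> {} \<and> \<sigma> \<subseteq> sbasis 1 ` {0..n}}"
    using fanD(2,4)[OF K] unit_lattice_points by fastforce
  define x :: rpoint where "x i = (if i \<in> {1..n} then 1 / real (n+1) else 0)" for i
  have x: "bcoord n 1 j x = 1 / real (n+1)" if "j \<le> n" for j
    using that by (auto simp: bcoord_def x_def field_simps)
  then have "x \<in> dilate n 1 1" by (simp add: dilate_def) (simp add: x_def)
  then obtain \<sigma> w where \<sigma>: "\<sigma> \<in> insert {} (itenberg_viro n 1)" "conic_rep \<sigma> w 1 x"
    by (rule fan_ex[OF K zero_le_one])
  have sub: "sbasis 1 ` {0..n} \<subseteq> \<sigma>"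
  proof
    fix v assume "v \<in> sbasis 1 ` {0..n}"
    then obtain j where j: "j \<le> n" "v = sbasis 1 j" by auto
    have "0 < bcoord n (1 * 1) j x" using x[OF j(1)] by simp
    then obtain u where u: "u \<in> \<sigma>" "0 < bcoord n 1 j (emb u)"
      by (rule bcoord_pos_vertex[OF \<sigma>(2)])
    then have "emb u \<in> dilate n 1 1" using fanD(4)[OF K, of \<sigma>] \<sigma>(1) by auto
    then obtain k where k: "k \<le> n" "u = sbasis 1 k" using unit_lattice_points by fastforce
    then have "k = j" using u(2) bcoord_sbasis[of k n j 1] j(1) by (auto split: if_splits)
    then show "v \<in> \<sigma>" using u(1) k(2) j(2) by simp
  qed
  then have "\<sigma> \<noteq> {}" by auto
  then have "\<sigma> \<in> itenberg_viro n 1" using \<sigma>(1) by simp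
  then show "{\<sigma>. \<sigma> \<noteq> {} \<and> \<sigma> \<subseteq> sbasis 1 ` {0..n}} \<subseteq> itenberg_viro n 1"
    using fanD(5)[OF K] sub by blast
qed

text \<open>
  Only the first coordinate matters, and on \<open>geom \<sigma>\<close> it takes all values between its minimum and its
  maximum on the vertices.
\<close>

lemma vol_segment:
  assumes fin: "finite \<sigma>" "\<sigma> \<noteq> {}"
  defines "a \<equiv> real_of_int (Min ((\<lambda>v. v 1) ` \<sigma>))" and "b \<equiv> real_of_int (Max ((\<lambda>v. v 1) ` \<sigma>))"
  shows "vol 1 (geom \<sigma>) = b - a"
proof -
  have mm: "Min ((\<lambda>v. v 1) ` \<sigma>) \<in> (\<lambda>v. v 1) ` \<sigma>" "Max ((\<lambda>v. v 1) ` \<sigma>) \<in> (\<lambda>v. v 1) ` \<sigma>"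
    using fin by (auto intro!: Min_in Max_in)
  from mm(1) obtain p where p0: "Min ((\<lambda>v. v 1) ` \<sigma>) = p 1" "p \<in> \<sigma>" by (rule imageE)
  from mm(2) obtain q where q0: "Max ((\<lambda>v. v 1) ` \<sigma>) = q 1" "q \<in> \<sigma>" by (rule imageE)
  have p: "p \<in> \<sigma>" "a = real_of_int (p 1)" and q: "q \<in> \<sigma>" "b = real_of_int (q 1)"
    using p0 q0 by (simp_all add: a_def b_def)
  have ab: "a \<le> real_of_int (v 1)" "real_of_int (v 1) \<le> b" if "v \<in> \<sigma>" for v
    using fin that by (auto simp: a_def b_def)
  have "a \<le> b" using ab[OF p(1)] by linarith
  have "(\<lambda>x. restrict x {1..1}) ` geom \<sigma> = Pi\<^sub>E {1..1::nat} (\<lambda>_. {a..b})"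
  proof
    show "(\<lambda>x. restrict x {1..1}) ` geom \<sigma> \<subseteq> Pi\<^sub>E {1..1} (\<lambda>_. {a..b})"
    proof
      fix y assume "y \<in> (\<lambda>x. restrict x {1..1}) ` geom \<sigma>"
      then obtain x where x: "x \<in> geom \<sigma>" "y = restrict x {1..1}" by blast
      then obtain w where w: "conic_rep \<sigma> w 1 x" using geom_eq_conic_rep[OF fin(1)] by blast
      have "(\<Sum>v\<in>\<sigma>. w v * a) \<le> x 1" "x 1 \<le> (\<Sum>v\<in>\<sigma>. w v * b)"
        unfolding conic_repD(4)[OF w, symmetric] using ab conic_repD(1)[OF w]
        by (auto intro!: sum_mono mult_left_mono)
      then have "a \<le> x 1" "x 1 \<le> b"
        using conic_repD(3)[OF w] by (simp_all flip: sum_distrib_right)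
      then show "y \<in> Pi\<^sub>E {1..1} (\<lambda>_. {a..b})" using x(2) by auto
    qed
    show "Pi\<^sub>E {1..1} (\<lambda>_. {a..b}) \<subseteq> (\<lambda>x. restrict x {1..1}) ` geom \<sigma>"
    proof
      fix y :: "nat \<Rightarrow> real" assume y: "y \<in> Pi\<^sub>E {1..1} (\<lambda>_. {a..b})"
      define u where "u = (if a = b then 0 else (y 1 - a) / (b - a))"
      have y1: "a \<le> y 1" "y 1 \<le> b" using PiE_mem[OF y, of 1] by simp_all
      have u: "0 \<le> u" "u \<le> 1" using y1 \<open>a \<le> b\<close> by (auto simp: u_def divide_simps)
      have "(1 - u) * a + u * b = y 1"
      proof (cases "a = b")
        case True
        then show ?thesis using y1 by (simp add: u_def)
      next
        case False
        then have "u * (b - a) = y 1 - a" by (simp add: u_def)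
        then show ?thesis by (simp add: algebra_simps)
      qed
      moreover have "(1 - u) *\<^sub>R emb p + u *\<^sub>R emb q \<in> geom \<sigma>"
        using emb_in_geom[OF p(1)] emb_in_geom[OF q(1)] u
        by (intro convexD[OF convex_geom]) auto
      ultimately have "\<exists>x\<in>geom \<sigma>. x 1 = y 1"
        using p(2) q(2)
        by (intro bexI[of _ "(1 - u) *\<^sub>R emb p + u *\<^sub>R emb q"]) (auto simp: scaleR_apply emb_def)
      then obtain x where x: "x \<in> geom \<sigma>" "x 1 = y 1" by blast
      have "y = restrict x {1..1}"
      proof
        fix i show "y i = restrict x {1..1} i"
          using x(2) PiE_arb[OF y, of i] by (cases "i = 1") simp_all
      qed
      then show "y \<in> (\<lambda>x. restrict x {1..1}) ` geom \<sigma>" using x(1) by blast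
    qed
  qed
  moreover have "emeasure (Pi\<^sub>M {1..1::nat} (\<lambda>_. lborel)) (Pi\<^sub>E {1..1} (\<lambda>_. {a..b})) = ennreal (b - a)"
  proof -
    interpret product_sigma_finite "\<lambda>_ :: nat. lborel :: real measure" by unfold_locales
    show ?thesis using \<open>a \<le> b\<close> by (subst emeasure_PiM) auto
  qed
  ultimately show ?thesis using \<open>a \<le> b\<close> by (simp add: vol_def measure_def)
qed

lemma raise_sbasis: "raise 0 (sbasis k 1) = sbasis (Suc k) 1"
  by (auto simp: fun_eq_iff raise_apply sbasis_def)

lemma sbasis_0_1: "sbasis 0 1 = 0"
  by (auto simp: fun_eq_iff sbasis_def)

lemma segment_in_itenberg_viro:
  "k < d \<Longrightarrow> {sbasis k 1, sbasis (Suc k) 1} \<in> itenberg_viro 1 d"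
proof (induction d arbitrary: k)
  case (Suc d)
  have e: "itenberg_viro 1 (Suc d) = glue (stair_key d) 0 d (itenberg_viro 1 d) {{0}}" by simp
  show ?case
  proof (cases k)
    case 0
    have "bottom 0 (itenberg_viro 1 d) = {{0}}" using bottom_itenberg_viro[of 0 d] by simp
    then have "raise 0 ` {0} \<union> {0} \<in> insert {} (glue (stair_key d) 0 d (itenberg_viro 1 d) {{0}})"
      by (intro glue_layerI) (auto simp: staircase_def)
    moreover have "raise 0 ` {0} \<union> {0} = {sbasis k 1, sbasis (Suc k) 1}"
      using raise_sbasis[of 0] 0 by (auto simp: sbasis_0_1[unfolded One_nat_def])
    ultimately show ?thesis unfolding e by simp
  next
    case (Suc k')
    then have "raise 0 ` {sbasis k' 1, sbasis (Suc k') 1} \<in> itenberg_viro 1 (Suc d)"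
      unfolding e using Suc.IH[of k'] Suc.prems by (intro glue_raiseI) simp
    then show ?thesis using Suc raise_sbasis[unfolded One_nat_def] by simp
  qed
qed simp

lemma itenberg_viro_segment:
  "\<sigma> \<in> itenberg_viro 1 (Suc d) \<Longrightarrow> \<exists>k\<le>d. \<sigma> \<subseteq> {sbasis k 1, sbasis (Suc k) 1}"
proof (induction d arbitrary: \<sigma>)
  case 0
  then have "\<sigma> \<subseteq> sbasis 1 ` {0..1}" using itenberg_viro_unit[of 1] by auto
  moreover have "{0..1::nat} = {0,1}" by auto
  moreover have "sbasis 1 0 = sbasis 0 1" by (auto simp: sbasis_def fun_eq_iff)
  ultimately show ?case by auto
next
  case (Suc d)
  have e: "itenberg_viro 1 (Suc (Suc d)) = glue (stair_key (Suc d)) 0 (Suc d) (itenberg_viro 1 (Suc d)) {{0}}"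
    by simp
  have "\<sigma> \<in> glue (stair_key (Suc d)) 0 (Suc d) (itenberg_viro 1 (Suc d)) {{0}}"
    using Suc.prems unfolding e .
  then show ?case
  proof (cases rule: glue_cases)
    case (1 \<sigma>0)
    then obtain k where k: "k \<le> d" "\<sigma>0 \<subseteq> {sbasis k 1, sbasis (Suc k) 1}" using Suc.IH by blast
    then have "\<sigma> \<subseteq> {sbasis (Suc k) 1, sbasis (Suc (Suc k)) 1}"
      using image_mono[OF k(2), of "raise 0"] unfolding 1(2) image_insert raise_sbasis by simp
    then show ?thesis using k(1) by (intro exI[of _ "Suc k"]) simp
  next
    case (2 \<alpha> \<beta>)
    have "bottom 0 (itenberg_viro 1 (Suc d)) = {{0}}" using bottom_itenberg_viro[of 0 "Suc d"] by simp
    then have "raise 0 ` \<alpha> \<subseteq> {sbasis (Suc 0) 1}" "\<beta> \<subseteq> {sbasis 0 1}"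
      using 2(2,3) raise_sbasis[of 0] by (auto simp: sbasis_0_1[unfolded One_nat_def])
    then show ?thesis using 2(1) by (intro exI[of _ 0]) auto
  qed
qed

lemma lattice_pts_1:
  assumes "v \<in> lattice_pts 1" "v 1 = int k"
  shows "v = sbasis k 1"
  using assms by (auto simp: lattice_pts_def sbasis_def fun_eq_iff)

text \<open>
  In a primitive triangulation of a segment each maximal simplex has length one, hence joins two
  consecutive lattice points; so the triangulation is contained in the recursively defined one.
\<close>

lemma IV_segment: "IV 1 (Suc d) = itenberg_viro 1 (Suc d)"
proof -
  let ?K0 = "itenberg_viro 1 (Suc d)"
  have fan: "simplicial_fan 1 (Suc d) ?K0" by (rule fan_itenberg_viro)
  have T0: "triangulation 1 (PP 1 (Suc d)) ?K0" by (rule fan_triangulation[OF fan]) simp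
  have "(THE K. primitive_triangulation 1 (PP 1 (Suc d)) K) = ?K0"
  proof (rule the_equality)
    have "vol 1 (geom \<sigma>) = 1" if \<sigma>: "\<sigma> \<in> ?K0" "\<forall>\<tau>\<in>?K0. \<sigma> \<subseteq> \<tau> \<longrightarrow> \<tau> = \<sigma>" for \<sigma>
    proof -
      obtain k where k: "k \<le> d" "\<sigma> \<subseteq> {sbasis k 1, sbasis (Suc k) 1}"
        using itenberg_viro_segment[OF \<sigma>(1)] by blast
      then have "\<sigma> = {sbasis k 1, sbasis (Suc k) 1}"
        using \<sigma>(2) segment_in_itenberg_viro[of k "Suc d"] by (metis le_imp_less_Suc)
      then show ?thesis using vol_segment[of \<sigma>] by (simp add: sbasis_def)
    qed
    then show "primitive_triangulation 1 (PP 1 (Suc d)) ?K0"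
      using T0 by (simp add: primitive_triangulation_def)
    fix K assume K: "primitive_triangulation 1 (PP 1 (Suc d)) K"
    then have T: "triangulation 1 (PP 1 (Suc d)) K" by (simp add: primitive_triangulation_def)
    show "K = ?K0"
    proof (rule triangulation_subset_eq[OF T T0], rule subsetI)
      fix \<sigma> assume \<sigma>: "\<sigma> \<in> K"
      have "finite K" using T by (simp add: triangulation_def)
      then obtain \<tau> where \<tau>: "\<tau> \<in> K" "\<sigma> \<subseteq> \<tau>" "\<forall>\<rho>\<in>K. \<tau> \<subseteq> \<rho> \<longrightarrow> \<rho> = \<tau>"
        using finite_has_maximal2[of K \<sigma>] \<sigma> by metis
      have fin: "finite \<tau>" "\<tau> \<noteq> {}" "\<tau> \<subseteq> lattice_pts 1" using T \<tau>(1) by (auto simp: triangulation_def)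
      have "vol 1 (geom \<tau>) = 1" using K \<tau>(1,3) by (simp add: primitive_triangulation_def)
      then have mm: "Max ((\<lambda>v. v 1) ` \<tau>) = Min ((\<lambda>v. v 1) ` \<tau>) + 1"
        unfolding vol_segment[OF fin(1,2)] by linarith
      have range: "0 \<le> v 1 \<and> v 1 \<le> int (Suc d)" if "v \<in> \<tau>" for v
      proof -
        have U: "(\<Union>\<sigma>\<in>K. geom \<sigma>) = PP 1 (Suc d)"
          using T unfolding triangulation_def by (elim conjE) assumption
        have "emb v \<in> PP 1 (Suc d)"
          unfolding U[symmetric] using \<tau>(1) emb_in_geom[OF that] by (rule UN_I)
        then have D: "emb v \<in> dilate 1 (Suc d) 1" using PP_eq[of "Suc d" 1] by (simp only: le_add2 One_nat_def Suc_le_mono le0)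
        have "0 \<le> bcoord 1 (real (Suc d) * 1) 0 (emb v)" "0 \<le> bcoord 1 (real (Suc d) * 1) 1 (emb v)"
          using D unfolding dilate_def by blast+
        then show ?thesis by (simp add: bcoord_def emb_def)
      qed
      define k where "k = nat (Min ((\<lambda>v. v 1) ` \<tau>))"
      have mm': "Min ((\<lambda>v. v 1) ` \<tau>) \<in> (\<lambda>v. v 1) ` \<tau>" "Max ((\<lambda>v. v 1) ` \<tau>) \<in> (\<lambda>v. v 1) ` \<tau>"
        using fin by (auto intro!: Min_in Max_in)
      from mm'(1) obtain p where p: "Min ((\<lambda>v. v 1) ` \<tau>) = p 1" "p \<in> \<tau>" by (rule imageE)
      from mm'(2) obtain q where q: "Max ((\<lambda>v. v 1) ` \<tau>) = q 1" "q \<in> \<tau>" by (rule imageE)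
      have k: "int k = Min ((\<lambda>v. v 1) ` \<tau>)" "k \<le> d"
        unfolding k_def using range[OF p(2)] range[OF q(2)] mm p(1) q(1) by linarith+
      have "v = sbasis k 1 \<or> v = sbasis (Suc k) 1" if "v \<in> \<tau>" for v
      proof -
        have "Min ((\<lambda>v. v 1) ` \<tau>) \<le> v 1" "v 1 \<le> Max ((\<lambda>v. v 1) ` \<tau>)" using fin that by auto
        then have "v 1 = int k \<or> v 1 = int (Suc k)" using k(1) mm by linarith
        then show ?thesis using lattice_pts_1 that fin(3) by blast
      qed
      then have "\<sigma> \<subseteq> {sbasis k 1, sbasis (Suc k) 1}" using \<tau>(2) by blast
      moreover have "\<sigma> \<noteq> {}" using T \<sigma> by (auto simp: triangulation_def)
      ultimately show "\<sigma> \<in> ?K0"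
        using fanD(5)[OF fan segment_in_itenberg_viro[of k "Suc d"]] k(2) by simp
    qed
  qed
  then show ?thesis by simp
qed

section \<open>Identification with the recursive description\<close>

theorem IV_eq_itenberg_viro: "1 \<le> n \<Longrightarrow> 1 \<le> d \<Longrightarrow> IV n d = itenberg_viro n d"
proof (induction n d rule: IV.induct)
  case (3 d)
  show ?case using IV_segment[of d] by simp
next
  case (4 m)
  show ?case using itenberg_viro_unit[of "Suc (Suc m)"] by simp
next
  case (5 m d)
  let ?K = "itenberg_viro (Suc (Suc m)) (Suc d)" and ?L = "itenberg_viro (Suc m) (Suc (Suc d))"
  have "IV (Suc (Suc m)) (Suc d) = ?K" "IV (Suc m) (Suc (Suc d)) = ?L"
    using "5.IH" by simp_all
  then have "IV (Suc (Suc m)) (Suc (Suc d)) =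
      (if even (Suc d) then plus_tri else minus_tri) (Suc m) (Suc d) ?K ?L" by simp
  also have "\<dots> = glue (stair_key (Suc d)) (Suc m) (Suc d) ?K ?L"
    using plus_minus_tri_eq_glue[of "Suc m" "Suc d" ?K ?L]
      fan_itenberg_viro[of "Suc (Suc m)" "Suc d"] fan_itenberg_viro[of "Suc m" "Suc (Suc d)"]
    by (simp only: Suc_eq_plus1[symmetric])
  finally show ?case by simp
qed simp_all


section \<open>Linear independence of barycentric vectors\<close>

text \<open>
  The homogeneous coordinate vector of a lattice point in the face spanned by the vertices in \<open>I\<close>.
\<close>

definition bvec :: "nat \<Rightarrow> nat \<Rightarrow> nat set \<Rightarrow> lpoint \<Rightarrow> rpoint" where
  "bvec n d I v = (\<lambda>i. if i \<in> I then bcoord n (real d) i (emb v) else 0)"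

definition supported :: "nat \<Rightarrow> nat \<Rightarrow> nat set \<Rightarrow> lpoint set \<Rightarrow> bool" where
  "supported n d I \<sigma> \<longleftrightarrow> (\<forall>v\<in>\<sigma>. \<forall>j\<le>n. j \<notin> I \<longrightarrow> bcoord n (real d) j (emb v) = 0)"

text \<open>
  The barycentric coordinates have the nonzero sum \<open>d\<close>, so a relation between them is a relation
  between the points that also preserves the mass.
\<close>

lemma bvec_relation:
  assumes fan: "simplicial_fan n d K" and "\<sigma> \<in> K" "d \<ge> 1" "supported n d I \<sigma>"
    and rel: "\<And>i. i \<in> I \<Longrightarrow> (\<Sum>v\<in>\<sigma>. c v * bcoord n (real d) i (emb v)) = 0"
    and "v \<in> \<sigma>"
  shows "c v = 0"
proof (rule fan_independent[OF fan \<open>\<sigma> \<in> K\<close> _ _ \<open>v \<in> \<sigma>\<close>])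
  have z: "(\<Sum>v\<in>\<sigma>. c v * bcoord n (real d) j (emb v)) = 0" if "j \<le> n" for j
  proof (cases "j \<in> I")
    case False
    then have "\<forall>v\<in>\<sigma>. bcoord n (real d) j (emb v) = 0"
      using that \<open>supported n d I \<sigma>\<close> by (simp add: supported_def)
    then show ?thesis by (intro sum.neutral) simp
  qed (rule rel)
  have "0 = (\<Sum>j\<le>n. \<Sum>v\<in>\<sigma>. c v * bcoord n (real d) j (emb v))" using z by simp
  also have "\<dots> = (\<Sum>v\<in>\<sigma>. c v * (\<Sum>j\<le>n. bcoord n (real d) j (emb v)))"
    by (subst sum.swap) (simp add: sum_distrib_left)
  also have "\<dots> = (\<Sum>v\<in>\<sigma>. c v) * d" by (simp add: sum_bcoord sum_distrib_right)
  finally show "(\<Sum>v\<in>\<sigma>. c v) = 0" using \<open>d \<ge> 1\<close> by simp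
  fix i
  show "(\<Sum>v\<in>\<sigma>. c v * real_of_int (v i)) = 0"
  proof (cases "i \<in> {1..n}")
    case True
    then show ?thesis using z[of i] by (simp add: bcoord_def emb_def)
  next
    case False
    then have "v i = 0" if "v \<in> \<sigma>" for v
      using fanD(4)[OF fan \<open>\<sigma> \<in> K\<close>] that by (force simp: dilate_def emb_def)
    then show ?thesis by (intro sum.neutral) simp
  qed
qed

lemma inj_on_bvec:
  assumes fan: "simplicial_fan n d K" and "\<sigma> \<in> K" "supported n d I \<sigma>"
  shows "inj_on (bvec n d I) \<sigma>"
proof
  fix u v assume u: "u \<in> \<sigma>" and v: "v \<in> \<sigma>" and e: "bvec n d I u = bvec n d I v"
  have D: "emb u \<in> dilate n d 1" "emb v \<in> dilate n d 1" using fanD(4)[OF fan \<open>\<sigma> \<in> K\<close>] u v by auto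
  have "emb u = emb v"
  proof (rule bcoord_ext[of n _ _ "real d"])
    show "emb u i = emb v i" if "i \<notin> {1..n}" for i using D that by (simp add: dilate_def)
    show "bcoord n (real d) j (emb u) = bcoord n (real d) j (emb v)" if "j \<in> {1..n}" for j
      using fun_cong[OF e, of j] assms(3) u v that
      by (cases "j \<in> I") (simp_all add: bvec_def supported_def)
  qed
  then show "u = v" using inj_emb by (simp add: inj_eq)
qed

lemma independent_bvec:
  assumes fan: "simplicial_fan n d K" and \<sigma>: "\<sigma> \<in> K" "d \<ge> 1" "supported n d I \<sigma>"
  shows "independent (bvec n d I ` \<sigma>)"
proof
  have fin: "finite \<sigma>" using fanD(3)[OF fan \<sigma>(1)] .
  assume "dependent (bvec n d I ` \<sigma>)"
  then obtain U where U: "\<exists>y\<in>bvec n d I ` \<sigma>. U y \<noteq> 0" "(\<Sum>y\<in>bvec n d I ` \<sigma>. U y *\<^sub>R y) = 0"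
    using dependent_finite[of "bvec n d I ` \<sigma>"] fin by auto
  have s: "(\<Sum>v\<in>\<sigma>. U (bvec n d I v) *\<^sub>R bvec n d I v) = 0"
    using U(2) by (simp add: sum.reindex[OF inj_on_bvec[OF fan \<sigma>(1,3)]])
  have "(\<Sum>v\<in>\<sigma>. U (bvec n d I v) * bcoord n (real d) i (emb v)) = 0" if "i \<in> I" for i
    using fun_cong[OF s, of i] that by (simp add: sum_apply scaleR_apply bvec_def)
  then have "U (bvec n d I v) = 0" if "v \<in> \<sigma>" for v
    using bvec_relation[OF fan \<sigma>, of "\<lambda>v. U (bvec n d I v)"] that by blast
  then show False using U(1) by blast
qed

definition unit_vec :: "nat \<Rightarrow> rpoint" where
  "unit_vec i = (\<lambda>j. if j = i then 1 else 0)"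

lemma span_unit_vec:
  assumes "finite I" "\<And>i. i \<notin> I \<Longrightarrow> x i = 0"
  shows "x \<in> span (unit_vec ` I)"
proof -
  have "(\<Sum>i\<in>I. x i *\<^sub>R unit_vec i) \<in> span (unit_vec ` I)"
    by (intro span_sum span_scale span_base) auto
  moreover have "(\<Sum>i\<in>I. x i *\<^sub>R unit_vec i) = x"
  proof
    fix j
    have "(\<Sum>i\<in>I. x i *\<^sub>R unit_vec i) j = (\<Sum>i\<in>I. if i = j then x j else 0)"
      unfolding sum_apply by (intro sum.cong) (auto simp: scaleR_apply unit_vec_def)
    then show "(\<Sum>i\<in>I. x i *\<^sub>R unit_vec i) j = x j" using assms by simp
  qed
  ultimately show ?thesis by simp
qed

lemma fan_card_le:
  assumes fan: "simplicial_fan n d K" and \<sigma>: "\<sigma> \<in> K" "d \<ge> 1" "supported n d I \<sigma>" and "finite I"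
  shows "card \<sigma> \<le> card I"
proof -
  have "bvec n d I ` \<sigma> \<subseteq> span (unit_vec ` I)"
    using span_unit_vec[OF \<open>finite I\<close>] by (auto simp: bvec_def)
  then have "card (bvec n d I ` \<sigma>) \<le> card (unit_vec ` I)"
    using independent_span_bound[OF _ independent_bvec[OF fan \<sigma>]] \<open>finite I\<close> by blast
  then show ?thesis
    using card_image[OF inj_on_bvec[OF fan \<sigma>(1,3)]] card_image_le[OF \<open>finite I\<close>, of unit_vec] by simp
qed

section \<open>The Harnack distribution is flat across interior facets\<close>

definition affine_mod2 :: "nat \<Rightarrow> lpoint set \<Rightarrow> (lpoint \<Rightarrow> bit) \<Rightarrow> bool" where
  "affine_mod2 n S f \<longleftrightarrow> (\<exists>u c. \<forall>x\<in>S. f x = pairing2 n x u + c)"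

text \<open>
  The property that makes the Hessians of the Harnack distribution and of \<open>\<chi>\<^sub>v\<close> agree at each simplex
  \<open>\<tau>\<close> of codimension one containing the interior vertex \<open>v\<close>; \<open>a\<close> and \<open>b\<close> are the apexes over \<open>\<tau>\<close>.
\<close>

definition harnack_flat :: "nat \<Rightarrow> nat \<Rightarrow> lpoint set set \<Rightarrow> bool" where
  "harnack_flat n d K \<longleftrightarrow> (\<forall>\<tau> a b v. insert a \<tau> \<in> K \<longrightarrow> insert b \<tau> \<in> K \<longrightarrow> a \<notin> \<tau> \<longrightarrow> b \<notin> \<tau> \<longrightarrow>
     a \<noteq> b \<longrightarrow> card \<tau> = n \<longrightarrow> v \<in> \<tau> \<longrightarrow> (\<forall>j\<le>n. 0 < bcoord n (real d) j (emb v)) \<longrightarrow>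
     affine_mod2 n (insert a (insert b \<tau>)) (\<lambda>x. harnack n x + chi v x))"

(* these rules would replace the field operations by bit operations *)
declare add_bit_eq_xor [simp del] mult_bit_eq_and [simp del]

lemma bit_add_self [simp]: "(b :: bit) + b = 0"
  by (cases b) simp_all

lemma bit_add_self_left [simp]: "(b :: bit) + (b + c) = c"
  by (simp only: add.assoc[symmetric] bit_add_self add_0_left)

lemma harnack_Suc:
  "harnack (m+1) x = harnack m x + (\<Sum>i\<in>{1..m}. of_int (x i)) * of_int (x (m+1))"
proof -
  let ?A = "{(i, j). i \<in> {1..m} \<and> j \<in> {1..m} \<and> i < j}" and ?B = "(\<lambda>i. (i, m+1)) ` {1..m}"
  let ?f = "\<lambda>(i, j). of_int (x i) * of_int (x j) :: bit"
  have "{(i, j). i \<in> {1..m+1} \<and> j \<in> {1..m+1} \<and> i < j} = ?A \<union> ?B"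
    by (auto simp: le_Suc_eq)
  moreover have "finite ?A" by (rule finite_subset[of _ "{1..m} \<times> {1..m}"]) auto
  moreover have "?A \<inter> ?B = {}" by auto
  ultimately have "harnack (m+1) x = sum ?f ?A + sum ?f ?B"
    unfolding harnack_def by (simp add: sum.union_disjoint)
  also have "sum ?f ?B = (\<Sum>i\<in>{1..m}. of_int (x i) * of_int (x (m+1)))"
    by (subst sum.reindex) (auto simp: inj_on_def)
  finally show ?thesis by (simp add: harnack_def sum_distrib_right)
qed

lemma harnack_cong: "(\<And>i. i \<in> {1..m} \<Longrightarrow> x i = y i) \<Longrightarrow> harnack m x = harnack m y"
  unfolding harnack_def by (intro sum.cong) auto

lemma harnack_raise:
  "harnack (m+1) (raise m x) = harnack (m+1) x + (\<Sum>i\<in>{1..m}. of_int (x i))"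
proof -
  have "harnack m (raise m x) = harnack m x" by (rule harnack_cong) (simp add: raise_apply)
  moreover have "(\<Sum>i\<in>{1..m}. of_int (raise m x i)) = (\<Sum>i\<in>{1..m}. of_int (x i) :: bit)"
    by (intro sum.cong) (auto simp: raise_apply)
  ultimately show ?thesis
    unfolding harnack_Suc by (simp add: raise_apply distrib_left add_ac)
qed

lemma pairing2_Suc: "pairing2 (m+1) x u = pairing2 m x u + of_int (x (m+1)) * u (m+1)"
  by (simp add: pairing2_def)

lemma pairing2_cong:
  "(\<And>i. i \<in> {1..m} \<Longrightarrow> x i = y i) \<Longrightarrow> (\<And>i. i \<in> {1..m} \<Longrightarrow> u i = w i) \<Longrightarrow>
    pairing2 m x u = pairing2 m y w"
  unfolding pairing2_def by (intro sum.cong) auto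

lemma pairing2_plus_one:
  "pairing2 m x (\<lambda>i. u i + 1) = pairing2 m x u + (\<Sum>i\<in>{1..m}. of_int (x i))"
  by (simp add: pairing2_def distrib_left sum.distrib)

lemma chi_raise: "chi (raise m v) (raise m x) = chi v x"
  using inj_raise[of m] by (simp add: chi_def inj_eq)

lemma affine_mod2_raise:
  assumes "affine_mod2 (m+1) S (\<lambda>x. harnack (m+1) x + chi v x)"
  shows "affine_mod2 (m+1) (raise m ` S) (\<lambda>x. harnack (m+1) x + chi (raise m v) x)"
proof -
  obtain u c where u: "\<And>x. x \<in> S \<Longrightarrow> harnack (m+1) x + chi v x = pairing2 (m+1) x u + c"
    using assms unfolding affine_mod2_def by blast
  define w where "w i = (if i \<le> m then u i + 1 else u i)" for i
  have "harnack (m+1) (raise m x) + chi (raise m v) (raise m x) =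
      pairing2 (m+1) (raise m x) w + (c + u (m+1))" if "x \<in> S" for x
  proof -
    have "pairing2 m (raise m x) w = pairing2 m x (\<lambda>i. u i + 1)"
      by (rule pairing2_cong) (auto simp: raise_apply w_def)
    then have "pairing2 (m+1) (raise m x) w =
        pairing2 m x u + (\<Sum>i\<in>{1..m}. of_int (x i)) + (of_int (x (m+1)) + 1) * u (m+1)"
      unfolding pairing2_Suc pairing2_plus_one by (simp add: raise_apply w_def)
    moreover have "harnack (m+1) (raise m x) + chi (raise m v) (raise m x) =
        (harnack (m+1) x + chi v x) + (\<Sum>i\<in>{1..m}. of_int (x i))"
      unfolding harnack_raise chi_raise by (simp add: add_ac)
    ultimately show ?thesis
      unfolding u[OF that] pairing2_Suc by (simp add: algebra_simps)
  qed
  then show ?thesis unfolding affine_mod2_def by blast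
qed

text \<open>
  The coefficient of the last coordinate and the constant term are still free. On the raised points
  only their sum matters, and at \<open>q\<close>, whose last coordinate is even, only the constant term.
\<close>

lemma affine_mod2_cone:
  assumes "affine_mod2 m S (\<lambda>x. harnack m x + chi v x)" "\<And>x. x \<in> S \<Longrightarrow> x (m+1) = 0"
    and q: "even (q (m+1))"
  shows "affine_mod2 (m+1) (insert q (raise m ` S)) (\<lambda>x. harnack (m+1) x + chi (raise m v) x)"
proof -
  let ?f = "\<lambda>x. harnack (m+1) x + chi (raise m v) x"
  obtain u c where u: "\<And>x. x \<in> S \<Longrightarrow> harnack m x + chi v x = pairing2 m x u + c"
    using assms(1) unfolding affine_mod2_def by blast
  (* raising adds the sum of the first m coordinates to the Harnack distribution, whence u i + 1 *)
  define b where "b = ?f q + pairing2 m q (\<lambda>i. u i + 1)"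
  define w where "w i = (if i \<le> m then u i + 1 else c + b)" for i
  have "?f (raise m x) = pairing2 (m+1) (raise m x) w + b" if "x \<in> S" for x
  proof -
    have "pairing2 m (raise m x) w = pairing2 m x (\<lambda>i. u i + 1)"
      by (rule pairing2_cong) (auto simp: raise_apply w_def)
    then have "pairing2 (m+1) (raise m x) w = pairing2 m x u + (\<Sum>i\<in>{1..m}. of_int (x i)) + (c + b)"
      unfolding pairing2_Suc pairing2_plus_one using assms(2)[OF that] by (simp add: raise_apply w_def)
    moreover have "?f (raise m x) = (harnack m x + chi v x) + (\<Sum>i\<in>{1..m}. of_int (x i))"
      unfolding harnack_raise chi_raise unfolding harnack_Suc using assms(2)[OF that] by (simp add: add_ac)
    ultimately show ?thesis unfolding u[OF that] by (simp add: algebra_simps)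
  qed
  moreover have "?f q = pairing2 (m+1) q w + b"
  proof -
    have "pairing2 m q w = pairing2 m q (\<lambda>i. u i + 1)" by (rule pairing2_cong) (auto simp: w_def)
    moreover have "(of_int (q (m+1)) :: bit) = 0" using q by (auto elim!: evenE)
    ultimately have "pairing2 (m+1) q w = pairing2 m q (\<lambda>i. u i + 1)" unfolding pairing2_Suc by simp
    then show ?thesis unfolding b_def by (simp add: add.commute)
  qed
  ultimately show ?thesis unfolding affine_mod2_def by blast
qed

lemma unimodular_affine_mod2:
  assumes "unimodular n \<sigma>"
  shows "affine_mod2 n \<sigma> f"
proof -
  define F :: "lpoint \<Rightarrow> int" where "F v = (if f v = 1 then 1 else 0)" for v
  have F: "of_int (F v) = f v" for v by (cases "f v") (auto simp: F_def)
  obtain w c where w: "\<And>v. v \<in> \<sigma> \<Longrightarrow> (\<Sum>i\<in>{1..n}. v i * w i) + c = F v"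
    using assms unfolding unimodular_def by blast
  have "f v = pairing2 n v (\<lambda>i. of_int (w i)) + of_int c" if "v \<in> \<sigma>" for v
  proof -
    have "f v = of_int ((\<Sum>i\<in>{1..n}. v i * w i) + c)" unfolding w[OF that] F ..
    then show ?thesis by (simp add: pairing2_def)
  qed
  then show ?thesis unfolding affine_mod2_def by blast
qed


text \<open>
  The last index in the order \<open>stair_key d\<close>; for positive \<open>d\<close> it is also the first one in the opposite
  order \<open>stair_key (d-1)\<close>.
\<close>

definition stair_end :: "nat \<Rightarrow> nat \<Rightarrow> nat" where
  "stair_end m d = (if even d then m else 0)"

definition low_apex :: "nat \<Rightarrow> nat \<Rightarrow> lpoint" where
  "low_apex m d = sbasis (d+1) (stair_end m d)"

definition high_apex :: "nat \<Rightarrow> nat \<Rightarrow> lpoint" where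
  "high_apex m d = raise m (raise m (sbasis (d-1) (stair_end m d)))"

lemma surj_raise: "surj (raise m)"
  by (rule surjI[of _ "\<lambda>v. v - sbasis 1 (m+1)"]) (simp add: raise_def)

lemma raise_vimage: "raise m ` (raise m -` A) = A"
  by (rule surj_image_vimage_eq[OF surj_raise])

lemma card_raise_vimage: "card (raise m -` A) = card A"
  using card_image[OF inj_on_raise, of m "raise m -` A"] by (simp only: raise_vimage)

text \<open>
  Its barycentric coordinates have sum \<open>D\<close>, all of which sits at the index \<open>M\<close>.
\<close>

lemma vertex_of_support:
  assumes u: "emb u \<in> dilate m D 1" and M: "M \<le> m"
    and supp: "\<And>k. k \<le> m \<Longrightarrow> 0 < bcoord m (real D) k (emb u) \<Longrightarrow> k = M"
  shows "u = sbasis D M"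
proof -
  have z: "bcoord m (real D) k (emb u) = 0" if "k \<le> m" "k \<noteq> M" for k
    using supp[of k] u that by (force simp: dilate_def)
  have "real D = (\<Sum>k\<le>m. bcoord m (real D) k (emb u))" by (simp add: sum_bcoord)
  also have "\<dots> = bcoord m (real D) M (emb u)"
    using z M by (subst sum.remove[of _ M]) auto
  finally have M': "bcoord m (real D) M (emb u) = real D" ..
  have "emb u = emb (sbasis D M)"
  proof (rule bcoord_ext[of m _ _ "real D"])
    show "emb u i = emb (sbasis D M) i" if "i \<notin> {1..m}" for i
    proof -
      have "emb u i = 0" using u that by (simp add: dilate_def)
      moreover have "emb (sbasis D M) i = 0" using M that by (auto simp: emb_def sbasis_def)
      ultimately show ?thesis by simp
    qed
    show "bcoord m (real D) j (emb u) = bcoord m (real D) j (emb (sbasis D M))" if "j \<in> {1..m}" for j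
      using bcoord_sbasis[OF M, of j D] that z[of j] M' by (cases "j = M") auto
  qed
  then show ?thesis using inj_emb by (simp add: inj_eq)
qed

lemma stair_end_max:
  assumes "k \<le> m" "\<And>j. j \<le> m \<Longrightarrow> stair_key d j \<le> stair_key d k"
  shows "k = stair_end m d"
  using assms(1) assms(2)[of m] assms(2)[of 0]
  by (auto simp: stair_key_def stair_end_def split: if_splits)

lemma stair_end_min:
  assumes "j \<le> m" "\<And>k. k \<le> m \<Longrightarrow> stair_key d j \<le> stair_key d k"
  shows "j = stair_end m (Suc d)"
  using assms(1) assms(2)[of m] assms(2)[of 0]
  by (auto simp: stair_key_def stair_end_def split: if_splits)

lemma stair_end_le: "stair_end m d \<le> m"
  by (simp add: stair_end_def)

text \<open>
  All barycentric coordinates of \<open>v\<close> in its slice are positive. In the lower layer, the staircase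
  condition therefore confines the lower part to the last index; in the upper layer, where \<open>v\<close> belongs to
  the lower part and the order is reversed, it confines the upper part to the first index of the
  reversed order, which is the same.
\<close>

lemma star_of_layer_vertex:
  assumes \<sigma>: "\<sigma> \<in> itenberg_viro (Suc m) (Suc d)" and v: "v \<in> \<sigma>" "v (m+1) = 1"
    and pos: "\<And>j. j \<le> m \<Longrightarrow> 0 < bcoord m (real d) j (emb v)"
  shows "\<exists>\<phi>\<in>itenberg_viro m d. \<exists>q\<in>{low_apex m d, high_apex m d}. \<sigma> \<subseteq> insert q (raise m ` \<phi>)"
proof -
  let ?K = "itenberg_viro (Suc m) d" and ?L = "itenberg_viro m (Suc d)"
  have K: "simplicial_fan (m+1) d ?K" and L: "simplicial_fan m (d+1) ?L"
    using fan_itenberg_viro[of "Suc m" d] fan_itenberg_viro[of m "Suc d"] by simp_all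
  obtain v0 where v0: "v = raise m v0" using surj_raise[of m] by (metis surjD)
  then have h0: "v0 (m+1) = 0" using v(2) by (simp add: raise_apply)
  have pos0: "0 < bcoord m (real d) j (emb v0)" if "j \<le> m" for j
    using pos[OF that] that by (simp add: v0 bcoord_raise)
  have "\<sigma> \<in> glue (stair_key d) m d ?K ?L" using \<sigma> by simp
  then show ?thesis
  proof (cases rule: glue_cases)
    case (2 \<alpha> \<beta>)
    have \<beta>h: "u (m+1) = 0" if "u \<in> \<beta>" for u
    proof -
      have "emb u \<in> dilate m (d+1) 1" using 2(3) fanD(4)[OF L, of \<beta>] that by auto
      then show ?thesis by (simp add: dilate_def emb_def)
    qed
    then have "v \<notin> \<beta>" using v(2) by force
    then have v\<alpha>: "v0 \<in> \<alpha>" using v(1) 2(1) v0 inj_raise by (auto simp: inj_eq)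
    then have "\<alpha> \<in> itenberg_viro m d" using 2(2) bottom_itenberg_viro[of m d] by auto
    moreover have "u = low_apex m d" if u: "u \<in> \<beta>" for u
      unfolding low_apex_def
    proof (rule vertex_of_support[OF _ stair_end_le])
      show "emb u \<in> dilate m (d+1) 1" using 2(3) fanD(4)[OF L, of \<beta>] u by auto
      show "k = stair_end m d" if "k \<le> m" "0 < bcoord m (real (d+1)) k (emb u)" for k
      proof (rule stair_end_max[OF \<open>k \<le> m\<close>])
        show "stair_key d j \<le> stair_key d k" if "j \<le> m" for j
          using 2(4) v\<alpha> u pos0[OF that] that \<open>k \<le> m\<close> \<open>0 < bcoord m (real (d+1)) k (emb u)\<close>
          unfolding staircase_def by blast
      qed
    qed
    ultimately show ?thesis using 2(1) by blast
  next
    case (1 \<sigma>0)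
    have "0 < d"
    proof -
      have "0 < (\<Sum>j\<le>m. bcoord m (real d) j (emb v))" using pos by (intro sum_pos) auto
      then show ?thesis by (simp add: sum_bcoord)
    qed
    then obtain e where e: "d = Suc e" by (cases d) auto
    let ?K' = "itenberg_viro (Suc m) e"
    have K': "simplicial_fan (m+1) e ?K'" using fan_itenberg_viro[of "Suc m" e] by simp
    have v\<sigma>: "v0 \<in> \<sigma>0" using v(1) 1(2) v0 inj_raise by (auto simp: inj_eq)
    have "\<sigma>0 \<in> glue (stair_key e) m e ?K' (itenberg_viro m d)" using 1(1) e by simp
    then show ?thesis
    proof (cases rule: glue_cases)
      case (1 \<sigma>1)
      then obtain v1 where v1: "v1 \<in> \<sigma>1" "v0 = raise m v1" using v\<sigma> by blast
      have "0 \<le> emb v1 (m+1)" using dilate_height fanD(4)[OF K' 1(1)] v1(1) by blast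
      then show ?thesis using h0 v1(2) by (simp add: emb_def raise_apply)
    next
      case (2 \<alpha> \<beta>)
      have \<alpha>h: "u (m+1) = 0" if "u \<in> \<alpha>" for u using that 2(2) by (auto simp: bottom_def)
      have "v0 \<notin> raise m ` \<alpha>" using \<alpha>h h0 by (force simp: raise_apply)
      then have v\<beta>: "v0 \<in> \<beta>" using v\<sigma> 2(1) by blast
      then have "\<beta> \<in> itenberg_viro m d" using 2(3) by auto
      moreover have "raise m (raise m u) = high_apex m d" if u: "u \<in> \<alpha>" for u
      proof -
        have "u = sbasis e (stair_end m d)"
        proof (rule vertex_of_support[OF _ stair_end_le])
          show "emb u \<in> dilate m e 1" using bottom_dilate[OF K' 2(2)] u by blast
          show "j = stair_end m d" if "j \<le> m" "0 < bcoord m (real e) j (emb u)" for j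
            unfolding e
          proof (rule stair_end_min[OF \<open>j \<le> m\<close>])
            show "stair_key e j \<le> stair_key e k" if "k \<le> m" for k
              using 2(4) v\<beta> u pos0[OF that] that \<open>j \<le> m\<close> \<open>0 < bcoord m (real e) j (emb u)\<close>
              unfolding staircase_def e by (simp add: add.commute)
          qed
        qed
        then show ?thesis by (simp add: high_apex_def e)
      qed
      ultimately show ?thesis
        unfolding \<open>\<sigma> = raise m ` \<sigma>0\<close> 2(1) image_Un by blast
    qed
  qed
qed

lemma harnack_sbasis: "harnack n (sbasis d i) = 0"
  unfolding harnack_def by (intro sum.neutral) (auto simp: sbasis_def)

lemma apex_heights:
  "low_apex m d (m+1) = 0" "high_apex m d (m+1) = 2"
  by (simp_all add: low_apex_def high_apex_def raise_apply sbasis_def stair_end_def)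

text \<open>
  The sum of the two apexes is twice the lattice point \<open>e\<^sub>m\<^sub>+\<^sub>1 + d e\<^sub>M\<close> of the slice.
\<close>

lemma apex_congruent:
  assumes "0 < d"
  shows "(of_int (low_apex m d i) :: bit) = of_int (high_apex m d i)"
proof -
  have "even (low_apex m d i + high_apex m d i)"
  proof -
    have "int (d + 1) + int (d - 1) = 2 * int d" using assms by simp
    then show ?thesis by (simp add: low_apex_def high_apex_def raise_apply sbasis_def stair_end_def)
  qed
  then obtain k where k: "low_apex m d i + high_apex m d i = 2 * k" by (elim evenE)
  have "(of_int (low_apex m d i + high_apex m d i) :: bit) = 0" unfolding k by simp
  then show ?thesis by (metis add_right_cancel bit_add_self of_int_add)
qed

lemma harnack_apex: "harnack (m+1) (low_apex m d) = 0" "harnack (m+1) (high_apex m d) = 0"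
proof -
  show "harnack (m+1) (low_apex m d) = 0" by (simp add: low_apex_def harnack_sbasis)
  have "(\<Sum>i\<in>{1..m}. of_int (raise m x i) :: bit) = (\<Sum>i\<in>{1..m}. of_int (x i))" for x
    by (intro sum.cong) (auto simp: raise_apply)
  then show "harnack (m+1) (high_apex m d) = 0"
    unfolding high_apex_def harnack_raise harnack_sbasis by simp
qed

lemma bcoord_raise_pos:
  assumes "j \<le> m"
  shows "bcoord (m+1) (real (d+1)) j (emb (raise m v)) = bcoord (m+1) (real d) j (emb v)"
  unfolding bcoord_slice[OF assms] bcoord_raise[OF assms] by (simp add: emb_def raise_apply)

text \<open>
  There are three cases: \<open>v\<close> lies above the layer; \<open>v\<close> has height one and \<open>\<tau>\<close> contains an apex; \<open>v\<close> has
  height one and \<open>\<tau>\<close> lies in the slice of height one. They use the assertion for the raised copy, the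
  assertion for the slice, and the congruence of the two apexes, respectively.
\<close>

lemma harnack_flat_step:
  assumes K: "harnack_flat (m+1) d (itenberg_viro (Suc m) d)"
    and L: "harnack_flat m d (itenberg_viro m d)"
  shows "harnack_flat (m+1) (d+1) (itenberg_viro (Suc m) (Suc d))"
  unfolding harnack_flat_def
proof (intro allI impI)
  let ?T = "itenberg_viro (Suc m) (Suc d)"
  have fanT: "simplicial_fan (m+1) (d+1) ?T" using fan_itenberg_viro[of "Suc m" "Suc d"] by simp
  have fanK: "simplicial_fan (m+1) d (itenberg_viro (Suc m) d)" using fan_itenberg_viro[of "Suc m" d] by simp
  have fan: "simplicial_fan m d (itenberg_viro m d)" by (rule fan_itenberg_viro)
  fix \<tau> a b v
  assume a: "insert a \<tau> \<in> ?T" and b: "insert b \<tau> \<in> ?T" and "a \<notin> \<tau>" "b \<notin> \<tau>" "a \<noteq> b"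
    and c: "card \<tau> = m+1" and v: "v \<in> \<tau>" and pos: "\<forall>j\<le>m+1. 0 < bcoord (m+1) (real (d+1)) j (emb v)"
  define S where "S = raise m -` \<tau>"
  obtain a0 where a0: "a = raise m a0" using surj_raise[of m] by (metis surjD)
  obtain b0 where b0: "b = raise m b0" using surj_raise[of m] by (metis surjD)
  obtain v0 where v0: "v = raise m v0" using surj_raise[of m] by (metis surjD)
  have \<tau>S: "\<tau> = raise m ` S" unfolding S_def raise_vimage ..
  have S: "a0 \<notin> S" "b0 \<notin> S" "a0 \<noteq> b0" "card S = m+1" "v0 \<in> S"
    using \<open>a \<notin> \<tau>\<close> \<open>b \<notin> \<tau>\<close> \<open>a \<noteq> b\<close> c v a0 b0 v0 by (auto simp: S_def card_raise_vimage)
  have img: "insert a \<tau> = raise m ` insert a0 S" "insert b \<tau> = raise m ` insert b0 S"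
    using a0 b0 \<tau>S by auto
  have pos0: "0 < bcoord (m+1) (real d) j (emb v0)" if "j \<le> m" for j
  proof -
    have "0 < bcoord (m+1) (real (d+1)) j (emb v)" using pos that by simp
    then show ?thesis using bcoord_raise_pos[OF that, of d v0] by (simp only: v0)
  qed
  have hv: "1 \<le> v (m+1)" using pos[rule_format, of "m+1"] by (simp add: bcoord_def emb_def)
  show "affine_mod2 (m+1) (insert a (insert b \<tau>)) (\<lambda>x. harnack (m+1) x + chi v x)"
  proof (cases "v (m+1) = 1")
    case False
    have inK: "\<rho> \<in> itenberg_viro (Suc m) d" if "raise m ` \<rho> \<in> ?T" "v0 \<in> \<rho>" for \<rho>
    proof -
      have "raise m ` \<rho> \<in> glue (stair_key d) m d (itenberg_viro (Suc m) d) (itenberg_viro m (Suc d))"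
        using that(1) by simp
      then show ?thesis
      proof (cases rule: glue_cases)
        case (1 \<sigma>0)
        then have "\<rho> = \<sigma>0" using inj_raise inj_image_eq_iff by metis
        then show ?thesis using 1 by simp
      next
        case (2 \<alpha> \<beta>)
        have "v \<in> raise m ` \<alpha> \<union> \<beta>" using that(2) v0 unfolding 2(1)[symmetric] by simp
        then have "v (m+1) \<le> 1"
        proof
          assume "v \<in> raise m ` \<alpha>"
          then show ?thesis using 2(2) by (auto simp: bottom_def raise_apply)
        next
          assume "v \<in> \<beta>"
          then have "emb v \<in> dilate m (d+1) 1"
            using 2(3) fanD(4)[OF fan_itenberg_viro, of \<beta> m "Suc d"] by auto
          then show ?thesis by (simp add: dilate_def emb_def)
        qed
        then show ?thesis using False hv by simp
      qed
    qed
    have "insert a0 S \<in> itenberg_viro (Suc m) d" using a S(5) unfolding img by (intro inK) auto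
    moreover have "insert b0 S \<in> itenberg_viro (Suc m) d" using b S(5) unfolding img by (intro inK) auto
    moreover have "0 < bcoord (m+1) (real d) j (emb v0)" if "j \<le> m+1" for j
    proof (cases "j \<le> m")
      case False
      then have "j = m+1" using that by simp
      moreover have "0 < v0 (m+1)" using \<open>v (m+1) \<noteq> 1\<close> hv v0 by (simp add: raise_apply)
      ultimately show ?thesis by (simp add: bcoord_def emb_def)
    qed (rule pos0)
    ultimately have "affine_mod2 (m+1) (insert a0 (insert b0 S)) (\<lambda>x. harnack (m+1) x + chi v0 x)"
      using K S unfolding harnack_flat_def by blast
    from affine_mod2_raise[OF this] show ?thesis by (simp only: image_insert a0 b0 v0 \<tau>S)
  next
    case True
    then have h0: "v0 (m+1) = 0" using v0 by (simp add: raise_apply)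
    have pos': "0 < bcoord m (real d) j (emb v0)" if "j \<le> m" for j
      using pos0[OF that] h0 unfolding bcoord_slice[OF that] by (simp add: emb_def)
    then have pos'': "0 < bcoord m (real d) j (emb v)" if "j \<le> m" for j
      using that by (simp add: v0 bcoord_raise)
    have "0 < d"
    proof -
      have "0 < (\<Sum>j\<le>m. bcoord m (real d) j (emb v0))" using pos' by (intro sum_pos) auto
      then show ?thesis by (simp add: sum_bcoord)
    qed
    have flat: "x (m+1) = 0" if "\<phi> \<in> itenberg_viro m d" "x \<in> \<phi>" for \<phi> x
    proof -
      have "emb x \<in> dilate m d 1" using fanD(4)[OF fan that(1)] that(2) by blast
      then show ?thesis by (simp add: dilate_def emb_def)
    qed
    (* p and q: the only possible vertices of the two simplices outside the slice *)
    obtain \<phi> p where \<phi>: "\<phi> \<in> itenberg_viro m d" "p \<in> {low_apex m d, high_apex m d}"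
      "insert a \<tau> \<subseteq> insert p (raise m ` \<phi>)"
      using star_of_layer_vertex[OF a _ True pos''] v by blast
    obtain \<psi> q where \<psi>: "\<psi> \<in> itenberg_viro m d" "q \<in> {low_apex m d, high_apex m d}"
      "insert b \<tau> \<subseteq> insert q (raise m ` \<psi>)"
      using star_of_layer_vertex[OF b _ True pos''] v by blast
    have apex: "r \<notin> raise m ` \<rho>" if "r \<in> {low_apex m d, high_apex m d}" "\<rho> \<in> itenberg_viro m d" for r \<rho>
    proof
      assume "r \<in> raise m ` \<rho>"
      then obtain x where "x \<in> \<rho>" "r = raise m x" by blast
      then have "r (m+1) = 1" using flat[OF that(2)] by (simp add: raise_apply)
      then show False using that(1) apex_heights[of m d] by fastforce
    qed
    show ?thesis
    proof (cases "p \<in> \<tau>")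
      case True
      then have "p = q" using \<psi>(3) apex[OF \<phi>(2) \<psi>(1)] by blast
      have "a \<in> raise m ` \<phi>" "b \<in> raise m ` \<psi>" using True \<phi>(3) \<psi>(3) \<open>a \<notin> \<tau>\<close> \<open>b \<notin> \<tau>\<close> \<open>p = q\<close> by auto
      obtain p0 where p0: "p = raise m p0" using surj_raise[of m] by (metis surjD)
      define R where "R = S - {p0}"
      have "p0 \<in> S" using True \<tau>S p0 inj_raise by (auto simp: inj_eq)
      then have cR: "card R = m" using S(4) by (simp add: R_def)
      have \<tau>R: "\<tau> = insert p (raise m ` R)" using \<open>p0 \<in> S\<close> \<tau>S p0 by (auto simp: R_def)
      have "p \<notin> raise m ` R" using p0 inj_raise by (auto simp: R_def inj_eq)
      have "insert a0 R \<subseteq> \<phi>"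
      proof -
        have "raise m ` insert a0 R \<subseteq> raise m ` \<phi>"
          using \<phi>(3) \<tau>R \<open>p \<notin> raise m ` R\<close> \<open>a \<in> raise m ` \<phi>\<close> a0 by auto
        then show ?thesis using inj_raise inj_image_subset_iff by metis
      qed
      then have ia: "insert a0 R \<in> itenberg_viro m d" using fanD(5)[OF fan \<phi>(1)] by blast
      have "insert b0 R \<subseteq> \<psi>"
      proof -
        have "raise m ` insert b0 R \<subseteq> raise m ` \<psi>"
          using \<psi>(3) \<tau>R \<open>p \<notin> raise m ` R\<close> \<open>b \<in> raise m ` \<psi>\<close> b0 \<open>p = q\<close> by auto
        then show ?thesis using inj_raise inj_image_subset_iff by metis
      qed
      then have ib: "insert b0 R \<in> itenberg_viro m d" using fanD(5)[OF fan \<psi>(1)] by blast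
      have "v \<noteq> p" using \<open>v (m+1) = 1\<close> \<phi>(2) apex_heights[of m d] by auto
      then have "v0 \<in> R" using S(5) v0 p0 by (auto simp: R_def)
      have "affine_mod2 m (insert a0 (insert b0 R)) (\<lambda>x. harnack m x + chi v0 x)"
        using L ia ib S(1-3) cR \<open>v0 \<in> R\<close> pos' unfolding harnack_flat_def R_def by blast
      then have "affine_mod2 (m+1) (insert p (raise m ` insert a0 (insert b0 R)))
          (\<lambda>x. harnack (m+1) x + chi (raise m v0) x)"
      proof (rule affine_mod2_cone)
        show "x (m+1) = 0" if "x \<in> insert a0 (insert b0 R)" for x
          using that flat[OF ia] flat[OF ib] by blast
        show "even (p (m+1))" using \<phi>(2) apex_heights[of m d] by auto
      qed
      moreover have "insert p (raise m ` insert a0 (insert b0 R)) = insert a (insert b \<tau>)"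
        unfolding \<tau>R a0 b0 by auto
      ultimately show ?thesis by (simp only: v0)
    next
      case False
      have "q \<notin> \<tau>"
      proof
        assume "q \<in> \<tau>"
        then have "q = p" using \<phi>(3) apex[OF \<psi>(2) \<phi>(1)] by blast
        then show False using False \<open>q \<in> \<tau>\<close> by simp
      qed
      have facet: "raise m x0 = r" if x: "x0 \<notin> S" "insert (raise m x0) \<tau> \<subseteq> insert r (raise m ` \<rho>)"
        "r \<notin> \<tau>" "\<rho> \<in> itenberg_viro m d" for x0 r \<rho>
      proof (rule ccontr)
        assume "raise m x0 \<noteq> r"
        then have "raise m ` insert x0 S \<subseteq> raise m ` \<rho>" using x(2,3) \<tau>S by auto
        then have sub: "insert x0 S \<subseteq> \<rho>" using inj_raise inj_image_subset_iff by metis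
        have fin: "finite S" using S(4) by (metis card.infinite Suc_eq_plus1 nat.distinct(1))
        have "card (insert x0 S) \<le> card \<rho>" using card_mono[OF fanD(3)[OF fan x(4)] sub] .
        also have "\<dots> \<le> card {..m}"
          by (rule fan_card_le[OF fan x(4)]) (use \<open>0 < d\<close> in \<open>auto simp: supported_def\<close>)
        finally show False using x(1) S(4) fin by simp
      qed
      (* tau already has the maximal number of vertices in the slice, so both apexes lie outside it *)
      have "a = p" using facet[OF S(1) _ False \<phi>(1)] \<phi>(3) a0 by simp
      have "b = q" using facet[OF S(2) _ \<open>q \<notin> \<tau>\<close> \<psi>(1)] \<psi>(3) b0 by simp
      let ?f = "\<lambda>x. harnack (m+1) x + chi v x"
      have ab: "{a, b} = {low_apex m d, high_apex m d}"
        using \<open>a = p\<close> \<open>b = q\<close> \<open>a \<noteq> b\<close> \<phi>(2) \<psi>(2) by auto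
      have "a \<noteq> v" "b \<noteq> v" using v \<open>a \<notin> \<tau>\<close> \<open>b \<notin> \<tau>\<close> by auto
      then have f0: "?f a = 0" "?f b = 0"
        using ab harnack_apex[of m d] by (auto simp: chi_def doubleton_eq_iff)
      have "unimodular (m+1) (insert a \<tau>)" using unimodular_itenberg_viro[OF a] by simp
      then obtain u c where u: "\<And>x. x \<in> insert a \<tau> \<Longrightarrow> ?f x = pairing2 (m+1) x u + c"
        using unimodular_affine_mod2[of "m+1" "insert a \<tau>" ?f] unfolding affine_mod2_def by blast
      have "(of_int (a i) :: bit) = of_int (b i)" for i
        using ab apex_congruent[OF \<open>0 < d\<close>, of m i] by (auto simp: doubleton_eq_iff)
      then have "pairing2 (m+1) a u = pairing2 (m+1) b u" by (simp add: pairing2_def)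
      then have "?f b = pairing2 (m+1) b u + c" using u[of a] f0 by simp
      then have "\<forall>x\<in>insert a (insert b \<tau>). ?f x = pairing2 (m+1) x u + c"
        using u by blast
      then show ?thesis unfolding affine_mod2_def by blast
    qed
  qed
qed

theorem harnack_flat_itenberg_viro: "harnack_flat n d (itenberg_viro n d)"
proof (induction n arbitrary: d)
  case 0
  show ?case
    unfolding harnack_flat_def
  proof (intro allI impI)
    fix \<tau> a b v
    assume "insert a \<tau> \<in> itenberg_viro 0 d" "card \<tau> = 0" "v \<in> \<tau>"
    then have False using fanD(3)[OF fan_itenberg_viro, of "insert a \<tau>" 0 d] by auto
    then show "affine_mod2 0 (insert a (insert b \<tau>)) (\<lambda>x. harnack 0 x + chi v x)" ..
  qed
next
  case (Suc m)
  note L = Suc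
  show ?case
  proof (induction d)
    case 0
    show ?case
      unfolding harnack_flat_def
    proof (intro allI impI)
      fix \<tau> a b v
      assume "insert a \<tau> \<in> itenberg_viro (Suc m) 0" "a \<notin> \<tau>" "v \<in> \<tau>"
      then have False by auto
      then show "affine_mod2 (Suc m) (insert a (insert b \<tau>)) (\<lambda>x. harnack (Suc m) x + chi v x)" ..
    qed
  next
    case (Suc d)
    then show ?case using harnack_flat_step[of m d] L[of d] by simp
  qed
qed


section \<open>Simplices of codimension one in a face\<close>

lemma supported_mono: "supported n d I \<sigma> \<Longrightarrow> I \<subseteq> J \<Longrightarrow> supported n d J \<sigma>"
  unfolding supported_def by blast

lemma supported_subset: "supported n d I \<sigma> \<Longrightarrow> \<tau> \<subseteq> \<sigma> \<Longrightarrow> supported n d I \<tau>"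
  unfolding supported_def by blast

lemma bvec_expand:
  assumes "finite I" "linear g"
  shows "g (bvec n d I v) = (\<Sum>i\<in>I. bcoord n (real d) i (emb v) * g (unit_vec i))"
proof -
  have "bvec n d I v = (\<Sum>i\<in>I. bcoord n (real d) i (emb v) *\<^sub>R unit_vec i)"
  proof
    fix j
    have "(\<Sum>i\<in>I. bcoord n (real d) i (emb v) *\<^sub>R unit_vec i) j =
        (\<Sum>i\<in>I. if i = j then bcoord n (real d) j (emb v) else 0)"
      unfolding sum_apply by (intro sum.cong) (auto simp: scaleR_apply unit_vec_def)
    then show "bvec n d I v j = (\<Sum>i\<in>I. bcoord n (real d) i (emb v) *\<^sub>R unit_vec i) j"
      using assms(1) by (simp add: bvec_def)
  qed
  then show ?thesis using assms(2) by (simp add: linear_sum linear_scale)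
qed

text \<open>
  Equality of the barycentric coordinates includes equality of the masses, since their sum is \<open>d\<close>
  times the mass.
\<close>

lemma fan_unique_bcoord:
  assumes fan: "simplicial_fan n d K" and "d \<ge> 1" and \<sigma>: "\<sigma> \<in> K" "\<sigma>' \<in> K"
    and w: "\<And>v. 0 \<le> w v" "\<And>v. v \<notin> \<sigma> \<Longrightarrow> w v = 0"
    and w': "\<And>v. 0 \<le> w' v" "\<And>v. v \<notin> \<sigma>' \<Longrightarrow> w' v = 0"
    and eq: "\<And>i. i \<le> n \<Longrightarrow> (\<Sum>v\<in>\<sigma>. w v * bcoord n (real d) i (emb v)) =
      (\<Sum>v\<in>\<sigma>'. w' v * bcoord n (real d) i (emb v))"
  shows "w = w'"
proof (rule fan_unique[OF fan])
  show "\<sigma> \<in> insert {} K" "\<sigma>' \<in> insert {} K" using \<sigma> by simp_all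
  have mass: "(\<Sum>i\<le>n. \<Sum>v\<in>S. u v * bcoord n (real d) i (emb v)) = sum u S * d" for S u
    by (subst sum.swap) (simp add: sum_bcoord flip: sum_distrib_left sum_distrib_right)
  have "sum w \<sigma> * d = sum w' \<sigma>' * d"
    unfolding mass[symmetric] using eq by (intro sum.cong[OF refl]) simp
  then have m: "sum w \<sigma> = sum w' \<sigma>'" using \<open>d \<ge> 1\<close> by simp
  have z: "v i = 0" if "v \<in> S" "S \<in> K" "i \<notin> {1..n}" for v S i
    using fanD(4)[OF fan that(2)] that(1,3) by (force simp: dilate_def emb_def)
  have x: "(\<Sum>v\<in>\<sigma>. w v * real_of_int (v i)) = (\<Sum>v\<in>\<sigma>'. w' v * real_of_int (v i))" for i
  proof (cases "i \<in> {1..n}")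
    case True
    then show ?thesis using eq[of i] by (simp add: bcoord_def emb_def)
  next
    case False
    have "(\<Sum>v\<in>\<sigma>. w v * real_of_int (v i)) = 0" "(\<Sum>v\<in>\<sigma>'. w' v * real_of_int (v i)) = 0"
      using z \<sigma> False by (auto intro!: sum.neutral)
    then show ?thesis by simp
  qed
  show "conic_rep \<sigma> w (sum w \<sigma>) (\<lambda>i. \<Sum>v\<in>\<sigma>. w v * real_of_int (v i))"
    using w by (intro conic_repI) auto
  show "conic_rep \<sigma>' w' (sum w \<sigma>) (\<lambda>i. \<Sum>v\<in>\<sigma>. w v * real_of_int (v i))"
    using w' m x by (intro conic_repI) auto
qed

lemma full_simplex_spans:
  assumes fan: "simplicial_fan n d K" and \<sigma>: "\<sigma> \<in> K" "d \<ge> 1" "supported n d I \<sigma>"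
    and "finite I" "card \<sigma> = card I" and x: "\<And>i. i \<notin> I \<Longrightarrow> x i = 0"
  shows "x \<in> span (bvec n d I ` \<sigma>)"
proof (rule ccontr)
  assume nx: "x \<notin> span (bvec n d I ` \<sigma>)"
  have "x \<notin> bvec n d I ` \<sigma>" using nx span_base[of x "bvec n d I ` \<sigma>"] by blast
  have "independent (insert x (bvec n d I ` \<sigma>))"
    using independent_insertI[OF nx independent_bvec[OF fan \<sigma>]] .
  moreover have "insert x (bvec n d I ` \<sigma>) \<subseteq> span (unit_vec ` I)"
    using span_unit_vec[OF \<open>finite I\<close>] x by (auto simp: bvec_def)
  ultimately have "card (insert x (bvec n d I ` \<sigma>)) \<le> card (unit_vec ` I)"
    using independent_span_bound \<open>finite I\<close> by blast
  also have "\<dots> \<le> card I" by (rule card_image_le[OF \<open>finite I\<close>])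
  finally show False
    using \<open>x \<notin> bvec n d I ` \<sigma>\<close> card_image[OF inj_on_bvec[OF fan \<sigma>(1,3)]]
      fanD(3)[OF fan \<sigma>(1)] \<open>card \<sigma> = card I\<close> by simp
qed

context
  fixes n d :: nat and K :: "lpoint set set" and \<tau> :: "lpoint set" and I :: "nat set"
  assumes fan: "simplicial_fan n d K" and d: "d \<ge> 1" and \<tau>: "\<tau> \<in> K"
    and supp: "supported n d I \<tau>" and I: "I \<subseteq> {..n}" and card: "card I = card \<tau> + 1"
begin

text \<open>
  The apexes of the simplices of \<open>K\<close> over \<open>\<tau>\<close> in the face \<open>I\<close>, in which \<open>\<tau>\<close> has codimension one.
\<close>

definition cofaces :: "lpoint set" where
  "cofaces = {a. a \<notin> \<tau> \<and> insert a \<tau> \<in> K \<and> supported n d I (insert a \<tau>)}"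

lemma finI: "finite I" using I finite_subset by blast

lemma fin\<tau>: "finite \<tau>" using fanD(3)[OF fan \<tau>] .

text \<open>
  The vector of \<open>a'\<close> is a combination of those of \<open>\<tau>\<close> and \<open>a\<close>, with a positive coefficient at \<open>a\<close> since \<open>g\<close>
  separates both from \<open>\<tau>\<close> on the same side. After adding a large multiple of the barycentre of \<open>\<tau>\<close>, both
  sides become nonnegative weights on the simplices \<open>\<tau> \<union> {a'}\<close> and \<open>\<tau> \<union> {a}\<close> for the same point.
\<close>

lemma coface_unique:
  fixes g :: "rpoint \<Rightarrow> real"
  assumes a: "a \<in> cofaces" "0 < g (bvec n d I a)" and a': "a' \<in> cofaces" "0 < g (bvec n d I a')"
    and g: "linear g" "\<And>v. v \<in> \<tau> \<Longrightarrow> g (bvec n d I v) = 0"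
  shows "a = a'"
proof (rule ccontr)
  assume "a \<noteq> a'"
  let ?y = "bvec n d I" and ?\<sigma> = "insert a \<tau>"
  have A: "a \<notin> \<tau>" "?\<sigma> \<in> K" "supported n d I ?\<sigma>" and A': "a' \<notin> \<tau>" "insert a' \<tau> \<in> K" "supported n d I (insert a' \<tau>)"
    using a a' by (auto simp: cofaces_def)
  have "?y a' \<in> span (?y ` ?\<sigma>)"
    by (rule full_simplex_spans[OF fan A(2) d A(3) finI]) (use A(1) fin\<tau> card in \<open>auto simp: bvec_def\<close>)
  then obtain U where U: "?y a' = (\<Sum>y\<in>?y ` ?\<sigma>. U y *\<^sub>R y)"
    using span_finite[of "?y ` ?\<sigma>"] fin\<tau> by auto
  define h where "h v = U (?y v)" for v
  have h: "?y a' = (\<Sum>v\<in>?\<sigma>. h v *\<^sub>R ?y v)"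
    unfolding U h_def by (rule sum.reindex_cong[OF inj_on_bvec[OF fan A(2,3)]]) auto
  have "g (?y a') = (\<Sum>v\<in>?\<sigma>. h v * g (?y v))"
    unfolding h using g(1) by (simp add: linear_sum linear_scale)
  also have "\<dots> = h a * g (?y a)" using A(1) fin\<tau> g(2) by simp
  finally have ha: "0 < h a" using a(2) a'(2) by (metis zero_less_mult_pos2)
  (* the multiple of the barycentre of tau that makes the weights nonnegative *)
  define N where "N = (\<Sum>v\<in>\<tau>. \<bar>h v\<bar>)"
  have N: "0 \<le> N + h v" if "v \<in> \<tau>" for v
  proof -
    have "\<bar>h v\<bar> \<le> N" unfolding N_def using that fin\<tau> by (intro member_le_sum) auto
    then show ?thesis by linarith
  qed
  have N0: "0 \<le> N" unfolding N_def by (intro sum_nonneg) simp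
  define w where "w v = (if v = a then h a else if v \<in> \<tau> then N + h v else 0)" for v
  define w' where "w' v = (if v = a' then 1 else if v \<in> \<tau> then N else 0)" for v
  have "w = w'"
  proof (rule fan_unique_bcoord[OF fan d A(2) A'(2)])
    show "0 \<le> w v" "0 \<le> w' v" for v using ha N N0 by (auto simp: w_def w'_def)
    show "w v = 0" if "v \<notin> insert a \<tau>" for v using that by (simp add: w_def)
    show "w' v = 0" if "v \<notin> insert a' \<tau>" for v using that by (simp add: w'_def)
    fix i assume "i \<le> n"
    let ?b = "\<lambda>v. bcoord n (real d) i (emb v)"
    have s1: "(\<Sum>v\<in>\<tau>. w v * ?b v) = N * (\<Sum>v\<in>\<tau>. ?b v) + (\<Sum>v\<in>\<tau>. h v * ?b v)"
      unfolding sum_distrib_left sum.distrib[symmetric] using A(1)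
      by (intro sum.cong) (auto simp: w_def distrib_right)
    have s2: "(\<Sum>v\<in>\<tau>. w' v * ?b v) = N * (\<Sum>v\<in>\<tau>. ?b v)"
      unfolding sum_distrib_left using A'(1) by (intro sum.cong) (auto simp: w'_def)
    have "?b a' = h a * ?b a + (\<Sum>v\<in>\<tau>. h v * ?b v)"
    proof (cases "i \<in> I")
      case True
      then show ?thesis using fun_cong[OF h, of i] A(1) fin\<tau> by (simp add: sum_apply scaleR_apply bvec_def)
    next
      case False
      then have "?b v = 0" if "v \<in> insert a \<tau> \<union> {a'}" for v
        using A(3) A'(3) \<open>i \<le> n\<close> that unfolding supported_def by blast
      then show ?thesis by simp
    qed
    then show "(\<Sum>v\<in>insert a \<tau>. w v * ?b v) = (\<Sum>v\<in>insert a' \<tau>. w' v * ?b v)"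
      using A(1) A'(1) fin\<tau> s1 s2 by (simp add: w_def w'_def)
  qed
  then have "w a = w' a" by simp
  then show False using ha \<open>a \<noteq> a'\<close> A(1) by (simp add: w_def w'_def)
qed

text \<open>
  One walks from the barycentre of \<open>\<tau>\<close> towards a vertex \<open>d e\<^sub>i\<close> of the face on the positive side. The
  points close to \<open>\<tau>\<close> lie in finitely many simplices, so one simplex contains points arbitrarily close to
  the barycentre; as weights depend affinely on the position, it contains the barycentre, hence \<open>\<tau>\<close>.
\<close>

lemma coface_exists:
  fixes g :: "rpoint \<Rightarrow> real"
  assumes g: "linear g" "\<And>v. v \<in> \<tau> \<Longrightarrow> g (bvec n d I v) = 0" and i: "i \<in> I" "0 < g (unit_vec i)"
  shows "\<exists>a\<in>cofaces. 0 < g (bvec n d I a)"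
proof -
  let ?e = "sbasis d i" and ?y = "bvec n d I"
  have \<tau>d: "emb ` \<tau> \<subseteq> dilate n d 1" using fanD(4)[OF fan \<tau>] .
  have e: "emb ?e \<in> geom (sbasis d ` I)" using i(1) by (intro emb_in_geom) auto
  then have eI: "bcoord n (real d) j (emb ?e) = 0" if "j \<le> n" "j \<notin> I" for j
    using geom_sbasis[OF d, of I n] I that by (auto simp: atLeast0AtMost)
  have ed: "emb ?e \<in> dilate n d 1" using e geom_sbasis[OF d, of I n] I by (auto simp: atLeast0AtMost)
  (* up to scaling, these points tend to the barycentre of tau along the segment from the vertex ?e *)
  define x where "x N k = real N * (\<Sum>v\<in>\<tau>. real_of_int (v k)) + real_of_int (?e k)" for N :: nat and k
  define s where "s N = real N * card \<tau> + 1" for N :: nat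
  have P: "conic_rep (\<tau> \<union> {?e}) (\<lambda>v. (if v \<in> \<tau> then real N else 0) + (if v = ?e then 1 else 0)) (s N) (x N)" for N
  proof -
    have "conic_rep \<tau> (\<lambda>v. if v \<in> \<tau> then real N else 0) (real N * card \<tau>)
        (\<lambda>k. real N * (\<Sum>v\<in>\<tau>. real_of_int (v k)))"
      by (intro conic_repI) (auto simp: sum_distrib_left)
    moreover have "conic_rep {?e} (\<lambda>v. if v = ?e then 1 else 0) 1 (\<lambda>k. real_of_int (?e k))"
      by (intro conic_repI) auto
    ultimately have "conic_rep (\<tau> \<union> {?e}) (\<lambda>v. (if v \<in> \<tau> then real N else 0) + (if v = ?e then 1 else 0))
        (real N * card \<tau> + 1) (\<lambda>k. real N * (\<Sum>v\<in>\<tau>. real_of_int (v k)) + real_of_int (?e k))"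
      using fin\<tau> by (intro conic_rep_add) auto
    moreover have "(\<lambda>k. real N * (\<Sum>v\<in>\<tau>. real_of_int (v k)) + real_of_int (?e k)) = x N"
      by (simp add: fun_eq_iff x_def)
    ultimately show ?thesis by (simp add: s_def)
  qed
  have bx: "bcoord n (real d * s N) j (x N) =
      real N * (\<Sum>v\<in>\<tau>. bcoord n (real d) j (emb v)) + bcoord n (real d) j (emb ?e)" for N j
  proof -
    let ?b = "\<lambda>v. bcoord n (real d) j (emb v)"
    have "bcoord n (real d * s N) j (x N) =
        (\<Sum>v\<in>\<tau> \<union> {?e}. (if v \<in> \<tau> then real N * ?b v else 0) + (if v = ?e then ?b v else 0))"
      unfolding bcoord_conic_rep[OF P] by (intro sum.cong) (auto simp: distrib_right)
    also have "\<dots> = (\<Sum>v\<in>\<tau> \<union> {?e}. if v \<in> \<tau> then real N * ?b v else 0) + (\<Sum>v\<in>\<tau> \<union> {?e}. if v = ?e then ?b v else 0)"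
      by (rule sum.distrib)
    also have "(\<Sum>v\<in>\<tau> \<union> {?e}. if v = ?e then ?b v else 0) = ?b ?e" using fin\<tau> by simp
    also have "(\<Sum>v\<in>\<tau> \<union> {?e}. if v \<in> \<tau> then real N * ?b v else 0) = (\<Sum>v\<in>\<tau>. real N * ?b v)"
      using fin\<tau> by (intro sum.mono_neutral_cong_right) auto
    finally show ?thesis by (simp add: sum_distrib_left)
  qed
  have xd: "x N \<in> dilate n d (s N)" for N
    using conic_rep_dilate[OF P] \<tau>d ed by auto
  have "\<forall>N. \<exists>\<sigma> w. \<sigma> \<in> insert {} K \<and> conic_rep \<sigma> w (s N) (x N) \<and> (\<forall>v\<in>\<sigma>. 0 < w v)"
  proof
    fix N
    have "0 \<le> s N" by (simp add: s_def)
    then show "\<exists>\<sigma> w. \<sigma> \<in> insert {} K \<and> conic_rep \<sigma> w (s N) (x N) \<and> (\<forall>v\<in>\<sigma>. 0 < w v)"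
      by (rule fan_ex_support[OF fan _ xd]) blast
  qed
  then obtain S W where S: "\<And>N. S N \<in> insert {} K" and W: "\<And>N. conic_rep (S N) (W N) (s N) (x N)"
    and pos: "\<And>N v. v \<in> S N \<Longrightarrow> 0 < W N v" by metis
  have SK: "S N \<in> K" for N
  proof -
    have "S N \<noteq> {}"
    proof
      assume "S N = {}"
      then have "s N = 0" using conic_repD(3)[OF W[of N]] by simp
      moreover have "0 \<le> real N * card \<tau>" by simp
      ultimately show False unfolding s_def by linarith
    qed
    then show ?thesis using S[of N] by simp
  qed
  have "finite (S ` UNIV)" by (rule finite_subset[of _ K]) (use SK fanD(1)[OF fan] in auto)
  then obtain N where inf: "infinite {N'. S N' = S N}"
    using pigeonhole_infinite[of "UNIV :: nat set" S] by auto
  define \<sigma> where "\<sigma> = S N"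
  have \<sigma>: "\<sigma> \<in> K" "finite \<sigma>" using SK fanD(3)[OF fan] by (auto simp: \<sigma>_def)
  obtain N1 where N1: "N < N1" "S N1 = S N" using inf by (auto simp: infinite_nat_iff_unbounded)
  (* the slope of the weights in N, which represents the sum of the vertices of tau *)
  define h where "h v = (W N1 v - W N v) / (real N1 - real N)" for v
  have hs: "(\<Sum>v\<in>\<sigma>. h v) = card \<tau>" "(\<Sum>v\<in>\<sigma>. h v * real_of_int (v k)) = (\<Sum>v\<in>\<tau>. real_of_int (v k))" for k
  proof -
    have "(\<Sum>v\<in>\<sigma>. W N1 v) - (\<Sum>v\<in>\<sigma>. W N v) = (real N1 - real N) * card \<tau>"
      using conic_repD(3)[OF W[of N]] conic_repD(3)[OF W[of N1]] N1(2)
      by (simp add: \<sigma>_def s_def algebra_simps)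
    then show "(\<Sum>v\<in>\<sigma>. h v) = card \<tau>"
      using N1(1) unfolding h_def by (simp flip: sum_divide_distrib add: sum_subtractf)
    have "(\<Sum>v\<in>\<sigma>. W N1 v * real_of_int (v k)) - (\<Sum>v\<in>\<sigma>. W N v * real_of_int (v k)) =
        (real N1 - real N) * (\<Sum>v\<in>\<tau>. real_of_int (v k))"
      using conic_repD(4)[OF W[of N], of k] conic_repD(4)[OF W[of N1], of k] N1(2)
      by (simp add: \<sigma>_def x_def algebra_simps)
    moreover have "(\<Sum>v\<in>\<sigma>. h v * real_of_int (v k)) =
      ((\<Sum>v\<in>\<sigma>. W N1 v * real_of_int (v k)) - (\<Sum>v\<in>\<sigma>. W N v * real_of_int (v k))) / (real N1 - real N)"
      unfolding h_def sum_subtractf[symmetric] sum_divide_distrib by (intro sum.cong) (auto simp: left_diff_distrib)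
    ultimately show "(\<Sum>v\<in>\<sigma>. h v * real_of_int (v k)) = (\<Sum>v\<in>\<tau>. real_of_int (v k))"
      using N1(1) by simp
  qed
  have affine: "W N' v = W N v + (real N' - real N) * h v" if "S N' = S N" "v \<in> \<sigma>" for N' v
  proof -
    have "W N' v - W N v - (real N' - real N) * h v = 0"
    proof (rule fan_independent[OF fan \<sigma>(1) _ _ that(2)])
      show "(\<Sum>v\<in>\<sigma>. W N' v - W N v - (real N' - real N) * h v) = 0"
      proof -
        have "(\<Sum>v\<in>\<sigma>. W N' v - W N v - (real N' - real N) * h v) =
            sum (W N') \<sigma> - sum (W N) \<sigma> - (real N' - real N) * sum h \<sigma>"
          by (simp add: sum_subtractf sum_distrib_left)
        also have "\<dots> = s N' - s N - (real N' - real N) * card \<tau>"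
          using conic_repD(3)[OF W[of N]] conic_repD(3)[OF W[of N']] that(1) hs(1) by (simp add: \<sigma>_def)
        also have "\<dots> = 0" by (simp add: s_def algebra_simps)
        finally show ?thesis .
      qed
      show "(\<Sum>v\<in>\<sigma>. (W N' v - W N v - (real N' - real N) * h v) * real_of_int (v k)) = 0" for k
      proof -
        have "(\<Sum>v\<in>\<sigma>. (W N' v - W N v - (real N' - real N) * h v) * real_of_int (v k)) =
          (\<Sum>v\<in>\<sigma>. W N' v * real_of_int (v k)) - (\<Sum>v\<in>\<sigma>. W N v * real_of_int (v k)) -
          (real N' - real N) * (\<Sum>v\<in>\<sigma>. h v * real_of_int (v k))"
          by (simp add: left_diff_distrib sum_subtractf sum_distrib_left mult.assoc)
        also have "\<dots> = x N' k - x N k - (real N' - real N) * (\<Sum>v\<in>\<tau>. real_of_int (v k))"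
          using conic_repD(4)[OF W[of N], of k] conic_repD(4)[OF W[of N'], of k] that(1) hs(2)
          by (simp add: \<sigma>_def)
        also have "\<dots> = 0" by (simp add: x_def algebra_simps)
        finally show ?thesis .
      qed
    qed
    then show ?thesis by simp
  qed
  (* a negative slope would make the weight negative for large N *)
  have hnn: "0 \<le> h v" if v: "v \<in> \<sigma>" for v
  proof (rule ccontr)
    assume neg: "\<not> 0 \<le> h v"
    obtain N2 :: nat where N2: "W N v / (- h v) < real N2" using reals_Archimedean2 by blast
    obtain N' where N': "N + N2 < N'" "S N' = S N" using inf by (auto simp: infinite_nat_iff_unbounded)
    have "0 < - h v" using neg by simp
    then have "W N v < real N2 * (- h v)" using N2 by (simp only: pos_divide_less_eq)
    also have "\<dots> \<le> (real N' - real N) * (- h v)"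
      using N'(1) neg by (intro mult_right_mono) auto
    finally have "W N' v < 0" using affine[OF N'(2) v] by simp
    then show False using conic_repD(1)[OF W[of N'], of v] by simp
  qed
  have "\<tau> \<subseteq> \<sigma>"
  proof
    fix v assume v: "v \<in> \<tau>"
    have "conic_rep \<tau> (\<lambda>v. if v \<in> \<tau> then 1 else 0) (card \<tau>) (\<lambda>k. \<Sum>v\<in>\<tau>. real_of_int (v k))"
      by (intro conic_repI) auto
    moreover have "conic_rep \<sigma> (\<lambda>v. if v \<in> \<sigma> then h v else 0) (card \<tau>) (\<lambda>k. \<Sum>v\<in>\<tau>. real_of_int (v k))"
      using hs hnn by (intro conic_repI) auto
    ultimately have "(\<lambda>v. if v \<in> \<tau> then 1 else 0) = (\<lambda>v. if v \<in> \<sigma> then h v else 0)"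
      using fan_unique[OF fan, of \<tau> \<sigma>] \<tau> \<sigma>(1) by blast
    from fun_cong[OF this, of v] show "v \<in> \<sigma>" using v by (auto split: if_splits)
  qed
  have \<sigma>d: "emb ` \<sigma> \<subseteq> dilate n d 1" using fanD(4)[OF fan \<sigma>(1)] .
  have W\<sigma>: "conic_rep \<sigma> (W N) (s N) (x N)" using W[of N] by (simp add: \<sigma>_def)
  have \<sigma>I: "supported n d I \<sigma>"
    unfolding supported_def
  proof (intro ballI allI impI)
    fix v j assume v: "v \<in> \<sigma>" and j: "j \<le> n" "j \<notin> I"
    have "(\<Sum>u\<in>\<tau>. bcoord n (real d) j (emb u)) = 0"
      using supp j by (intro sum.neutral) (auto simp: supported_def)
    then have "(\<Sum>u\<in>\<sigma>. W N u * bcoord n (real d) j (emb u)) = 0"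
      unfolding bcoord_conic_rep[OF W\<sigma>, symmetric] bx using eI[OF j] by simp
    moreover have "0 \<le> W N u * bcoord n (real d) j (emb u)" if "u \<in> \<sigma>" for u
      using \<sigma>d that j(1) conic_repD(1)[OF W\<sigma>] by (auto simp: dilate_def)
    ultimately have "W N v * bcoord n (real d) j (emb v) = 0"
      using sum_nonneg_eq_0_iff[OF \<sigma>(2)] v by (metis (no_types, lifting))
    then show "bcoord n (real d) j (emb v) = 0" using pos[of v N] v by (simp add: \<sigma>_def)
  qed
  have "0 < (\<Sum>v\<in>\<sigma>. W N v * g (?y v))"
  proof -
    have "(\<Sum>v\<in>\<sigma>. W N v * g (?y v)) =
        (\<Sum>k\<in>I. (\<Sum>v\<in>\<sigma>. W N v * bcoord n (real d) k (emb v)) * g (unit_vec k))"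
      unfolding bvec_expand[OF finI g(1)] sum_distrib_left sum_distrib_right
      by (subst sum.swap) (simp add: mult.assoc)
    also have "\<dots> = (\<Sum>k\<in>I. (real N * (\<Sum>v\<in>\<tau>. bcoord n (real d) k (emb v)) + bcoord n (real d) k (emb ?e)) * g (unit_vec k))"
      unfolding bcoord_conic_rep[OF W\<sigma>, symmetric] bx ..
    also have "\<dots> = real N * (\<Sum>v\<in>\<tau>. g (?y v)) + g (?y ?e)"
    proof -
      have "(\<Sum>v\<in>\<tau>. g (?y v)) = (\<Sum>k\<in>I. (\<Sum>v\<in>\<tau>. bcoord n (real d) k (emb v)) * g (unit_vec k))"
        unfolding bvec_expand[OF finI g(1)] sum_distrib_right by (rule sum.swap)
      then show ?thesis
        unfolding bvec_expand[OF finI g(1), of _ _ ?e]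
        by (simp add: distrib_right sum.distrib mult.assoc flip: sum_distrib_left)
    qed
    also have "(\<Sum>v\<in>\<tau>. g (?y v)) = 0" using g(2) by (intro sum.neutral) simp
    also have "g (?y ?e) = real d * g (unit_vec i)"
    proof -
      have "g (?y ?e) = (\<Sum>k\<in>I. if k = i then real d * g (unit_vec i) else 0)"
        unfolding bvec_expand[OF finI g(1)]
        using i(1) I bcoord_sbasis[of i n _ d] by (intro sum.cong) (auto simp: subset_iff)
      then show ?thesis using finI i(1) by simp
    qed
    finally show ?thesis using i(2) d by simp
  qed
  then obtain a where a: "a \<in> \<sigma>" "0 < W N a * g (?y a)"
    by (metis (no_types, lifting) not_less sum_nonpos)
  then have ga: "0 < g (?y a)" using conic_repD(1)[OF W\<sigma>, of a] by (auto simp: zero_less_mult_iff)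
  then have "a \<notin> \<tau>" using g(2) by force
  have "insert a \<tau> \<subseteq> \<sigma>" using a(1) \<open>\<tau> \<subseteq> \<sigma>\<close> by simp
  moreover have "card \<sigma> \<le> card (insert a \<tau>)"
    using fan_card_le[OF fan \<sigma>(1) d \<sigma>I finI] card \<open>a \<notin> \<tau>\<close> fin\<tau> by simp
  ultimately have "insert a \<tau> = \<sigma>" using card_seteq[OF \<sigma>(2)] by blast
  then have "a \<in> cofaces" using \<open>a \<notin> \<tau>\<close> \<sigma>(1) \<sigma>I by (simp add: cofaces_def)
  then show ?thesis using ga by blast
qed

lemma coface_nonzero:
  fixes g :: "rpoint \<Rightarrow> real"
  assumes "a \<in> cofaces" "linear g" "\<And>v. v \<in> \<tau> \<Longrightarrow> g (bvec n d I v) = 0" "i \<in> I" "g (unit_vec i) \<noteq> 0"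
  shows "g (bvec n d I a) \<noteq> 0"
proof
  assume z: "g (bvec n d I a) = 0"
  have A: "a \<notin> \<tau>" "insert a \<tau> \<in> K" "supported n d I (insert a \<tau>)" using assms(1) by (auto simp: cofaces_def)
  have "unit_vec i \<in> span (bvec n d I ` insert a \<tau>)"
    by (rule full_simplex_spans[OF fan A(2) d A(3) finI])
      (use A(1) fin\<tau> card assms(4) in \<open>auto simp: unit_vec_def\<close>)
  then have "g (unit_vec i) = 0"
    using linear_eq_0_on_span[OF assms(2), of "bvec n d I ` insert a \<tau>"] z assms(3) by blast
  then show False using assms(5) by simp
qed

text \<open>
  Let \<open>g\<close> be a linear form vanishing on \<open>\<tau>\<close> but not on the face. If \<open>\<tau>\<close> is not in the boundary of the face,
  then its barycentre has positive coordinates, whence \<open>g\<close> takes both signs on the vertices of the face,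
  and there is exactly one coface on each side. If \<open>\<tau>\<close> lies in the facet opposite to a vertex \<open>j\<close>, then this
  facet is unique and \<open>g\<close> can be taken to be the coordinate \<open>j\<close>, which is nonnegative; so there is exactly
  one coface.
\<close>

theorem facet_count:
  "(\<exists>a b. a \<noteq> b \<and> cofaces = {a, b} \<and> (\<forall>j\<in>I. \<not> supported n d (I - {j}) \<tau>)) \<or>
   (\<exists>a j. cofaces = {a} \<and> {j \<in> I. supported n d (I - {j}) \<tau>} = {j})"
proof (cases "\<forall>j\<in>I. \<not> supported n d (I - {j}) \<tau>")
  case True
  let ?y = "bvec n d I"
  have "\<exists>i\<in>I. unit_vec i \<notin> span (?y ` \<tau>)"
  proof (rule ccontr)
    assume "\<not> ?thesis"
    then have "unit_vec ` I \<subseteq> span (?y ` \<tau>)" by blast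
    moreover have "inj_on unit_vec I" by (auto simp: inj_on_def unit_vec_def fun_eq_iff split: if_splits)
    moreover have "independent (unit_vec ` I)"
    proof
      assume "dependent (unit_vec ` I)"
      then obtain U where U: "\<exists>y\<in>unit_vec ` I. U y \<noteq> 0" "(\<Sum>y\<in>unit_vec ` I. U y *\<^sub>R y) = 0"
        using dependent_finite[of "unit_vec ` I"] finI by auto
      have s: "(\<Sum>i\<in>I. U (unit_vec i) *\<^sub>R unit_vec i) = 0"
        using U(2) by (simp add: sum.reindex[OF \<open>inj_on unit_vec I\<close>])
      have "U (unit_vec j) = 0" if "j \<in> I" for j
      proof -
        have "(\<Sum>i\<in>I. U (unit_vec i) *\<^sub>R unit_vec i) j = (\<Sum>i\<in>I. if i = j then U (unit_vec j) else 0)"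
          unfolding sum_apply by (intro sum.cong) (auto simp: scaleR_apply unit_vec_def)
        then show ?thesis using s finI that by simp
      qed
      then show False using U(1) by blast
    qed
    ultimately have "card I \<le> card (?y ` \<tau>)"
      using independent_span_bound[of "?y ` \<tau>" "unit_vec ` I"] fin\<tau> by (simp add: card_image)
    also have "\<dots> \<le> card \<tau>" by (rule card_image_le[OF fin\<tau>])
    finally show False using card by simp
  qed
  then obtain i0 where i0: "i0 \<in> I" "unit_vec i0 \<notin> span (?y ` \<tau>)" by blast
  then have "independent (insert (unit_vec i0) (?y ` \<tau>))"
    by (intro independent_insertI independent_bvec[OF fan \<tau> d supp])
  then obtain g :: "rpoint \<Rightarrow> real" where g: "linear g"
    "\<forall>x\<in>insert (unit_vec i0) (?y ` \<tau>). g x = (if x = unit_vec i0 then 1 else 0)"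
    using linear_independent_extend[of "insert (unit_vec i0) (?y ` \<tau>)" "\<lambda>x. if x = unit_vec i0 then 1 else 0"]
    by blast
  have g0: "g (?y v) = 0" if "v \<in> \<tau>" for v
    using g(2) i0(2) span_base[of "?y v" "?y ` \<tau>"] that by (auto split: if_splits)
  have gi: "g (unit_vec i0) = 1" using g(2) by simp
  have b: "0 < (\<Sum>v\<in>\<tau>. bcoord n (real d) i (emb v))" if i: "i \<in> I" for i
  proof -
    have nn: "0 \<le> bcoord n (real d) i (emb v)" if "v \<in> \<tau>" for v
      using fanD(4)[OF fan \<tau>] that i I by (auto simp: dilate_def)
    obtain v where "v \<in> \<tau>" "bcoord n (real d) i (emb v) \<noteq> 0"
      using True i supp unfolding supported_def by blast
    then show ?thesis using nn fin\<tau> by (intro sum_pos2[of \<tau> v]) (auto simp: less_le)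
  qed
  have "0 = (\<Sum>v\<in>\<tau>. g (?y v))" using g0 by simp
  also have "\<dots> = (\<Sum>k\<in>I. (\<Sum>v\<in>\<tau>. bcoord n (real d) k (emb v)) * g (unit_vec k))"
    unfolding bvec_expand[OF finI g(1)] sum_distrib_right by (rule sum.swap)
  finally have z: "(\<Sum>k\<in>I. (\<Sum>v\<in>\<tau>. bcoord n (real d) k (emb v)) * g (unit_vec k)) = 0" by simp
  have "\<exists>i\<in>I. g (unit_vec i) < 0"
  proof (rule ccontr)
    assume "\<not> ?thesis"
    then have "0 < (\<Sum>k\<in>I. (\<Sum>v\<in>\<tau>. bcoord n (real d) k (emb v)) * g (unit_vec k))"
      using b i0(1) gi finI by (intro sum_pos2[of I i0]) (auto simp: not_less less_imp_le)
    then show False using z by simp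
  qed
  then obtain i1 where i1: "i1 \<in> I" "g (unit_vec i1) < 0" by blast
  obtain a where a: "a \<in> cofaces" "0 < g (?y a)"
    using coface_exists[OF g(1) g0 i0(1)] gi by auto
  have ng: "linear (\<lambda>x. - g x)" using g(1) by (rule linear_compose_neg)
  obtain c where c: "c \<in> cofaces" "0 < - g (?y c)"
    using coface_exists[OF ng _ i1(1)] g0 i1(2) by auto
  have "x = a \<or> x = c" if x: "x \<in> cofaces" for x
  proof -
    have "g (?y x) \<noteq> 0" using coface_nonzero[OF x g(1) g0 i0(1)] gi by simp
    then consider "0 < g (?y x)" | "0 < - g (?y x)" by linarith
    then show ?thesis
    proof cases
      case 1
      then show ?thesis using coface_unique[OF x 1 a g(1) g0] by simp
    next
      case 2
      then show ?thesis using coface_unique[OF x _ c(1) _ ng] c(2) g0 by simp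
    qed
  qed
  then have "cofaces = {a, c}" using a(1) c(1) by blast
  moreover have "a \<noteq> c" using a(2) c(2) by auto
  ultimately show ?thesis using True by blast
next
  case False
  then obtain j where j: "j \<in> I" "supported n d (I - {j}) \<tau>" by blast
  have uniq: "k = j" if "k \<in> I" "supported n d (I - {k}) \<tau>" for k
  proof (rule ccontr)
    assume "k \<noteq> j"
    have "supported n d (I - {j} - {k}) \<tau>" using j that unfolding supported_def by blast
    then have "card \<tau> \<le> card (I - {j} - {k})" using finI by (intro fan_card_le[OF fan \<tau> d]) auto
    moreover have "0 < card \<tau>" using fin\<tau> fanD(2)[OF fan] \<tau> by (auto simp: card_gt_0_iff)
    ultimately show False using \<open>k \<noteq> j\<close> j(1) that(1) card finI by simp
  qed
  define g where "g = (\<lambda>x :: rpoint. x j)"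
  have g: "linear g" by (rule linearI) (simp_all add: g_def scaleR_apply)
  have "j \<le> n" using j(1) I by auto
  have gy: "g (bvec n d I v) = bcoord n (real d) j (emb v)" for v using j(1) by (simp add: g_def bvec_def)
  have g0: "g (bvec n d I v) = 0" if "v \<in> \<tau>" for v
    using j that \<open>j \<le> n\<close> by (simp add: gy supported_def)
  have gj: "g (unit_vec j) = 1" by (simp add: g_def unit_vec_def)
  obtain a where a: "a \<in> cofaces" "0 < g (bvec n d I a)"
    using coface_exists[OF g g0 j(1)] gj by auto
  have "x = a" if x: "x \<in> cofaces" for x
  proof -
    have "insert x \<tau> \<in> K" using x by (simp add: cofaces_def)
    then have "emb x \<in> dilate n d 1" using fanD(4)[OF fan] by blast
    then have "0 \<le> g (bvec n d I x)" using \<open>j \<le> n\<close> by (simp add: gy dilate_def)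
    moreover have "g (bvec n d I x) \<noteq> 0" using coface_nonzero[OF x g g0 j(1)] gj by simp
    ultimately show ?thesis using coface_unique[OF x _ a g g0] by simp
  qed
  then have "cofaces = {a}" using a(1) by blast
  moreover have "{k \<in> I. supported n d (I - {k}) \<tau>} = {j}" using uniq j by blast
  ultimately show ?thesis by blast
qed

end


section \<open>Faces of the dilated simplex\<close>

definition face :: "nat \<Rightarrow> nat set \<Rightarrow> rpoint set" where
  "face d I = geom (sbasis d ` I)"

lemma face_eq:
  assumes "d \<ge> 1" "I \<subseteq> {..n}"
  shows "face d I = {x \<in> dilate n d 1. \<forall>j\<le>n. j \<notin> I \<longrightarrow> bcoord n (real d) j x = 0}"
  unfolding face_def using assms by (intro geom_sbasis) auto

lemma PP_face: "PP n d = face d {..n}"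
  by (simp add: PP_def face_def atLeast0AtMost)

lemma vertex_in_face_iff:
  assumes "d \<ge> 1" "I \<subseteq> {..n}" "i \<le> n"
  shows "emb (sbasis d i) \<in> face d I \<longleftrightarrow> i \<in> I"
proof
  assume "emb (sbasis d i) \<in> face d I"
  then have "i \<notin> I \<longrightarrow> bcoord n (real d) i (emb (sbasis d i)) = 0"
    using assms(3) unfolding face_eq[OF assms(1,2)] by blast
  then show "i \<in> I" using assms bcoord_sbasis[of i n i d] by auto
qed (auto simp: face_def intro: emb_in_geom)

lemma face_subset_iff:
  assumes "d \<ge> 1" "I \<subseteq> {..n}" "J \<subseteq> {..n}"
  shows "face d I \<subseteq> face d J \<longleftrightarrow> I \<subseteq> J"
proof
  assume sub: "face d I \<subseteq> face d J"
  show "I \<subseteq> J"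
  proof
    fix i assume "i \<in> I"
    then have "emb (sbasis d i) \<in> face d I" by (auto simp: face_def intro: emb_in_geom)
    then have "emb (sbasis d i) \<in> face d J" using sub by blast
    then show "i \<in> J" using vertex_in_face_iff[OF assms(1,3)] \<open>i \<in> I\<close> assms(2) by auto
  qed
qed (auto simp: face_def intro!: geom_mono)

lemma face_inj:
  assumes "d \<ge> 1" "I \<subseteq> {..n}" "J \<subseteq> {..n}"
  shows "face d I = face d J \<longleftrightarrow> I = J"
  using face_subset_iff[OF assms] face_subset_iff[OF assms(1,3,2)] by auto

lemma geom_subset_face_iff:
  assumes "simplicial_fan n d K" "\<sigma> \<in> K" "d \<ge> 1" "I \<subseteq> {..n}"
  shows "geom \<sigma> \<subseteq> face d I \<longleftrightarrow> supported n d I \<sigma>"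
proof -
  have "geom \<sigma> \<subseteq> face d I \<longleftrightarrow> (\<forall>v\<in>\<sigma>. emb v \<in> face d I)"
    unfolding face_def by (rule geom_subset_convex[OF convex_geom])
  then show ?thesis
    using fanD(4)[OF assms(1,2)] unfolding face_eq[OF assms(3,4)] supported_def by blast
qed

lemma face_face_of:
  assumes "d \<ge> 1" "I \<subseteq> {..n}"
  shows "face d I face_of PP n d"
  unfolding face_of_def
proof (intro conjI ballI impI)
  show "face d I \<subseteq> PP n d" unfolding PP_face using assms by (simp add: face_subset_iff)
  show "convex (face d I)" by (simp add: face_def convex_geom)
  fix a b x assume a: "a \<in> PP n d" and b: "b \<in> PP n d" and x: "x \<in> face d I" "x \<in> open_segment a b"
  have D: "a \<in> dilate n d 1" "b \<in> dilate n d 1" using a b PP_eq[OF assms(1)] by auto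
  obtain u where u: "0 < u" "u < 1" "x = (1 - u) *\<^sub>R a + u *\<^sub>R b"
    using x(2) by (auto simp: in_segment)
  have "bcoord n (real d) j a = 0 \<and> bcoord n (real d) j b = 0" if j: "j \<le> n" "j \<notin> I" for j
  proof -
    have "(1 - u) * bcoord n (real d) j a + u * bcoord n (real d) j b = 0"
      using x(1) j bcoord_affine[of "1 - u" u n "real d" j a b] unfolding face_eq[OF assms] u(3) by simp
    moreover have "0 \<le> bcoord n (real d) j a" "0 \<le> bcoord n (real d) j b" using D j by (auto simp: dilate_def)
    ultimately show ?thesis using u(1,2) by (simp add: add_nonneg_eq_0_iff)
  qed
  then show "a \<in> face d I" "b \<in> face d I" using D unfolding face_eq[OF assms] by auto
qed

text \<open>
  Let \<open>I\<close> be the set of coordinates not vanishing identically on \<open>Q\<close>. Averaging points of \<open>Q\<close> gives a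
  point \<open>z \<in> Q\<close> with positive coordinates on \<open>I\<close>; each other point \<open>y\<close> of the face \<open>I\<close> is an end of a segment in the
  polytope having \<open>z\<close> in its interior, so \<open>y \<in> Q\<close>.
\<close>

lemma face_of_PP:
  assumes d: "d \<ge> 1" and Q: "Q face_of PP n d" "Q \<noteq> {}"
  obtains I where "I \<subseteq> {..n}" "Q = face d I"
proof -
  define I where "I = {j. j \<le> n \<and> (\<exists>x\<in>Q. bcoord n (real d) j x \<noteq> 0)}"
  have I: "I \<subseteq> {..n}" and finI: "finite I" by (auto simp: I_def)
  have QP: "Q \<subseteq> dilate n d 1" using Q(1) PP_eq[OF d] by (auto simp: face_of_def)
  have "Q = face d I"
  proof
    show "Q \<subseteq> face d I" unfolding face_eq[OF d I] using QP by (auto simp: I_def)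
    show "face d I \<subseteq> Q"
    proof
      fix y assume y: "y \<in> face d I"
      then have yD: "y \<in> dilate n d 1" and yI: "\<And>j. j \<le> n \<Longrightarrow> j \<notin> I \<Longrightarrow> bcoord n (real d) j y = 0"
        unfolding face_eq[OF d I] by auto
      have "\<forall>j\<in>I. \<exists>x. x \<in> Q \<and> bcoord n (real d) j x \<noteq> 0" by (auto simp: I_def)
      then obtain X where X: "\<And>j. j \<in> I \<Longrightarrow> X j \<in> Q" "\<And>j. j \<in> I \<Longrightarrow> bcoord n (real d) j (X j) \<noteq> 0"
        by metis
      have "I \<noteq> {}"
      proof
        assume "I = {}"
        then have "(\<Sum>j\<le>n. bcoord n (real d) j y) = 0" using yI by (intro sum.neutral) auto
        then show False using d by (simp add: sum_bcoord)
      qed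
      then have cI: "0 < real (card I)" using finI by (simp add: card_gt_0_iff)
      define z where "z = (\<Sum>j\<in>I. (1 / real (card I)) *\<^sub>R X j)"
      have zQ: "z \<in> Q"
        unfolding z_def using Q(1) X(1) cI finI by (intro convex_sum) (auto simp: face_of_def)
      have bz: "bcoord n (real d) j z = (\<Sum>k\<in>I. bcoord n (real d) j (X k)) / card I" for j
      proof (cases "j = 0")
        case True
        have "(\<Sum>i\<in>{1..n}. z i) = (\<Sum>k\<in>I. \<Sum>i\<in>{1..n}. X k i) / card I"
          unfolding z_def sum_apply by (subst sum.swap) (simp add: scaleR_apply sum_divide_distrib)
        then show ?thesis using True cI
          by (simp add: bcoord_def sum_subtractf diff_divide_distrib)
      next
        case False
        then show ?thesis by (simp add: bcoord_def z_def sum_apply scaleR_apply sum_divide_distrib)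
      qed
      have zpos: "0 < bcoord n (real d) j z" if j: "j \<in> I" for j
      proof -
        have nn: "0 \<le> bcoord n (real d) j (X k)" if "k \<in> I" for k
          using QP X(1)[OF that] j I by (auto simp: dilate_def)
        have "0 < (\<Sum>k\<in>I. bcoord n (real d) j (X k))"
          using nn[OF j] X(2)[OF j] nn finI j by (intro sum_pos2[of I j]) (auto simp: less_le)
        then show ?thesis using cI by (simp add: bz)
      qed
      (* no coordinate of y exceeds d, so the segment from y can be prolonged beyond z by this fraction *)
      define e where "e = Min ((\<lambda>j. bcoord n (real d) j z) ` I) / d"
      have "0 < Min ((\<lambda>j. bcoord n (real d) j z) ` I)"
        using finI \<open>I \<noteq> {}\<close> zpos by (subst Min_gr_iff) auto
      then have e: "0 < e" using d by (simp add: e_def)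
      define w where "w = (1 + e) *\<^sub>R z + (- e) *\<^sub>R y"
      have bw: "bcoord n (real d) j w = (1 + e) * bcoord n (real d) j z + (- e) * bcoord n (real d) j y" for j
        unfolding w_def by (rule bcoord_affine) simp
      have "0 \<le> bcoord n (real d) j w" if j: "j \<le> n" for j
      proof (cases "j \<in> I")
        case True
        have "bcoord n (real d) j y \<le> (\<Sum>k\<le>n. bcoord n (real d) k y)"
          using yD j by (intro member_le_sum) (auto simp: dilate_def)
        then have "e * bcoord n (real d) j y \<le> e * d" using e by (simp add: sum_bcoord)
        also have "\<dots> = Min ((\<lambda>j. bcoord n (real d) j z) ` I)" using d by (simp add: e_def)
        also have "\<dots> \<le> bcoord n (real d) j z" using finI True by simp
        also have "\<dots> \<le> (1 + e) * bcoord n (real d) j z"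
          using e zpos[OF True] by (simp add: distrib_right)
        finally show ?thesis by (simp add: bw)
      next
        case False
        have "bcoord n (real d) j z = 0"
          using False j X(1) by (auto simp: bz I_def intro!: sum.neutral)
        then show ?thesis using yI[OF j False] by (simp add: bw)
      qed
      moreover have "w i = 0" if "i \<notin> {1..n}" for i
        using QP zQ yD that by (auto simp: w_def scaleR_apply dilate_def)
      ultimately have wP: "w \<in> PP n d" unfolding PP_eq[OF d] by (simp add: dilate_def)
      have yP: "y \<in> PP n d" using yD PP_eq[OF d] by simp
      show "y \<in> Q"
      proof (cases "y = w")
        case True
        have "(1 + e) *\<^sub>R y = (1 + e) *\<^sub>R z"
          using True unfolding w_def by (auto simp: fun_eq_iff scaleR_apply algebra_simps)
        then have "y = z" using e by (simp add: fun_eq_iff scaleR_apply)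
        then show ?thesis using zQ by simp
      next
        case False
        have "z = (1 - 1 / (1 + e)) *\<^sub>R y + (1 / (1 + e)) *\<^sub>R w"
        proof
          fix i
          have "(1 - t) * y i + t * ((1 + e) * z i + (- e) * y i) = z i" if t: "t * (1 + e) = 1" for t
          proof -
            have "(1 - t) * y i + t * ((1 + e) * z i + (- e) * y i) = y i + (t * (1 + e)) * (z i - y i)"
              by (simp add: algebra_simps)
            then show ?thesis unfolding t by simp
          qed
          from this[of "1 / (1 + e)"] have "(1 - 1 / (1 + e)) * y i + (1 / (1 + e)) * ((1 + e) * z i + (- e) * y i) = z i"
            using e by simp
          then show "z i = ((1 - 1 / (1 + e)) *\<^sub>R y + (1 / (1 + e)) *\<^sub>R w) i"
            by (simp add: scaleR_apply w_def)
        qed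
        then have "z \<in> open_segment y w"
          using False e unfolding in_segment by (intro conjI exI[of _ "1 / (1 + e)"]) auto
        then show ?thesis using Q(1) yP wP zQ unfolding face_of_def by blast
      qed
    qed
  qed
  then show ?thesis using that I by blast
qed

section \<open>Dimensions\<close>

text \<open>
  The differences to a fixed vertex form a basis of the tangent space.
\<close>

lemma dim_tangent_geom:
  assumes fin: "finite \<sigma>" "\<sigma> \<noteq> {}" and aff: "\<not> affine_dependent (emb ` \<sigma>)"
  shows "dim (tangent (geom \<sigma>)) = card \<sigma> - 1"
proof -
  obtain a where a: "a \<in> \<sigma>" using fin(2) by blast
  let ?S = "emb ` (\<sigma> - {a})"
  let ?B = "(\<lambda>x. - emb a + x) ` ?S"
  have ins: "emb ` \<sigma> = insert (emb a) ?S" using a by auto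
  have na: "emb a \<notin> ?S" using inj_emb by (auto simp: inj_eq)
  have ind: "independent ?B" using aff affine_dependent_iff_dependent[OF na] unfolding ins by simp
  have "card ?B = card \<sigma> - 1"
  proof -
    have "inj_on (\<lambda>x. - emb a + x) ?S" by (auto simp: inj_on_def)
    then have "card ?B = card ?S" by (rule card_image)
    also have "\<dots> = card (\<sigma> - {a})" by (rule card_image) (rule inj_on_subset[OF inj_emb], simp)
    finally show ?thesis using a fin(1) by simp
  qed
  moreover have "?B \<subseteq> tangent (geom \<sigma>)"
  proof
    fix x assume "x \<in> ?B"
    then obtain v where v: "v \<in> \<sigma>" "x = emb v - emb a" by auto
    then show "x \<in> tangent (geom \<sigma>)"
      unfolding tangent_def using emb_in_geom a by (intro span_base) blast
  qed
  moreover have "tangent (geom \<sigma>) \<subseteq> span ?B"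
    unfolding tangent_def
  proof (rule span_minimal)
    show "{x - y |x y. x \<in> geom \<sigma> \<and> y \<in> geom \<sigma>} \<subseteq> span ?B"
    proof clarify
      fix x y assume x: "x \<in> geom \<sigma>" and y: "y \<in> geom \<sigma>"
      have "geom \<sigma> \<subseteq> affine hull (emb ` \<sigma>)" unfolding geom_def by (rule convex_hull_subset_affine_hull)
      also have "\<dots> = (\<lambda>x. emb a + x) ` span ?B" unfolding ins by (rule affine_hull_insert_span_gen)
      finally obtain p q where "p \<in> span ?B" "q \<in> span ?B" "x = emb a + p" "y = emb a + q"
        using x y by blast
      then show "x - y \<in> span ?B" by (simp add: span_diff)
    qed
  qed simp
  ultimately show ?thesis using ind by (intro dim_unique) auto
qed

lemma sbasis_inj:
  assumes "d \<ge> 1"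
  shows "inj_on (sbasis d) A"
proof
  fix i j assume "sbasis d i = sbasis d j"
  from fun_cong[OF this, of i] fun_cong[OF this, of j] show "i = j"
    using assms by (auto simp: sbasis_def split: if_splits)
qed

lemma face_affine_independent:
  assumes d: "d \<ge> 1" and I: "I \<subseteq> {..n}"
  shows "\<not> affine_dependent (emb ` sbasis d ` I)"
proof
  assume dep: "affine_dependent (emb ` sbasis d ` I)"
  have fin: "finite I" using I finite_subset by blast
  have inj: "inj_on (\<lambda>i. emb (sbasis d i)) I"
    using comp_inj_on[OF sbasis_inj[OF d, of I] inj_on_subset[OF inj_emb subset_UNIV]]
    by (simp add: comp_def)
  have img: "emb ` sbasis d ` I = (\<lambda>i. emb (sbasis d i)) ` I" by auto
  obtain U where U: "sum U (emb ` sbasis d ` I) = 0" "\<exists>v\<in>emb ` sbasis d ` I. U v \<noteq> 0"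
    "(\<Sum>v\<in>emb ` sbasis d ` I. U v *\<^sub>R v) = 0"
    using dep affine_dependent_explicit_finite[of "emb ` sbasis d ` I"] fin by auto
  define c where "c i = U (emb (sbasis d i))" for i
  have c0: "sum c I = 0" using U(1) unfolding img by (simp add: sum.reindex[OF inj] c_def)
  have "(\<Sum>i\<in>I. c i *\<^sub>R emb (sbasis d i)) = 0"
    using U(3) unfolding img by (simp add: sum.reindex[OF inj] c_def)
  then have c1: "(\<Sum>i\<in>I. c i * emb (sbasis d i) k) = 0" for k
    by (simp add: fun_eq_iff sum_apply scaleR_apply)
  have "c j = 0" if j: "j \<in> I" for j
  proof -
    have "(\<Sum>i\<in>I. c i * bcoord n (real d) j (emb (sbasis d i))) = (\<Sum>i\<in>I. if i = j then c j * d else 0)"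
      using I j bcoord_sbasis[of _ n j d] by (intro sum.cong) (auto simp: subset_iff)
    also have "\<dots> = c j * d" using fin j by simp
    finally have 1: "(\<Sum>i\<in>I. c i * bcoord n (real d) j (emb (sbasis d i))) = c j * d" .
    have "(\<Sum>i\<in>I. c i * bcoord n (real d) j (emb (sbasis d i))) = 0"
    proof (cases "j = 0")
      case True
      have "(\<Sum>i\<in>I. c i * bcoord n (real d) j (emb (sbasis d i))) =
          sum c I * d - (\<Sum>i\<in>I. \<Sum>k\<in>{1..n}. c i * emb (sbasis d i) k)"
        using True by (simp add: bcoord_def right_diff_distrib sum_subtractf sum_distrib_left sum_distrib_right)
      also have "(\<Sum>i\<in>I. \<Sum>k\<in>{1..n}. c i * emb (sbasis d i) k) = 0"
        by (subst sum.swap) (simp add: c1)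
      finally show ?thesis using c0 by simp
    next
      case False
      then show ?thesis using c1[of j] by (simp add: bcoord_def)
    qed
    then show ?thesis using 1 d by simp
  qed
  then show False using U(2) by (auto simp: c_def)
qed

lemma dim_tangent_face:
  assumes "d \<ge> 1" "I \<subseteq> {..n}" "I \<noteq> {}"
  shows "dim (tangent (face d I)) = card I - 1"
proof -
  have "finite I" using assms(2) finite_subset by blast
  then show ?thesis
    unfolding face_def using dim_tangent_geom[OF _ _ face_affine_independent[OF assms(1,2)]] assms(3)
    by (simp add: card_image[OF sbasis_inj[OF assms(1)]])
qed

section \<open>Cells\<close>

context
  fixes n d :: nat and K :: "lpoint set set"
  assumes fan: "simplicial_fan n d K" and d: "d \<ge> 1"
begin

lemma simplex_fin: "\<sigma> \<in> K \<Longrightarrow> finite \<sigma>" "\<sigma> \<in> K \<Longrightarrow> \<sigma> \<noteq> {}"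
  using fanD(2,3)[OF fan] by auto

lemma card_le_support:
  "\<sigma> \<in> K \<Longrightarrow> supported n d I \<sigma> \<Longrightarrow> I \<subseteq> {..n} \<Longrightarrow> card \<sigma> \<le> card I"
  using fan_card_le[OF fan _ d] finite_subset by blast

lemma dim_simplex: "\<sigma> \<in> K \<Longrightarrow> dim (tangent (geom \<sigma>)) = card \<sigma> - 1"
  using dim_tangent_geom fan_affine_independent[OF fan] simplex_fin by blast

lemma YY_E:
  assumes "(\<sigma>, Q) \<in> YY (PP n d) K"
  obtains I where "I \<subseteq> {..n}" "Q = face d I" "supported n d I \<sigma>" "\<sigma> \<in> K" "card \<sigma> \<le> card I"
proof -
  have Q: "\<sigma> \<in> K" "Q face_of PP n d" "geom \<sigma> \<subseteq> Q" using assms by (auto simp: YY_def)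
  obtain v where "v \<in> \<sigma>" using simplex_fin(2)[OF Q(1)] by blast
  then have "Q \<noteq> {}" using Q(3) emb_in_geom by blast
  then obtain I where I: "I \<subseteq> {..n}" "Q = face d I" using face_of_PP[OF d Q(2)] by blast
  then have "supported n d I \<sigma>" using geom_subset_face_iff[OF fan Q(1) d I(1)] Q(3) by simp
  then show ?thesis using that I Q(1) card_le_support by blast
qed

lemma YY_I:
  assumes "\<sigma> \<in> K" "I \<subseteq> {..n}" "supported n d I \<sigma>"
  shows "(\<sigma>, face d I) \<in> YY (PP n d) K"
  using assms face_face_of[OF d assms(2)] geom_subset_face_iff[OF fan assms(1) d assms(2)]
  by (simp add: YY_def)

lemma cdim_cell:
  assumes "\<sigma> \<in> K" "I \<subseteq> {..n}" "supported n d I \<sigma>"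
  shows "cdim (\<sigma>, face d I) = card I - card \<sigma>"
proof -
  have "1 \<le> card \<sigma>" using simplex_fin[OF assms(1)] by (simp add: Suc_le_eq card_gt_0_iff)
  moreover have "card \<sigma> \<le> card I" using card_le_support assms by blast
  ultimately have "I \<noteq> {}" by auto
  then show ?thesis
    using dim_simplex[OF assms(1)] dim_tangent_face[OF d assms(2)] \<open>1 \<le> card \<sigma>\<close>
    by (simp add: cdim_def)
qed

lemma XX_iff:
  "(\<sigma>, Q) \<in> XX (PP n d) K \<longleftrightarrow> (\<sigma>, Q) \<in> YY (PP n d) K \<and> 2 \<le> card \<sigma>"
proof -
  have "1 \<le> dim (tangent (geom \<sigma>)) \<longleftrightarrow> 2 \<le> card \<sigma>" if "\<sigma> \<in> K"
    using dim_simplex[OF that] by linarith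
  then show ?thesis by (auto simp: XX_def YY_def)
qed

lemma XX_E:
  assumes "e \<in> XX (PP n d) K"
  obtains \<sigma> I where "e = (\<sigma>, face d I)" "I \<subseteq> {..n}" "supported n d I \<sigma>" "\<sigma> \<in> K"
    "card \<sigma> \<le> card I" "2 \<le> card \<sigma>" "cdim e = card I - card \<sigma>"
proof -
  obtain \<sigma> Q where e: "e = (\<sigma>, Q)" by (cases e)
  then have "(\<sigma>, Q) \<in> YY (PP n d) K" "2 \<le> card \<sigma>" using assms XX_iff by auto
  from YY_E[OF this(1)] obtain I where I: "I \<subseteq> {..n}" "Q = face d I" "supported n d I \<sigma>" "\<sigma> \<in> K"
    "card \<sigma> \<le> card I" .
  then show ?thesis using that[of \<sigma> I] e \<open>2 \<le> card \<sigma>\<close> cdim_cell[of \<sigma> I] by simp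
qed

lemma XX_I:
  "\<sigma> \<in> K \<Longrightarrow> I \<subseteq> {..n} \<Longrightarrow> supported n d I \<sigma> \<Longrightarrow> 2 \<le> card \<sigma> \<Longrightarrow> (\<sigma>, face d I) \<in> XX (PP n d) K"
  using XX_iff YY_I by blast

lemma finite_XX: "finite (XX (PP n d) K)"
proof (rule finite_subset)
  show "XX (PP n d) K \<subseteq> K \<times> face d ` Pow {..n}"
  proof
    fix e assume "e \<in> XX (PP n d) K"
    then show "e \<in> K \<times> face d ` Pow {..n}" by (rule XX_E) auto
  qed
  show "finite (K \<times> face d ` Pow {..n})" using fanD(1)[OF fan] by simp
qed

lemma cell_le_iff:
  assumes "I \<subseteq> {..n}" "J \<subseteq> {..n}"
  shows "cell_le (\<sigma>, face d J) (\<tau>, face d I) \<longleftrightarrow> \<tau> \<subseteq> \<sigma> \<and> J \<subseteq> I"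
  using face_subset_iff[OF d assms(2,1)] by (simp add: cell_le_def)

definition ends :: "cell \<Rightarrow> cell set" where
  "ends e = {e' \<in> XX (PP n d) K. cell_le e' e \<and> cdim e' = 0}"

text \<open>
  Passing to the boundary of a cell \<open>(\<tau>, Q)\<close> means enlarging \<open>\<tau>\<close> or shrinking \<open>Q\<close>; from a 1-cell to a 0-cell
  exactly one of the two happens, by one step.
\<close>

lemma ends_eq:
  assumes \<tau>: "\<tau> \<in> K" "I \<subseteq> {..n}" "supported n d I \<tau>" "2 \<le> card \<tau>" "card I = card \<tau> + 1"
  shows "ends (\<tau>, face d I) = (\<lambda>a. (insert a \<tau>, face d I)) ` cofaces n d K \<tau> I \<union>
    (\<lambda>j. (\<tau>, face d (I - {j}))) ` {j \<in> I. supported n d (I - {j}) \<tau>}"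
    (is "_ = ?A \<union> ?B")
proof
  have finI: "finite I" using \<tau>(2) finite_subset by blast
  have fin\<tau>: "finite \<tau>" using simplex_fin(1)[OF \<tau>(1)] .
  note cof = cofaces_def[OF fan d \<tau>(1,3,2,5)]
  show "ends (\<tau>, face d I) \<subseteq> ?A \<union> ?B"
  proof
    fix e assume "e \<in> ends (\<tau>, face d I)"
    then have e: "e \<in> XX (PP n d) K" "cell_le e (\<tau>, face d I)" "cdim e = 0" by (auto simp: ends_def)
    from XX_E[OF e(1)] obtain \<sigma> J where \<sigma>: "e = (\<sigma>, face d J)" "J \<subseteq> {..n}" "supported n d J \<sigma>" "\<sigma> \<in> K"
      "card \<sigma> \<le> card J" "cdim e = card J - card \<sigma>" by metis
    have le: "\<tau> \<subseteq> \<sigma>" "J \<subseteq> I" using e(2) cell_le_iff[OF \<tau>(2) \<sigma>(2)] \<sigma>(1) by auto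
    have c: "card J = card \<sigma>" using \<sigma>(5,6) e(3) by simp
    have "card J \<le> card I" by (rule card_mono[OF finI le(2)])
    show "e \<in> ?A \<union> ?B"
    proof (cases "\<sigma> = \<tau>")
      case True
      then have "card (I - J) = 1" using c \<tau>(5) le(2) finI by (simp add: card_Diff_subset finite_subset)
      then obtain j where j: "I - J = {j}" by (auto simp: card_1_singleton_iff)
      then have "J = I - {j}" "j \<in> I" using le(2) by auto
      then show ?thesis using True \<sigma>(1,3) by auto
    next
      case False
      have "card \<tau> < card \<sigma>" using le(1) False simplex_fin(1)[OF \<sigma>(4)] by (intro psubset_card_mono) auto
      then have cs: "card \<sigma> = card \<tau> + 1" "card J = card I" using c \<open>card J \<le> card I\<close> \<tau>(5) by auto
      then have "J = I" using card_subset_eq[OF finI le(2)] by simp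
      have "card (\<sigma> - \<tau>) = 1" using cs(1) le(1) fin\<tau> by (simp add: card_Diff_subset)
      then obtain a where a: "\<sigma> - \<tau> = {a}" by (auto simp: card_1_singleton_iff)
      then have "\<sigma> = insert a \<tau>" "a \<notin> \<tau>" using le(1) by auto
      then have "a \<in> cofaces n d K \<tau> I" using \<sigma>(3,4) \<open>J = I\<close> by (simp add: cof)
      then show ?thesis using \<sigma>(1) \<open>\<sigma> = insert a \<tau>\<close> \<open>J = I\<close> by blast
    qed
  qed
  show "?A \<union> ?B \<subseteq> ends (\<tau>, face d I)"
  proof
    fix e assume "e \<in> ?A \<union> ?B"
    then show "e \<in> ends (\<tau>, face d I)"
    proof
      assume "e \<in> ?A"
      then obtain a where a: "a \<notin> \<tau>" "insert a \<tau> \<in> K" "supported n d I (insert a \<tau>)" "e = (insert a \<tau>, face d I)"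
        by (auto simp: cof)
      then have "e \<in> XX (PP n d) K" using XX_I[OF a(2) \<tau>(2) a(3)] \<tau>(4) fin\<tau> by simp
      moreover have "cdim e = 0" using cdim_cell[OF a(2) \<tau>(2) a(3)] a(1,4) \<tau>(5) fin\<tau> by simp
      ultimately show ?thesis using a(4) by (auto simp: ends_def cell_le_def)
    next
      assume "e \<in> ?B"
      then obtain j where j: "j \<in> I" "supported n d (I - {j}) \<tau>" "e = (\<tau>, face d (I - {j}))" by blast
      have sub: "I - {j} \<subseteq> {..n}" using \<tau>(2) by blast
      have "e \<in> XX (PP n d) K" using XX_I[OF \<tau>(1) sub j(2) \<tau>(4)] j(3) by simp
      moreover have "cdim e = 0" using cdim_cell[OF \<tau>(1) sub j(2)] j(1,3) \<tau>(5) finI by simp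
      moreover have "cell_le e (\<tau>, face d I)" using j(3) cell_le_iff[OF \<tau>(2) sub] by auto
      ultimately show ?thesis by (simp add: ends_def)
    qed
  qed
qed

lemma two_ends:
  assumes e: "e \<in> XX (PP n d) K" "cdim e = 1"
  shows "\<exists>x y. x \<noteq> y \<and> ends e = {x, y}"
proof -
  from XX_E[OF e(1)] obtain \<tau> I where \<tau>: "e = (\<tau>, face d I)" "I \<subseteq> {..n}" "supported n d I \<tau>" "\<tau> \<in> K"
    "card \<tau> \<le> card I" "2 \<le> card \<tau>" "cdim e = card I - card \<tau>" by metis
  then have c: "card I = card \<tau> + 1" using e(2) by simp
  note E = ends_eq[OF \<tau>(4,2,3,6) c, folded \<tau>(1)]
  note cof = cofaces_def[OF fan d \<tau>(4,3,2) c]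
  from facet_count[OF fan d \<tau>(4,3,2) c] show ?thesis
  proof
    assume "\<exists>a b. a \<noteq> b \<and> cofaces n d K \<tau> I = {a, b} \<and> (\<forall>j\<in>I. \<not> supported n d (I - {j}) \<tau>)"
    then obtain a b where ab: "a \<noteq> b" "cofaces n d K \<tau> I = {a, b}" "\<forall>j\<in>I. \<not> supported n d (I - {j}) \<tau>" by blast
    have ne: "insert a \<tau> \<noteq> insert b \<tau>"
    proof -
      have "a \<notin> \<tau>" using ab(2) cof by blast
      then show ?thesis using ab(1) by blast
    qed
    have none: "{j \<in> I. supported n d (I - {j}) \<tau>} = {}" using ab(3) by blast
    then have "ends e = {(insert a \<tau>, face d I), (insert b \<tau>, face d I)}"
      unfolding E ab(2) none by simp
    then show ?thesis using ne
      by (intro exI[of _ "(insert a \<tau>, face d I)"] exI[of _ "(insert b \<tau>, face d I)"]) simp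
  next
    assume "\<exists>a j. cofaces n d K \<tau> I = {a} \<and> {j \<in> I. supported n d (I - {j}) \<tau>} = {j}"
    then obtain a j where aj: "cofaces n d K \<tau> I = {a}" "{j \<in> I. supported n d (I - {j}) \<tau>} = {j}" by blast
    have "insert a \<tau> \<noteq> \<tau>" using aj(1) cof by blast
    moreover have "ends e = {(insert a \<tau>, face d I), (\<tau>, face d (I - {j}))}"
      unfolding E aj by (simp add: insert_commute)
    ultimately show ?thesis
      by (intro exI[of _ "(insert a \<tau>, face d I)"] exI[of _ "(\<tau>, face d (I - {j}))"]) simp
  qed
qed

lemma cofaces_mem:
  assumes "\<tau> \<in> K" "supported n d I \<tau>" "I \<subseteq> {..n}" "card I = card \<tau> + 1"
  shows "a \<in> cofaces n d K \<tau> I \<longleftrightarrow> a \<notin> \<tau> \<and> insert a \<tau> \<in> K \<and> supported n d I (insert a \<tau>)"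
  unfolding cofaces_def[OF fan d assms] by simp

lemma interior_ends:
  assumes \<tau>: "\<tau> \<in> K" "2 \<le> card \<tau>" "card \<tau> = n" and v: "v \<in> \<tau>" "\<And>j. j \<le> n \<Longrightarrow> 0 < bcoord n (real d) j (emb v)"
  shows "\<exists>a b. a \<noteq> b \<and> a \<notin> \<tau> \<and> b \<notin> \<tau> \<and> insert a \<tau> \<in> K \<and> insert b \<tau> \<in> K \<and>
    ends (\<tau>, PP n d) = {(insert a \<tau>, PP n d), (insert b \<tau>, PP n d)}"
proof -
  have s: "supported n d {..n} \<tau>" by (simp add: supported_def)
  have c: "card {..n} = card \<tau> + 1" using \<tau>(3) by simp
  have none: "\<not> supported n d ({..n} - {j}) \<tau>" if "j \<in> {..n}" for j
    using v(1) v(2)[of j] that unfolding supported_def by force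
  have none': "{j \<in> {..n}. supported n d ({..n} - {j}) \<tau>} = {}"
  proof (rule equals0I)
    fix j assume "j \<in> {j \<in> {..n}. supported n d ({..n} - {j}) \<tau>}"
    then show False using none[of j] by simp
  qed
  have "\<exists>a b. a \<noteq> b \<and> cofaces n d K \<tau> {..n} = {a, b}"
    using facet_count[OF fan d \<tau>(1) s subset_refl c] unfolding none' by (elim disjE exE conjE) auto
  then obtain a b where ab: "a \<noteq> b" "cofaces n d K \<tau> {..n} = {a, b}" by (elim exE conjE)
  have "ends (\<tau>, PP n d) = {(insert a \<tau>, PP n d), (insert b \<tau>, PP n d)}"
    unfolding PP_face ends_eq[OF \<tau>(1) subset_refl s \<tau>(2) c] ab(2) none' by simp
  moreover have "a \<notin> \<tau>" "b \<notin> \<tau>" "insert a \<tau> \<in> K" "insert b \<tau> \<in> K"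
    using ab(2) cofaces_mem[OF \<tau>(1) s subset_refl c] by auto
  ultimately show ?thesis using ab(1) by (intro exI[of _ a] exI[of _ b]) simp
qed

text \<open>
  Between the two cells, two elements have to be either added to the simplex or removed from the face;
  the intermediate cells correspond to the choice of the first one.
\<close>

lemma diamond:
  assumes e: "e \<in> XX (PP n d) K" "cdim e = 2" and e2: "e2 \<in> XX (PP n d) K" "cdim e2 = 0" "cell_le e2 e"
  shows "\<exists>x y. x \<noteq> y \<and> {e1 \<in> XX (PP n d) K. cell_le e1 e \<and> cdim e1 = 1 \<and> cell_le e2 e1} = {x, y}"
    (is "\<exists>x y. _ \<and> ?M = _")
proof -
  from XX_E[OF e(1)] obtain \<rho> I where \<rho>: "e = (\<rho>, face d I)" "I \<subseteq> {..n}" "supported n d I \<rho>" "\<rho> \<in> K"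
    "card \<rho> \<le> card I" "2 \<le> card \<rho>" "cdim e = card I - card \<rho>" by metis
  from XX_E[OF e2(1)] obtain \<sigma> J where \<sigma>: "e2 = (\<sigma>, face d J)" "J \<subseteq> {..n}" "supported n d J \<sigma>" "\<sigma> \<in> K"
    "card \<sigma> \<le> card J" "2 \<le> card \<sigma>" "cdim e2 = card J - card \<sigma>" by metis
  have c: "card I = card \<rho> + 2" "card J = card \<sigma>" using \<rho>(5,7) e(2) \<sigma>(5,7) e2(2) by auto
  have le: "\<rho> \<subseteq> \<sigma>" "J \<subseteq> I" using e2(3) cell_le_iff[OF \<rho>(2) \<sigma>(2)] \<rho>(1) \<sigma>(1) by auto
  have fin: "finite I" "finite J" "finite \<sigma>" "finite \<rho>"
    using \<rho>(2) \<sigma>(2) finite_subset simplex_fin(1) \<rho>(4) \<sigma>(4) by blast+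
  have M: "?M = {(\<tau>, face d L) |\<tau> L. \<rho> \<subseteq> \<tau> \<and> \<tau> \<subseteq> \<sigma> \<and> J \<subseteq> L \<and> L \<subseteq> I \<and> card L = card \<tau> + 1}" (is "_ = ?N")
  proof
    show "?M \<subseteq> ?N"
    proof
      fix f assume "f \<in> ?M"
      then have f: "f \<in> XX (PP n d) K" "cell_le f e" "cdim f = 1" "cell_le e2 f" by auto
      from XX_E[OF f(1)] obtain \<tau> L where \<tau>: "f = (\<tau>, face d L)" "L \<subseteq> {..n}" "cdim f = card L - card \<tau>" by metis
      then show "f \<in> ?N"
        using f(2-4) cell_le_iff[OF \<rho>(2) \<tau>(2)] cell_le_iff[OF \<tau>(2) \<sigma>(2)] \<rho>(1) \<sigma>(1) by auto
    qed
    show "?N \<subseteq> ?M"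
    proof
      fix f assume "f \<in> ?N"
      then obtain \<tau> L where f: "f = (\<tau>, face d L)" "\<rho> \<subseteq> \<tau>" "\<tau> \<subseteq> \<sigma>" "J \<subseteq> L" "L \<subseteq> I" "card L = card \<tau> + 1"
        by blast
      have L: "L \<subseteq> {..n}" using f(5) \<rho>(2) by blast
      have "\<tau> \<noteq> {}" using f(2) simplex_fin(2)[OF \<rho>(4)] by blast
      then have \<tau>K: "\<tau> \<in> K" using fanD(5)[OF fan \<sigma>(4) f(3)] by blast
      have s: "supported n d L \<tau>" using supported_mono[OF supported_subset[OF \<sigma>(3) f(3)] f(4)] .
      have "2 \<le> card \<tau>" using card_mono[OF simplex_fin(1)[OF \<tau>K] f(2)] \<rho>(6) by simp
      then have "f \<in> XX (PP n d) K" using XX_I[OF \<tau>K L s] f(1) by simp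
      moreover have "cdim f = 1" using cdim_cell[OF \<tau>K L s] f(1,6) by simp
      ultimately show "f \<in> ?M"
        using f cell_le_iff[OF \<rho>(2) L] cell_le_iff[OF L \<sigma>(2)] \<rho>(1) \<sigma>(1) by simp
    qed
  qed
  have cle: "card \<rho> \<le> card \<sigma>" "card J \<le> card I" using le fin by (auto intro: card_mono)
  have bound: "card \<tau> \<le> card \<sigma>" "card \<rho> \<le> card \<tau>" "card J \<le> card L" "card L \<le> card I"
    if "\<rho> \<subseteq> \<tau>" "\<tau> \<subseteq> \<sigma>" "J \<subseteq> L" "L \<subseteq> I" for \<tau> L
    using that fin by (auto intro: card_mono finite_subset)
  consider "card \<sigma> = card \<rho>" | "card \<sigma> = card \<rho> + 1" | "card \<sigma> = card \<rho> + 2"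
    using c cle by linarith
  then show ?thesis
  proof cases
    case 1
    then have "\<sigma> = \<rho>" using card_subset_eq[OF fin(3) le(1)] by simp
    have "card (I - J) = 2" using c 1 le fin by (simp add: card_Diff_subset)
    then obtain p q where pq: "I - J = {p, q}" "p \<noteq> q" by (auto simp: card_2_iff)
    have pI: "p \<notin> J" "q \<notin> J" "insert p J \<subseteq> {..n}" "insert q J \<subseteq> {..n}" using pq \<rho>(2) le(2) by auto
    have "?N = {(\<rho>, face d (insert p J)), (\<rho>, face d (insert q J))}"
    proof
      show "?N \<subseteq> {(\<rho>, face d (insert p J)), (\<rho>, face d (insert q J))}"
      proof
        fix f assume "f \<in> ?N"
        then obtain \<tau> L where f: "f = (\<tau>, face d L)" "\<rho> \<subseteq> \<tau>" "\<tau> \<subseteq> \<sigma>" "J \<subseteq> L" "L \<subseteq> I" "card L = card \<tau> + 1" by blast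
        have "\<tau> = \<rho>" using \<open>\<sigma> = \<rho>\<close> f(2,3) by blast
        have "card (L - J) = 1" using f(4,6) c 1 \<open>\<tau> = \<rho>\<close> fin by (simp add: card_Diff_subset)
        then obtain r where r: "L - J = {r}" by (auto simp: card_1_singleton_iff)
        then have "L = insert r J" "r = p \<or> r = q" using f(4,5) pq by blast+
        then show "f \<in> {(\<rho>, face d (insert p J)), (\<rho>, face d (insert q J))}"
          using f(1) \<open>\<tau> = \<rho>\<close> by auto
      qed
      have "card (insert p J) = card \<rho> + 1" "card (insert q J) = card \<rho> + 1" using pI fin c 1 by auto
      moreover have "insert p J \<subseteq> I" "insert q J \<subseteq> I" using pq le(2) by auto
      ultimately show "{(\<rho>, face d (insert p J)), (\<rho>, face d (insert q J))} \<subseteq> ?N" using le(1) by blast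
    qed
    moreover have "face d (insert p J) \<noteq> face d (insert q J)"
      using face_inj[OF d pI(3,4)] pI(1,2) pq(2) by auto
    ultimately show ?thesis unfolding M
      by (intro exI[of _ "(\<rho>, face d (insert p J))"] exI[of _ "(\<rho>, face d (insert q J))"]) simp
  next
    case 2
    have "?N = {(\<rho>, face d J), (\<sigma>, face d I)}"
    proof
      show "?N \<subseteq> {(\<rho>, face d J), (\<sigma>, face d I)}"
      proof
        fix f assume "f \<in> ?N"
        then obtain \<tau> L where f: "f = (\<tau>, face d L)" "\<rho> \<subseteq> \<tau>" "\<tau> \<subseteq> \<sigma>" "J \<subseteq> L" "L \<subseteq> I" "card L = card \<tau> + 1" by blast
        note b = bound[OF f(2-5)]
        have "card \<tau> = card \<rho> \<or> card \<tau> = card \<sigma>" using b 2 by linarith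
        then show "f \<in> {(\<rho>, face d J), (\<sigma>, face d I)}"
        proof
          assume "card \<tau> = card \<rho>"
          then have "\<rho> = \<tau>" using f(2,3) fin by (intro card_subset_eq) (auto intro: finite_subset)
          moreover have "J = L" using f(4,5,6) \<open>card \<tau> = card \<rho>\<close> c 2 fin by (intro card_subset_eq) (auto intro: finite_subset)
          ultimately show ?thesis using f(1) by simp
        next
          assume "card \<tau> = card \<sigma>"
          then have "\<tau> = \<sigma>" using f(3) fin by (intro card_subset_eq) auto
          moreover have "L = I" using f(5,6) \<open>card \<tau> = card \<sigma>\<close> c 2 fin by (intro card_subset_eq) auto
          ultimately show ?thesis using f(1) by simp
        qed
      qed
      have "card J = card \<rho> + 1" "card I = card \<sigma> + 1" using c 2 by auto
      then show "{(\<rho>, face d J), (\<sigma>, face d I)} \<subseteq> ?N" using le by blast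
    qed
    moreover have "\<rho> \<noteq> \<sigma>" using 2 by auto
    ultimately show ?thesis unfolding M
      by (intro exI[of _ "(\<rho>, face d J)"] exI[of _ "(\<sigma>, face d I)"]) simp
  next
    case 3
    then have "J = I" using card_subset_eq[OF fin(1) le(2)] c by simp
    have "card (\<sigma> - \<rho>) = 2" using 3 le fin by (simp add: card_Diff_subset)
    then obtain p q where pq: "\<sigma> - \<rho> = {p, q}" "p \<noteq> q" by (auto simp: card_2_iff)
    have pI: "p \<notin> \<rho>" "q \<notin> \<rho>" "insert p \<rho> \<subseteq> \<sigma>" "insert q \<rho> \<subseteq> \<sigma>" using pq le(1) by auto
    have "?N = {(insert p \<rho>, face d I), (insert q \<rho>, face d I)}"
    proof
      show "?N \<subseteq> {(insert p \<rho>, face d I), (insert q \<rho>, face d I)}"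
      proof
        fix f assume "f \<in> ?N"
        then obtain \<tau> L where f: "f = (\<tau>, face d L)" "\<rho> \<subseteq> \<tau>" "\<tau> \<subseteq> \<sigma>" "J \<subseteq> L" "L \<subseteq> I" "card L = card \<tau> + 1" by blast
        have "L = I" using f(4,5) \<open>J = I\<close> by blast
        then have "card (\<tau> - \<rho>) = 1" using f(2,6) c fin by (simp add: card_Diff_subset)
        then obtain r where r: "\<tau> - \<rho> = {r}" by (auto simp: card_1_singleton_iff)
        then have "\<tau> = insert r \<rho>" "r = p \<or> r = q" using f(2,3) pq by blast+
        then show "f \<in> {(insert p \<rho>, face d I), (insert q \<rho>, face d I)}" using f(1) \<open>L = I\<close> by auto
      qed
      have "card I = card (insert p \<rho>) + 1" "card I = card (insert q \<rho>) + 1" using pI fin c by auto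
      then show "{(insert p \<rho>, face d I), (insert q \<rho>, face d I)} \<subseteq> ?N" using pI(3,4) \<open>J = I\<close> by blast
    qed
    moreover have "insert p \<rho> \<noteq> insert q \<rho>" using pI pq(2) by auto
    ultimately show ?thesis unfolding M
      by (intro exI[of _ "(insert p \<rho>, face d I)"] exI[of _ "(insert q \<rho>, face d I)"]) simp
  qed
qed

end


section \<open>Conormal vectors modulo two\<close>

definition conormal :: "nat \<Rightarrow> lpoint set \<Rightarrow> (nat \<Rightarrow> bit) set" where
  "conormal n \<sigma> = {u \<in> N2 n. \<forall>v\<in>\<sigma>. \<forall>v'\<in>\<sigma>. pairing2 n v u = pairing2 n v' u}"

lemma bitfun_add_self [simp]: "(f :: nat \<Rightarrow> bit) + f = 0"
  by (simp add: fun_eq_iff)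

lemma of_int_bit_eq_0_iff: "(of_int k :: bit) = 0 \<longleftrightarrow> even k"
proof (cases "even k")
  case True
  then obtain j where "k = 2 * j" by (elim evenE)
  then show ?thesis by simp
next
  case False
  then obtain j where "k = 2 * j + 1" by (elim oddE)
  then show ?thesis by simp
qed

lemma pairing2_add: "pairing2 n v (u + w) = pairing2 n v u + pairing2 n v w"
  by (simp add: pairing2_def distrib_left sum.distrib)

lemma pairing2_zero [simp]: "pairing2 n v 0 = 0"
  by (simp add: pairing2_def)

lemma N2_add: "u \<in> N2 n \<Longrightarrow> w \<in> N2 n \<Longrightarrow> u + w \<in> N2 n"
  by (simp add: N2_def)

lemma N2_zero: "0 \<in> N2 n"
  by (simp add: N2_def)

text \<open>
  An integer lift of \<open>u\<close> is constant modulo 2 on \<open>\<sigma>\<close>. By unimodularity, half of its deviation from a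
  constant is an integer affine function on \<open>\<sigma>\<close>; subtracting twice its linear part makes the lift constant.
\<close>

lemma conormal_lift:
  assumes "unimodular n \<sigma>" "u \<in> conormal n \<sigma>" and ne: "\<sigma> \<noteq> {}"
  obtains w k where "w \<in> lattice_pts n" "u = (\<lambda>i. of_int (w i))"
    "\<And>v. v \<in> \<sigma> \<Longrightarrow> (\<Sum>i\<in>{1..n}. v i * w i) = k"
proof -
  define U :: "nat \<Rightarrow> int" where "U i = (if u i = 1 then 1 else 0)" for i
  have U: "of_int (U i) = u i" for i by (cases "u i") (auto simp: U_def)
  obtain v0 where v0: "v0 \<in> \<sigma>" using ne by blast
  define c where "c = (\<Sum>i\<in>{1..n}. v0 i * U i)"
  have even: "even ((\<Sum>i\<in>{1..n}. v i * U i) - c)" if "v \<in> \<sigma>" for v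
  proof -
    have P: "(of_int (\<Sum>i\<in>{1..n}. x i * U i) :: bit) = pairing2 n x u" for x
      by (simp add: pairing2_def U)
    have "pairing2 n v u = pairing2 n v0 u" using assms(2) that v0 unfolding conormal_def by blast
    then have "(of_int (\<Sum>i\<in>{1..n}. v i * U i) :: bit) = of_int c" unfolding c_def P .
    then have "(of_int ((\<Sum>i\<in>{1..n}. v i * U i) - c) :: bit) = 0"
      unfolding of_int_diff by (simp only: diff_self)
    then show ?thesis by (simp only: of_int_bit_eq_0_iff)
  qed
  obtain g b where g: "\<And>v. v \<in> \<sigma> \<Longrightarrow> (\<Sum>i\<in>{1..n}. v i * g i) + b = ((\<Sum>i\<in>{1..n}. v i * U i) - c) div 2"
    using assms(1)[unfolded unimodular_def, rule_format, of "\<lambda>v. ((\<Sum>i\<in>{1..n}. v i * U i) - c) div 2"] by blast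
  define w where "w i = (if i \<in> {1..n} then U i - 2 * g i else 0)" for i
  have "(\<Sum>i\<in>{1..n}. v i * w i) = c + 2 * b" if "v \<in> \<sigma>" for v
  proof -
    have "(\<Sum>i\<in>{1..n}. v i * w i) = (\<Sum>i\<in>{1..n}. v i * U i) - 2 * (\<Sum>i\<in>{1..n}. v i * g i)"
      unfolding sum_distrib_left sum_subtractf[symmetric] by (intro sum.cong) (auto simp: w_def algebra_simps)
    moreover have "2 * (((\<Sum>i\<in>{1..n}. v i * U i) - c) div 2) = (\<Sum>i\<in>{1..n}. v i * U i) - c"
      using even[OF that] by simp
    ultimately show ?thesis using g[OF that] by simp
  qed
  moreover have "w \<in> lattice_pts n" by (simp add: lattice_pts_def w_def)
  moreover have "u = (\<lambda>i. of_int (w i))"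
  proof
    fix i show "u i = of_int (w i)"
      using assms(2) U[of i] by (auto simp: w_def conormal_def N2_def)
  qed
  ultimately show ?thesis using that by blast
qed

text \<open>
  The stalks of the wave sheaf, which are defined by integral conormal vectors, can be tested modulo 2,
  because conormal vectors modulo 2 lift.
\<close>

lemma W1_stalk:
  assumes "unimodular n \<sigma>" "\<sigma> \<noteq> {}"
  shows "stalk (W1 n) (\<sigma>, Q) = conormal n \<sigma>"
proof
  show "stalk (W1 n) (\<sigma>, Q) \<subseteq> conormal n \<sigma>"
  proof
    fix u assume "u \<in> stalk (W1 n) (\<sigma>, Q)"
    then obtain w where w: "w \<in> lattice_pts n" "u = (\<lambda>i. of_int (w i))"
      "\<forall>t\<in>tangent (geom \<sigma>). (\<Sum>i\<in>{1..n}. t i * real_of_int (w i)) = 0"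
      by (auto simp: W1_def)
    have "pairing2 n v u = pairing2 n v' u" if "v \<in> \<sigma>" "v' \<in> \<sigma>" for v v'
    proof -
      have "emb v - emb v' \<in> tangent (geom \<sigma>)"
        unfolding tangent_def using emb_in_geom that by (intro span_base) blast
      then have "(\<Sum>i\<in>{1..n}. (emb v - emb v') i * real_of_int (w i)) = 0" using w(3) by blast
      then have "real_of_int (\<Sum>i\<in>{1..n}. v i * w i) = real_of_int (\<Sum>i\<in>{1..n}. v' i * w i)"
        by (simp add: emb_def left_diff_distrib sum_subtractf)
      then have "(\<Sum>i\<in>{1..n}. v i * w i) = (\<Sum>i\<in>{1..n}. v' i * w i)" by (simp only: of_int_eq_iff)
      then have "(of_int (\<Sum>i\<in>{1..n}. v i * w i) :: bit) = of_int (\<Sum>i\<in>{1..n}. v' i * w i)" by (simp only:)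
      then show ?thesis by (simp add: pairing2_def w(2))
    qed
    moreover have "u \<in> N2 n" using w(1,2) by (simp add: N2_def lattice_pts_def)
    ultimately show "u \<in> conormal n \<sigma>" unfolding conormal_def by blast
  qed
  show "conormal n \<sigma> \<subseteq> stalk (W1 n) (\<sigma>, Q)"
  proof
    fix u assume "u \<in> conormal n \<sigma>"
    then obtain w k where w: "w \<in> lattice_pts n" "u = (\<lambda>i. of_int (w i))"
      "\<And>v. v \<in> \<sigma> \<Longrightarrow> (\<Sum>i\<in>{1..n}. v i * w i) = k"
      using conormal_lift[OF assms(1) _ assms(2)] by metis
    define L :: "rpoint \<Rightarrow> real" where "L x = (\<Sum>i\<in>{1..n}. x i * real_of_int (w i))" for x
    have L: "linear L"
      by (rule linearI) (simp_all add: L_def scaleR_apply distrib_right sum.distrib sum_distrib_left mult.assoc)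
    have sub: "geom \<sigma> \<subseteq> {x. L x = k}"
    proof (subst geom_subset_convex)
      show "convex {x. L x = k}"
        using L by (auto simp: convex_def linear_add linear_scale simp flip: distrib_right)
      show "\<forall>v\<in>\<sigma>. emb v \<in> {x. L x = real_of_int k}"
      proof
        fix v assume "v \<in> \<sigma>"
        then have "real_of_int (\<Sum>i\<in>{1..n}. v i * w i) = real_of_int k" using w(3) by simp
        then show "emb v \<in> {x. L x = real_of_int k}" by (simp add: L_def emb_def)
      qed
    qed
    have Lk: "L x = k" if "x \<in> geom \<sigma>" for x using that sub by blast
    have "L t = 0" if "t \<in> {x - y |x y. x \<in> geom \<sigma> \<and> y \<in> geom \<sigma>}" for t
      using that by (auto simp: linear_diff[OF L] Lk)
    then have "L t = 0" if "t \<in> tangent (geom \<sigma>)" for t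
      using linear_eq_0_on_span[OF L] that unfolding tangent_def by blast
    then show "u \<in> stalk (W1 n) (\<sigma>, Q)" using w(1,2) unfolding L_def by (auto simp: W1_def)
  qed
qed

text \<open>
  A lift \<open>w\<close> of \<open>u\<close> is constant on \<open>\<sigma>\<close>. The homogeneous coordinate vectors of the \<open>n + 1\<close> vertices span
  the whole space, so the linear form given by \<open>w\<close> and this constant is zero.
\<close>

lemma conormal_full:
  assumes fan: "simplicial_fan n d K" and d: "d \<ge> 1" and \<sigma>: "\<sigma> \<in> K" "unimodular n \<sigma>" "card \<sigma> = n + 1"
    and u: "u \<in> conormal n \<sigma>"
  shows "u = 0"
proof -
  have "\<sigma> \<noteq> {}" using fanD(2)[OF fan] \<sigma>(1) by auto
  then obtain w k where w: "w \<in> lattice_pts n" "u = (\<lambda>i. of_int (w i))"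
    "\<And>v. v \<in> \<sigma> \<Longrightarrow> (\<Sum>i\<in>{1..n}. v i * w i) = k"
    using conormal_lift[OF \<sigma>(2) u] by metis
  (* the coordinate vectors of lattice points have sum d, whence the factor k / d *)
  define g :: "rpoint \<Rightarrow> real" where
    "g x = (\<Sum>i\<in>{1..n}. x i * real_of_int (w i)) - (k / d) * (\<Sum>i\<le>n. x i)" for x
  have g: "linear g"
    by (rule linearI)
      (simp_all add: g_def scaleR_apply distrib_right sum.distrib distrib_left sum_distrib_left mult.assoc
        right_diff_distrib mult.left_commute)
  have s: "supported n d {..n} \<sigma>" by (simp add: supported_def)
  have z: "g y = 0" if "y \<in> bvec n d {..n} ` \<sigma>" for y
  proof -
    from that obtain v where v: "v \<in> \<sigma>" "y = bvec n d {..n} v" by blast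
    have "(\<Sum>i\<in>{1..n}. y i * real_of_int (w i)) = (\<Sum>i\<in>{1..n}. real_of_int (v i * w i))"
      unfolding v(2) by (intro sum.cong) (auto simp: bvec_def bcoord_def emb_def)
    also have "\<dots> = real_of_int k" unfolding w(3)[OF v(1), symmetric] by simp
    finally have "(\<Sum>i\<in>{1..n}. y i * real_of_int (w i)) = real_of_int k" .
    moreover have "(\<Sum>i\<le>n. y i) = d"
      unfolding v(2) using sum_bcoord[of n "real d" "emb v"] by (simp add: bvec_def)
    ultimately show ?thesis using d by (simp add: g_def)
  qed
  have gu: "g (unit_vec i) = 0" if "i \<le> n" for i
  proof -
    have "unit_vec i \<in> span (bvec n d {..n} ` \<sigma>)"
      by (rule full_simplex_spans[OF fan \<sigma>(1) d s]) (use \<sigma>(3) that in \<open>auto simp: unit_vec_def\<close>)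
    then show ?thesis using linear_eq_0_on_span[OF g z] by blast
  qed
  have su: "(\<Sum>j\<le>n. unit_vec i j) = 1" if "i \<le> n" for i
    using that by (simp add: unit_vec_def)
  have "(\<Sum>j\<in>{1..n}. unit_vec 0 j * real_of_int (w j)) = 0"
    by (intro sum.neutral) (auto simp: unit_vec_def)
  then have k: "k / d = (0 :: real)" using gu[of 0] su[of 0] by (simp add: g_def)
  have "w i = 0" for i
  proof (cases "i \<in> {1..n}")
    case True
    have "(\<Sum>j\<in>{1..n}. unit_vec i j * real_of_int (w j)) = (\<Sum>j\<in>{1..n}. if j = i then real_of_int (w i) else 0)"
      by (intro sum.cong) (auto simp: unit_vec_def)
    also have "\<dots> = real_of_int (w i)" using True by simp
    finally show ?thesis using gu[of i] True k unfolding g_def by simp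
  next
    case False
    then show ?thesis using w(1) by (simp add: lattice_pts_def)
  qed
  then show ?thesis using w(2) by (simp add: fun_eq_iff)
qed

section \<open>Gradients and Hessians\<close>

lemma sum_edge:
  assumes "s \<in> edges \<sigma>"
  obtains v v' where "s = {v, v'}" "v \<noteq> v'" "v \<in> \<sigma>" "v' \<in> \<sigma>" "\<And>f. (\<Sum>x\<in>s. f x) = f v + (f v' :: bit)"
proof -
  obtain v v' where "s = {v, v'}" "v \<noteq> v'" using assms by (auto simp: edges_def card_2_iff)
  moreover have "v \<in> \<sigma>" "v' \<in> \<sigma>" using assms calculation by (auto simp: edges_def)
  ultimately show ?thesis using that by simp
qed

lemma dsimp_eq_iff:
  "dsimp \<sigma> f = dsimp \<sigma> g \<longleftrightarrow> (\<forall>v\<in>\<sigma>. \<forall>v'\<in>\<sigma>. f v + g v = f v' + g v')"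
proof
  assume e: "dsimp \<sigma> f = dsimp \<sigma> g"
  show "\<forall>v\<in>\<sigma>. \<forall>v'\<in>\<sigma>. f v + g v = f v' + g v'"
  proof (intro ballI)
    fix v v' assume v: "v \<in> \<sigma>" "v' \<in> \<sigma>"
    show "f v + g v = f v' + g v'"
    proof (cases "v = v'")
      case False
      then have "{v, v'} \<in> edges \<sigma>" using v by (simp add: edges_def)
      then have "f v + f v' = g v + g v'"
        using fun_cong[OF e, of "{v, v'}"] False by (simp add: dsimp_def)
      then have "f v + f v' + (f v' + g v) = g v + g v' + (f v' + g v)" by (simp only:)
      then show ?thesis by (simp add: ac_simps)
    qed simp
  qed
next
  assume *: "\<forall>v\<in>\<sigma>. \<forall>v'\<in>\<sigma>. f v + g v = f v' + g v'"
  show "dsimp \<sigma> f = dsimp \<sigma> g"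
  proof
    fix s
    show "dsimp \<sigma> f s = dsimp \<sigma> g s"
    proof (cases "s \<in> edges \<sigma>")
      case True
      obtain v v' where s: "v \<in> \<sigma>" "v' \<in> \<sigma>" "\<And>h. (\<Sum>x\<in>s. h x) = h v + (h v' :: bit)"
        using sum_edge[OF True] by metis
      have "f v + g v = f v' + g v'" using * s by blast
      then have "f v + g v + (f v' + g v) = f v' + g v' + (f v' + g v)" by (simp only:)
      then have "f v + f v' = g v + g v'" by (simp add: ac_simps)
      then show ?thesis using True s(3) by (simp add: dsimp_def)
    qed (simp add: dsimp_def)
  qed
qed

lemma trans_W1: "trans (W1 n) e' e u = u"
  by (simp add: W1_def)

lemma cochains_stalk:
  assumes "a \<in> cochains A G q" "e \<in> A" "cdim e = q"
  shows "a e \<in> stalk G e"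
proof -
  have "if e \<in> A \<and> cdim e = q then a e \<in> stalk G e else a e = 0"
    using assms(1) unfolding cochains_def by blast
  then show ?thesis using assms(2,3) by simp
qed

lemma cochains_zero:
  assumes "a \<in> cochains A G q" "\<not> (e \<in> A \<and> cdim e = q)"
  shows "a e = 0"
proof -
  have "if e \<in> A \<and> cdim e = q then a e \<in> stalk G e else a e = 0"
    using assms(1) unfolding cochains_def by blast
  then show ?thesis using assms(2) by (simp only: if_False)
qed

lemma cochainsI:
  assumes "\<And>e. e \<in> A \<Longrightarrow> cdim e = q \<Longrightarrow> a e \<in> stalk G e" "\<And>e. \<not> (e \<in> A \<and> cdim e = q) \<Longrightarrow> a e = 0"
  shows "a \<in> cochains A G q"
  using assms unfolding cochains_def by auto

lemma cobdry_zero: "\<not> (e \<in> A \<and> cdim e = Suc q) \<Longrightarrow> cobdry A G q a e = 0"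
  unfolding cobdry_def by (simp only: if_False)

lemma coh_class_0: "coh_class A G 0 c = {c}"
  by (simp add: coh_class_def)

context
  fixes n d :: nat and K :: "lpoint set set" and h :: "lpoint \<Rightarrow> bit"
  assumes fan: "simplicial_fan n d K" and d: "d \<ge> 1"
    and unim: "\<And>\<sigma>. \<sigma> \<in> K \<Longrightarrow> unimodular n \<sigma>"
    and flat: "\<And>\<tau> a b v. insert a \<tau> \<in> K \<Longrightarrow> insert b \<tau> \<in> K \<Longrightarrow> a \<notin> \<tau> \<Longrightarrow> b \<notin> \<tau> \<Longrightarrow>
      a \<noteq> b \<Longrightarrow> card \<tau> = n \<Longrightarrow> v \<in> \<tau> \<Longrightarrow> (\<forall>j\<le>n. 0 < bcoord n (real d) j (emb v)) \<Longrightarrow>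
      affine_mod2 n (insert a (insert b \<tau>)) (\<lambda>x. h x + chi v x)"
begin

abbreviation "X \<equiv> XX (PP n d) K"
abbreviation "H \<equiv> hessian n (PP n d) K"

lemma stalk_W1: "\<sigma> \<in> K \<Longrightarrow> stalk (W1 n) (\<sigma>, Q) = conormal n \<sigma>"
  using W1_stalk unim simplex_fin(2)[OF fan d] by blast

text \<open>
  On each 0-cell \<open>(\<sigma>, Q)\<close> the value \<open>b\<close> is a gradient of \<open>\<epsilon>\<close> on \<open>\<sigma>\<close>, in the form: \<open>\<epsilon>\<close> plus the pairing
  with \<open>b\<close> is constant on \<open>\<sigma>\<close>.
\<close>

definition gradient_cochain :: "(lpoint \<Rightarrow> bit) \<Rightarrow> (cell \<Rightarrow> nat \<Rightarrow> bit) \<Rightarrow> bool" where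
  "gradient_cochain \<epsilon> b \<longleftrightarrow> b \<in> cochains X (N2_sheaf n) 0 \<and>
     (\<forall>e\<in>X. cdim e = 0 \<longrightarrow> (\<forall>v\<in>fst e. \<forall>v'\<in>fst e. pairing2 n v (b e) + \<epsilon> v = pairing2 n v' (b e) + \<epsilon> v'))"

lemma hessian_iff:
  "a \<in> H \<epsilon> \<longleftrightarrow> a \<in> cocycles X (W1 n) 1 \<and> (\<exists>b. gradient_cochain \<epsilon> b \<and> a = cobdry X (N2_sheaf n) 0 b)"
proof -
  have *: "(\<lambda>e. zmap n e (b e)) = dsection X \<epsilon> \<longleftrightarrow>
     (\<forall>e\<in>X. cdim e = 0 \<longrightarrow> (\<forall>v\<in>fst e. \<forall>v'\<in>fst e. pairing2 n v (b e) + \<epsilon> v = pairing2 n v' (b e) + \<epsilon> v'))"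
    if b: "b \<in> cochains X (N2_sheaf n) 0" for b
  proof -
    have z: "zmap n e (b e) = dsection X \<epsilon> e" if "\<not> (e \<in> X \<and> cdim e = 0)" for e
    proof -
      have "b e = 0" by (rule cochains_zero[OF b that])
      moreover have "zmap n e 0 = 0" by (simp add: zmap_def dsimp_def fun_eq_iff)
      ultimately have "zmap n e (b e) = 0" by simp
      then show ?thesis using that by (auto simp: dsection_def)
    qed
    have "(\<lambda>e. zmap n e (b e)) = dsection X \<epsilon> \<longleftrightarrow> (\<forall>e\<in>X. cdim e = 0 \<longrightarrow> zmap n e (b e) = dsection X \<epsilon> e)"
      using z by (auto simp: fun_eq_iff)
    also have "\<dots> \<longleftrightarrow> (\<forall>e\<in>X. cdim e = 0 \<longrightarrow> dsimp (fst e) (\<lambda>v. pairing2 n v (b e)) = dsimp (fst e) \<epsilon>)"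
      by (auto simp: zmap_def dsection_def)
    finally show ?thesis unfolding dsimp_eq_iff .
  qed
  have "a \<in> H \<epsilon> \<longleftrightarrow> a \<in> cocycles X (W1 n) 1 \<and>
      (\<exists>b\<in>cochains X (N2_sheaf n) 0. (\<lambda>e. zmap n e (b e)) = dsection X \<epsilon> \<and> a = cobdry X (N2_sheaf n) 0 b)"
    unfolding hessian_def connecting_def coh_class_0 by simp
  also have "\<dots> \<longleftrightarrow> a \<in> cocycles X (W1 n) 1 \<and> (\<exists>b. gradient_cochain \<epsilon> b \<and> a = cobdry X (N2_sheaf n) 0 b)"
    unfolding gradient_cochain_def using * by blast
  finally show ?thesis .
qed

lemma gradient_cochain_exists: "\<exists>b. gradient_cochain \<epsilon> b"
proof -
  have "\<exists>u. u \<in> N2 n \<and> (\<forall>v\<in>fst e. \<forall>v'\<in>fst e. pairing2 n v u + \<epsilon> v = pairing2 n v' u + \<epsilon> v')"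
    if "e \<in> X" for e
  proof -
    have "fst e \<in> K" using that by (auto simp: XX_def YY_def)
    then obtain u c where u: "\<forall>x\<in>fst e. \<epsilon> x = pairing2 n x u + c"
      using unimodular_affine_mod2[OF unim] unfolding affine_mod2_def by blast
    define w where "w i = (if i \<in> {1..n} then u i else 0)" for i
    have p: "pairing2 n v w = pairing2 n v u" for v by (rule pairing2_cong) (auto simp: w_def)
    have "w \<in> N2 n" by (simp add: N2_def w_def)
    moreover have "pairing2 n v w + \<epsilon> v = c" if "v \<in> fst e" for v
      using u that by (simp add: p)
    ultimately show ?thesis by (intro exI[of _ w]) simp
  qed
  then obtain U where U: "\<And>e. e \<in> X \<Longrightarrow> U e \<in> N2 n"
    "\<And>e v v'. e \<in> X \<Longrightarrow> v \<in> fst e \<Longrightarrow> v' \<in> fst e \<Longrightarrow> pairing2 n v (U e) + \<epsilon> v = pairing2 n v' (U e) + \<epsilon> v'"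
    by metis
  let ?b = "\<lambda>e. if e \<in> X \<and> cdim e = 0 then U e else 0"
  have "?b \<in> cochains X (N2_sheaf n) 0" using U(1) by (simp add: cochains_def N2_sheaf_def)
  moreover have "\<forall>e\<in>X. cdim e = 0 \<longrightarrow>
      (\<forall>v\<in>fst e. \<forall>v'\<in>fst e. pairing2 n v (?b e) + \<epsilon> v = pairing2 n v' (?b e) + \<epsilon> v')"
  proof (intro ballI impI)
    fix e v v' assume e: "e \<in> X" "cdim e = 0" and v: "v \<in> fst e" "v' \<in> fst e"
    have "?b e = U e" using e by simp
    then show "pairing2 n v (?b e) + \<epsilon> v = pairing2 n v' (?b e) + \<epsilon> v'"
      using U(2)[OF e(1) v] by (simp only:)
  qed
  ultimately show ?thesis unfolding gradient_cochain_def by blast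
qed

lemma cobdry_ends:
  assumes "e \<in> X" "cdim e = 1"
  shows "cobdry X (N2_sheaf n) 0 b e = (\<Sum>e'\<in>ends n d K e. b e')"
  using assms by (simp add: cobdry_def ends_def[OF fan d] N2_sheaf_def)

text \<open>
  At a 1-cell \<open>(\<tau>, Q)\<close> the two gradients at the ends agree on \<open>\<tau>\<close> up to a constant, so their sum is
  conormal to \<open>\<tau>\<close>. In the coboundary at a 2-cell each gradient occurs twice, by the diamond property.
\<close>

lemma cobdry_gradient_cochain:
  assumes b: "gradient_cochain \<epsilon> b"
  shows "cobdry X (N2_sheaf n) 0 b \<in> cocycles X (W1 n) 1"
proof -
  let ?a = "cobdry X (N2_sheaf n) 0 b"
  have bc: "b \<in> cochains X (N2_sheaf n) 0" using b unfolding gradient_cochain_def by blast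
  have bN: "b e \<in> N2 n" for e
  proof (cases "e \<in> X \<and> cdim e = 0")
    case True
    then show ?thesis using cochains_stalk[OF bc, of e] by (simp add: N2_sheaf_def)
  next
    case False
    then show ?thesis using cochains_zero[OF bc False] N2_zero by simp
  qed
  have "?a e \<in> stalk (W1 n) e" if e: "e \<in> X" "cdim e = 1" for e
  proof -
    obtain x y where xy: "x \<noteq> y" "ends n d K e = {x, y}" using two_ends[OF fan d e] by blast
    have a: "?a e = b x + b y" using cobdry_ends[OF e] xy by simp
    have E: "z \<in> X" "cdim z = 0" "fst e \<subseteq> fst z" if "z \<in> {x, y}" for z
      using that xy(2) by (auto simp: ends_def[OF fan d] cell_le_def)
    have "pairing2 n v (?a e) = pairing2 n v' (?a e)" if v: "v \<in> fst e" "v' \<in> fst e" for v v'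
    proof -
      have "pairing2 n v (b z) + \<epsilon> v = pairing2 n v' (b z) + \<epsilon> v'" if "z \<in> {x, y}" for z
        using b E[OF that] v unfolding gradient_cochain_def by blast
      then have "(pairing2 n v (b x) + \<epsilon> v) + (pairing2 n v (b y) + \<epsilon> v) =
          (pairing2 n v' (b x) + \<epsilon> v') + (pairing2 n v' (b y) + \<epsilon> v')" by simp
      then show ?thesis unfolding a pairing2_add by (simp add: ac_simps)
    qed
    moreover have "?a e \<in> N2 n" unfolding a by (intro N2_add bN)
    ultimately have "?a e \<in> conormal n (fst e)" unfolding conormal_def by blast
    moreover have "fst e \<in> K" using e by (auto simp: XX_def YY_def)
    ultimately show ?thesis using stalk_W1[of "fst e" "snd e"] by simp
  qed
  moreover have "?a e = 0" if "\<not> (e \<in> X \<and> cdim e = 1)" for e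
    using that by (auto simp: cobdry_def)
  ultimately have "?a \<in> cochains X (W1 n) 1" by (rule cochainsI)
  moreover have "cobdry X (W1 n) 1 ?a e = 0" for e
  proof (cases "e \<in> X \<and> cdim e = 2")
    case True
    let ?A = "{e1 \<in> X. cell_le e1 e \<and> cdim e1 = 1}" and ?B = "{e2 \<in> X. cell_le e2 e \<and> cdim e2 = 0}"
    have fin: "finite ?A" "finite ?B" using finite_XX[OF fan d] by auto
    have "cobdry X (W1 n) 1 ?a e = (\<Sum>e1\<in>?A. ?a e1)"
      by (subst cobdry_def) (use True in \<open>simp add: trans_W1 numeral_2_eq_2\<close>)
    also have "\<dots> = (\<Sum>e1\<in>?A. \<Sum>e2\<in>{e2\<in>?B. cell_le e2 e1}. b e2)"
    proof (rule sum.cong[OF refl])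
      fix e1 assume e1: "e1 \<in> ?A"
      then have "?a e1 = (\<Sum>e2\<in>ends n d K e1. b e2)" by (intro cobdry_ends) auto
      moreover have "ends n d K e1 = {e2\<in>?B. cell_le e2 e1}"
        using e1 by (auto simp: ends_def[OF fan d] cell_le_def)
      ultimately show "?a e1 = (\<Sum>e2\<in>{e2\<in>?B. cell_le e2 e1}. b e2)" by simp
    qed
    also have "\<dots> = (\<Sum>e2\<in>?B. \<Sum>e1\<in>{e1\<in>?A. cell_le e2 e1}. b e2)"
      by (rule sum.swap_restrict[OF fin])
    also have "\<dots> = 0"
    proof (rule sum.neutral, rule ballI)
      fix e2 assume e2: "e2 \<in> ?B"
      have "\<exists>x y. x \<noteq> y \<and> {e1 \<in> X. cell_le e1 e \<and> cdim e1 = 1 \<and> cell_le e2 e1} = {x, y}"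
        using True e2 by (intro diamond[OF fan d]) auto
      then obtain x y where xy: "x \<noteq> y" "{e1 \<in> X. cell_le e1 e \<and> cdim e1 = 1 \<and> cell_le e2 e1} = {x, y}"
        by (elim exE conjE)
      have bet: "{e1\<in>?A. cell_le e2 e1} = {e1 \<in> X. cell_le e1 e \<and> cdim e1 = 1 \<and> cell_le e2 e1}" by auto
      show "(\<Sum>e1\<in>{e1\<in>?A. cell_le e2 e1}. b e2) = 0"
        unfolding bet xy(2) using xy(1) by simp
    qed
    finally show ?thesis .
  next
    case False
    then show ?thesis by (intro cobdry_zero) (simp add: numeral_2_eq_2)
  qed
  ultimately show ?thesis by (auto simp: cocycles_def)
qed

lemma hessian_nonempty: "\<exists>a. a \<in> H \<epsilon>"
  using hessian_iff gradient_cochain_exists cobdry_gradient_cochain by blast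

text \<open>
  By definition an interior vertex avoids all proper faces.
\<close>

lemma face_at_interior:
  assumes "v \<in> interior_vertices (PP n d) K" "Q face_of PP n d" "emb v \<in> Q"
  shows "Q = PP n d"
proof (rule ccontr)
  assume "Q \<noteq> PP n d"
  then have "emb v \<in> bdry (PP n d)" using assms(2,3) by (auto simp: bdry_def)
  then show False using assms(1) by (simp add: interior_vertices_def geom_def)
qed

lemma interior_bcoord_pos:
  assumes v: "v \<in> interior_vertices (PP n d) K" and j: "j \<le> n"
  shows "0 < bcoord n (real d) j (emb v)"
proof (rule ccontr)
  assume neg: "\<not> ?thesis"
  have "{v} \<in> K" using v by (simp add: interior_vertices_def)
  then have D: "emb v \<in> dilate n d 1" using fanD(4)[OF fan] by blast
  then have z: "bcoord n (real d) j (emb v) = 0" using neg j by (force simp: dilate_def)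
  let ?I = "{..n} - {j}"
  have "emb v \<in> face d ?I" using D z by (subst face_eq[OF d, of _ n]) auto
  moreover have "face d ?I face_of PP n d" by (rule face_face_of[OF d]) auto
  ultimately have "face d ?I = face d {..n}"
    using face_at_interior[OF v] unfolding PP_face by blast
  then show False using face_inj[OF d, of ?I n "{..n}"] j by auto
qed

lemma bdry_dual_cell_E:
  assumes v: "v \<in> interior_vertices (PP n d) K" and e: "e \<in> bdry_dual_cell (PP n d) K v"
  shows "\<exists>\<tau>. e = (\<tau>, PP n d) \<and> \<tau> \<in> K \<and> v \<in> \<tau> \<and> 2 \<le> card \<tau>"
proof -
  obtain \<tau> Q where \<tau>: "e = (\<tau>, Q)" by (cases e)
  have e': "e \<in> YY (PP n d) K" "cell_le e ({v}, PP n d)" "e \<noteq> ({v}, PP n d)"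
    using e by (auto simp: bdry_dual_cell_def dual_cell_def)
  then have t: "\<tau> \<in> K" "Q face_of PP n d" "geom \<tau> \<subseteq> Q" "v \<in> \<tau>" using \<tau> by (auto simp: YY_def cell_le_def)
  have "emb v \<in> Q" using t(3) emb_in_geom[OF t(4)] by blast
  then have Q: "Q = PP n d" using face_at_interior[OF v t(2)] by simp
  have "\<tau> \<noteq> {v}" using e'(3) \<tau> Q by auto
  then have "{v} \<subset> \<tau>" using t(4) by blast
  then have "card {v} < card \<tau>" using simplex_fin(1)[OF fan d t(1)] by (intro psubset_card_mono)
  then show ?thesis using \<tau> Q t by auto
qed

text \<open>
  The cells of \<open>v\<^sup>*\<close> other than \<open>v\<^sup>*\<close> itself have a simplex of dimension at least one.
\<close>

lemma X0_eq: "X0 (PP n d) K = (\<Union>v\<in>interior_vertices (PP n d) K. bdry_dual_cell (PP n d) K v)"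
proof
  show "X0 (PP n d) K \<subseteq> (\<Union>v\<in>interior_vertices (PP n d) K. bdry_dual_cell (PP n d) K v)"
  proof
    fix e assume "e \<in> X0 (PP n d) K"
    then obtain v where v: "v \<in> interior_vertices (PP n d) K" "e \<in> X" "e \<in> dual_cell (PP n d) K v"
      by (auto simp: X0_def)
    obtain \<tau> Q where \<tau>: "e = (\<tau>, Q)" by (cases e)
    have "2 \<le> card \<tau>" using v(2) \<tau> XX_iff[OF fan d] by simp
    then have "e \<noteq> ({v}, PP n d)" using \<tau> by auto
    then show "e \<in> (\<Union>v\<in>interior_vertices (PP n d) K. bdry_dual_cell (PP n d) K v)"
      using v by (auto simp: bdry_dual_cell_def)
  qed
  show "(\<Union>v\<in>interior_vertices (PP n d) K. bdry_dual_cell (PP n d) K v) \<subseteq> X0 (PP n d) K"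
  proof
    fix e assume "e \<in> (\<Union>v\<in>interior_vertices (PP n d) K. bdry_dual_cell (PP n d) K v)"
    then obtain v where v: "v \<in> interior_vertices (PP n d) K" "e \<in> bdry_dual_cell (PP n d) K v" by blast
    then obtain \<tau> where \<tau>: "e = (\<tau>, PP n d)" "2 \<le> card \<tau>" using bdry_dual_cell_E by blast
    have D: "e \<in> dual_cell (PP n d) K v" using v(2) by (simp add: bdry_dual_cell_def)
    then have "e \<in> X" using \<tau> XX_iff[OF fan d] by (auto simp: dual_cell_def)
    then show "e \<in> X0 (PP n d) K" using v(1) D by (auto simp: X0_def)
  qed
qed

lemma X0_E:
  assumes "e \<in> X0 (PP n d) K"
  obtains \<tau> v where "e = (\<tau>, PP n d)" "\<tau> \<in> K" "v \<in> \<tau>" "2 \<le> card \<tau>" "v \<in> interior_vertices (PP n d) K"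
    "cdim e = n + 1 - card \<tau>" "card \<tau> \<le> n + 1"
proof -
  obtain v where v: "v \<in> interior_vertices (PP n d) K" "e \<in> bdry_dual_cell (PP n d) K v"
    using assms unfolding X0_eq by blast
  then obtain \<tau> where \<tau>: "e = (\<tau>, PP n d)" "\<tau> \<in> K" "v \<in> \<tau>" "2 \<le> card \<tau>" using bdry_dual_cell_E by blast
  have s: "supported n d {..n} \<tau>" by (simp add: supported_def)
  have "cdim e = n + 1 - card \<tau>" using cdim_cell[OF fan d \<tau>(2) subset_refl s] \<tau>(1) by (simp add: PP_face)
  moreover have "card \<tau> \<le> n + 1" using card_le_support[OF fan d \<tau>(2) s] by simp
  ultimately show ?thesis using that \<tau> v(1) by blast
qed

lemma X0_subset: "X0 (PP n d) K \<subseteq> X"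
  by (auto simp: X0_def)

text \<open>
  Let \<open>p\<close> and \<open>q\<close> be the apexes over \<open>\<tau>\<close>. The gradients of \<open>\<epsilon> + \<epsilon>'\<close> on the full-dimensional simplices \<open>\<tau> \<union> {p}\<close>
  and \<open>\<tau> \<union> {q}\<close> are unique, and by assumption one affine function serves on both; so they coincide and the
  difference of the two Hessians at \<open>\<tau>\<close> vanishes.
\<close>

lemma hessian_eq:
  assumes a: "a \<in> H \<epsilon>" and a': "a' \<in> H \<epsilon>'" and e: "e = (\<tau>, PP n d)" "\<tau> \<in> K" "2 \<le> card \<tau>"
    and v: "v \<in> \<tau>" "v \<in> interior_vertices (PP n d) K"
    and aff: "\<And>a b. a \<noteq> b \<Longrightarrow> a \<notin> \<tau> \<Longrightarrow> b \<notin> \<tau> \<Longrightarrow> insert a \<tau> \<in> K \<Longrightarrow> insert b \<tau> \<in> K \<Longrightarrow> card \<tau> = n \<Longrightarrow>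
      affine_mod2 n (insert a (insert b \<tau>)) (\<lambda>x. \<epsilon> x + \<epsilon>' x)"
  shows "a e = a' e"
proof -
  have s: "supported n d {..n} \<tau>" by (simp add: supported_def)
  have eX: "e \<in> X" using XX_I[OF fan d e(2) subset_refl s e(3)] e(1) by (simp add: PP_face)
  have c: "cdim e = n + 1 - card \<tau>" using cdim_cell[OF fan d e(2) subset_refl s] e(1) by (simp add: PP_face)
  obtain b where b: "gradient_cochain \<epsilon> b" "a = cobdry X (N2_sheaf n) 0 b" using a hessian_iff by blast
  obtain b' where b': "gradient_cochain \<epsilon>' b'" "a' = cobdry X (N2_sheaf n) 0 b'" using a' hessian_iff by blast
  show ?thesis
  proof (cases "cdim e = 1")
    case False
    then show ?thesis unfolding b(2) b'(2) by (simp add: cobdry_def)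
  next
    case True
    then have cn: "card \<tau> = n" using c by simp
    obtain p q where pq: "p \<noteq> q" "p \<notin> \<tau>" "q \<notin> \<tau>" "insert p \<tau> \<in> K" "insert q \<tau> \<in> K"
      "ends n d K (\<tau>, PP n d) = {(insert p \<tau>, PP n d), (insert q \<tau>, PP n d)}"
      using interior_ends[OF fan d e(2,3) cn v(1) interior_bcoord_pos[OF v(2)]] by blast
    obtain u0 k where u0: "\<forall>x\<in>insert p (insert q \<tau>). \<epsilon> x + \<epsilon>' x = pairing2 n x u0 + k"
      using aff[OF pq(1-5) cn] unfolding affine_mod2_def by blast
    define u where "u i = (if i \<in> {1..n} then u0 i else 0)" for i
    have pu: "pairing2 n x u = pairing2 n x u0" for x by (rule pairing2_cong) (auto simp: u_def)
    have uN: "u \<in> N2 n" by (simp add: N2_def u_def)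
    have key: "b z + b' z = u" if z: "z = (insert r \<tau>, PP n d)" and r: "r \<in> {p, q}" for z r
    proof -
      have rK: "insert r \<tau> \<in> K" "r \<notin> \<tau>" using r pq by auto
      have zE: "z \<in> ends n d K (\<tau>, PP n d)" using z r pq(6) by auto
      then have zX: "z \<in> X" "cdim z = 0" by (auto simp: ends_def[OF fan d])
      have bN: "b z \<in> N2 n" "b' z \<in> N2 n"
      proof -
        have "b \<in> cochains X (N2_sheaf n) 0" "b' \<in> cochains X (N2_sheaf n) 0"
          using b(1) b'(1) unfolding gradient_cochain_def by blast+
        from this[THEN cochains_stalk, OF zX] show "b z \<in> N2 n" "b' z \<in> N2 n"
          by (simp_all add: N2_sheaf_def)
      qed
      have "b z + b' z + u \<in> conormal n (insert r \<tau>)"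
        unfolding conormal_def
      proof (intro CollectI conjI ballI)
        show "b z + b' z + u \<in> N2 n" by (intro N2_add bN uN)
        fix x y assume x: "x \<in> insert r \<tau>" and y: "y \<in> insert r \<tau>"
        have 1: "pairing2 n x (b z) + \<epsilon> x = pairing2 n y (b z) + \<epsilon> y"
          using b(1) zX x y z unfolding gradient_cochain_def by (metis fst_conv)
        have 2: "pairing2 n x (b' z) + \<epsilon>' x = pairing2 n y (b' z) + \<epsilon>' y"
          using b'(1) zX x y z unfolding gradient_cochain_def by (metis fst_conv)
        have 3: "pairing2 n x u = \<epsilon> x + \<epsilon>' x + k" "pairing2 n y u = \<epsilon> y + \<epsilon>' y + k"
        proof -
          have "x \<in> insert p (insert q \<tau>)" "y \<in> insert p (insert q \<tau>)" using x y r by auto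
          then have "\<epsilon> x + \<epsilon>' x = pairing2 n x u + k" "\<epsilon> y + \<epsilon>' y = pairing2 n y u + k"
            using u0 pu by auto
          then show "pairing2 n x u = \<epsilon> x + \<epsilon>' x + k" "pairing2 n y u = \<epsilon> y + \<epsilon>' y + k"
            by (simp_all add: add.assoc)
        qed
        have "pairing2 n x (b z + b' z + u) = (pairing2 n x (b z) + \<epsilon> x) + (pairing2 n x (b' z) + \<epsilon>' x) + k"
          unfolding pairing2_add 3 by (simp only: ac_simps)
        also have "\<dots> = pairing2 n y (b z + b' z + u)"
          unfolding 1 2 pairing2_add 3 by (simp only: ac_simps)
        finally show "pairing2 n x (b z + b' z + u) = pairing2 n y (b z + b' z + u)" .
      qed
      then have "b z + b' z + u = 0"
        by (intro conormal_full[OF fan d rK(1) unim[OF rK(1)]])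
          (use rK cn simplex_fin(1)[OF fan d e(2)] in auto)
      then have "b z + b' z + u + u = u" by simp
      then show ?thesis by (simp add: add.assoc)
    qed
    let ?x = "(insert p \<tau>, PP n d)" and ?y = "(insert q \<tau>, PP n d)"
    have ne: "?x \<noteq> ?y" using pq(1-3) by blast
    have "a e = b ?x + b ?y" "a' e = b' ?x + b' ?y"
      using cobdry_ends[OF eX True] e(1) pq(6) ne by (simp_all add: b(2) b'(2))
    moreover have "(b ?x + b' ?x) + (b ?y + b' ?y) = 0"
      using key[of ?x p] key[of ?y q] by simp
    ultimately have z: "a e + a' e = 0" by (simp add: ac_simps)
    have "a e = a e + (a' e + a' e)" by simp
    also have "\<dots> = (a e + a' e) + a' e" by (simp only: add.assoc)
    also have "\<dots> = a' e" using z by simp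
    finally show ?thesis .
  qed
qed

section \<open>Uniformity\<close>

definition res :: "cell set \<Rightarrow> (cell \<Rightarrow> nat \<Rightarrow> bit) \<Rightarrow> cell \<Rightarrow> nat \<Rightarrow> bit" where
  "res B a = (\<lambda>e. if e \<in> B then a e else 0)"

text \<open>
  The stalks of the wave sheaf at the 0-cells of \<open>X\<^sub>0\<close> are zero, so there are no coboundaries.
\<close>

lemma coh_class_X0:
  assumes B: "B \<subseteq> X0 (PP n d) K"
  shows "coh_class B (W1 n) 1 a = {a}"
proof -
  have "c = 0" if c: "c \<in> cochains B (W1 n) 0" for c
  proof
    fix e
    show "c e = 0 e"
    proof (cases "e \<in> B \<and> cdim e = 0")
      case True
      then have "e \<in> X0 (PP n d) K" using B by blast
      from X0_E[OF this] obtain \<tau> v where \<tau>: "e = (\<tau>, PP n d)" "\<tau> \<in> K" "cdim e = n + 1 - card \<tau>" "card \<tau> \<le> n + 1"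
        by metis
      then have "card \<tau> = n + 1" using True by simp
      moreover have "c e \<in> stalk (W1 n) e"
        using cochains_stalk[OF c] True by blast
      ultimately show ?thesis
        using conormal_full[OF fan d \<tau>(2) unim[OF \<tau>(2)]] stalk_W1[OF \<tau>(2)] \<tau>(1) by simp
    next
      case False
      then show ?thesis using cochains_zero[OF c False] by simp
    qed
  qed
  moreover have "(0 :: cell \<Rightarrow> nat \<Rightarrow> bit) \<in> cochains B (W1 n) 0"
  proof -
    have "0 \<in> stalk (W1 n) e" if "e \<in> B" for e
    proof -
      have "fst e \<in> K" using that B X0_subset by (auto simp: XX_def YY_def)
      then show ?thesis using stalk_W1[of "fst e" "snd e"] N2_zero by (simp add: conormal_def)
    qed
    then show ?thesis by (intro cochainsI) simp_all
  qed
  ultimately have "cochains B (W1 n) 0 = {0}" by blast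
  moreover have "cobdry B (W1 n) 0 0 = 0" by (simp add: cobdry_def W1_def fun_eq_iff)
  ultimately have "coboundaries B (W1 n) 1 = {0}" by simp
  then show ?thesis by (simp add: coh_class_def)
qed

lemma coh_restrict_singleton:
  assumes "B \<subseteq> X0 (PP n d) K"
  shows "coh_restrict B (W1 n) 1 {a} = {res B a}"
  unfolding coh_restrict_def coh_class_X0[OF assms] res_def by simp

text \<open>
  The case \<open>\<epsilon> = \<epsilon>'\<close> of the comparison: all representatives of a Hessian coincide on \<open>X\<^sub>0\<close>.
\<close>

lemma hessian_agree:
  assumes "a \<in> H \<epsilon>" "a' \<in> H \<epsilon>" "e \<in> X0 (PP n d) K"
  shows "a e = a' e"
proof -
  from X0_E[OF assms(3)] obtain \<tau> v where \<tau>: "e = (\<tau>, PP n d)" "\<tau> \<in> K" "v \<in> \<tau>" "2 \<le> card \<tau>"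
    "v \<in> interior_vertices (PP n d) K" by metis
  have "affine_mod2 n S (\<lambda>x. \<epsilon> x + \<epsilon> x)" for S
    unfolding affine_mod2_def by (intro exI[of _ 0]) simp
  then show ?thesis using hessian_eq[OF assms(1,2) \<tau>(1,2,4,3,5)] by blast
qed

lemma coh_restrict_hessian:
  assumes B: "B \<subseteq> X0 (PP n d) K" and a: "a \<in> H \<epsilon>"
  shows "coh_restrict B (W1 n) 1 (H \<epsilon>) = {res B a}"
proof -
  have eq: "res B a' = res B a" if "a' \<in> H \<epsilon>" for a'
  proof
    fix e show "res B a' e = res B a e"
      using hessian_agree[OF that a subsetD[OF B]] by (simp add: res_def)
  qed
  have "coh_restrict B (W1 n) 1 (H \<epsilon>) = (\<Union>a'\<in>H \<epsilon>. {res B a'})"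
    unfolding coh_restrict_def coh_class_X0[OF B] res_def ..
  also have "\<dots> = (\<Union>a'\<in>H \<epsilon>. {res B a})" by (rule SUP_cong) (simp_all only: eq)
  also have "\<dots> = {res B a}" by (rule UN_constant_eq[OF a]) simp
  finally show ?thesis .
qed

text \<open>
  With a cell, \<open>X\<^sub>0\<close> contains its boundary in \<open>X\<close>, so coboundaries can be computed in either complex.
\<close>

lemma res_cocycle:
  assumes a: "a \<in> H \<epsilon>"
  shows "res (X0 (PP n d) K) a \<in> cocycles (X0 (PP n d) K) (W1 n) 1"
proof -
  let ?X0 = "X0 (PP n d) K"
  have ac: "a \<in> cochains X (W1 n) 1" "cobdry X (W1 n) 1 a = 0"
    using a hessian_iff by (auto simp: cocycles_def)
  have "res ?X0 a \<in> cochains ?X0 (W1 n) 1"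
  proof (rule cochainsI)
    show "res ?X0 a e \<in> stalk (W1 n) e" if "e \<in> ?X0" "cdim e = 1" for e
      using cochains_stalk[OF ac(1), of e] X0_subset that by (auto simp: res_def)
    show "res ?X0 a e = 0" if "\<not> (e \<in> ?X0 \<and> cdim e = 1)" for e
      using cochains_zero[OF ac(1), of e] that by (auto simp: res_def)
  qed
  moreover have "cobdry ?X0 (W1 n) 1 (res ?X0 a) e = 0" for e
  proof (cases "e \<in> ?X0 \<and> cdim e = 2")
    case True
    have down: "e' \<in> ?X0" if "e' \<in> X" "cell_le e' e" for e'
      using True that unfolding X0_def dual_cell_def XX_def cell_le_def by blast
    then have "{e'. e' \<in> ?X0 \<and> cell_le e' e \<and> cdim e' = 1} = {e'. e' \<in> X \<and> cell_le e' e \<and> cdim e' = 1}"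
      using X0_subset by blast
    then have "cobdry ?X0 (W1 n) 1 (res ?X0 a) e = (\<Sum>e' | e' \<in> X \<and> cell_le e' e \<and> cdim e' = 1. res ?X0 a e')"
      by (subst cobdry_def) (use True in \<open>simp add: trans_W1 numeral_2_eq_2\<close>)
    also have "\<dots> = (\<Sum>e' | e' \<in> X \<and> cell_le e' e \<and> cdim e' = 1. a e')"
      using down by (intro sum.cong) (auto simp: res_def)
    also have "\<dots> = cobdry X (W1 n) 1 a e"
      by (subst cobdry_def) (use True X0_subset in \<open>auto simp: trans_W1 numeral_2_eq_2\<close>)
    finally show ?thesis using ac(2) by simp
  next
    case False
    then show ?thesis by (intro cobdry_zero) (simp add: numeral_2_eq_2)
  qed
  ultimately show ?thesis by (auto simp: cocycles_def)
qed

lemma hessian_flat: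
  assumes v: "v \<in> interior_vertices (PP n d) K" and a: "a \<in> H h" and a': "a' \<in> H (chi v)"
    and e: "e \<in> bdry_dual_cell (PP n d) K v"
  shows "a e = a' e"
proof -
  obtain \<tau> where \<tau>: "e = (\<tau>, PP n d)" "\<tau> \<in> K" "v \<in> \<tau>" "2 \<le> card \<tau>" using bdry_dual_cell_E[OF v e] by blast
  show ?thesis
    by (rule hessian_eq[OF a a' \<tau>(1,2,4,3) v])
      (use flat[OF _ _ _ _ _ _ \<tau>(3)] interior_bcoord_pos[OF v] in blast)
qed

text \<open>
  On \<open>X\<^sub>0\<close> and on the spheres \<open>\<partial>v\<^sup>*\<close>, classes are cocycles. The restriction of the Hessian of \<open>h\<close> agrees with
  that of \<open>\<chi>\<^sub>v\<close> on \<open>\<partial>v\<^sup>*\<close>, and since these spheres cover \<open>X\<^sub>0\<close>, no other class has this property.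
\<close>

theorem flat_imp_uniform:
  "uniform n (PP n d) K (coh_restrict (X0 (PP n d) K) (W1 n) 1 (H h))"
  "uniform n (PP n d) K \<rho> \<Longrightarrow> \<rho> = coh_restrict (X0 (PP n d) K) (W1 n) 1 (H h)"
proof -
  let ?X0 = "X0 (PP n d) K" and ?V = "interior_vertices (PP n d) K" and ?B = "bdry_dual_cell (PP n d) K"
  obtain a where a: "a \<in> H h" using hessian_nonempty by blast
  have B: "?B v \<subseteq> ?X0" if "v \<in> ?V" for v unfolding X0_eq using that by blast
  have R: "coh_restrict ?X0 (W1 n) 1 (H h) = {res ?X0 a}" by (rule coh_restrict_hessian[OF subset_refl a])
  have chi: "coh_restrict (?B v) (W1 n) 1 (H (chi v)) = {res (?B v) a}" if v: "v \<in> ?V" for v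
  proof -
    obtain c where c: "c \<in> H (chi v)" using hessian_nonempty by blast
    have "res (?B v) c = res (?B v) a"
    proof
      fix e show "res (?B v) c e = res (?B v) a e"
        using hessian_flat[OF v a c, of e] by (simp add: res_def)
    qed
    then show ?thesis using coh_restrict_hessian[OF B[OF v] c] by simp
  qed
  have "{res ?X0 a} = coh_class ?X0 (W1 n) 1 (res ?X0 a)" by (rule coh_class_X0[OF subset_refl, symmetric])
  then have "{res ?X0 a} \<in> cohomology ?X0 (W1 n) 1"
    unfolding cohomology_def using res_cocycle[OF a] by blast
  moreover have "coh_restrict (?B v) (W1 n) 1 {res ?X0 a} = {res (?B v) a}" if v: "v \<in> ?V" for v
  proof -
    have "res (?B v) (res ?X0 a) = res (?B v) a" using B[OF v] by (auto simp: res_def fun_eq_iff)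
    then show ?thesis using coh_restrict_singleton[OF B[OF v]] by simp
  qed
  ultimately show "uniform n (PP n d) K (coh_restrict ?X0 (W1 n) 1 (H h))"
    unfolding uniform_def R using chi by simp
  assume u: "uniform n (PP n d) K \<rho>"
  then have "\<rho> \<in> cohomology ?X0 (W1 n) 1" by (simp add: uniform_def)
  then obtain r where r: "r \<in> cocycles ?X0 (W1 n) 1" "\<rho> = {r}"
    unfolding cohomology_def coh_class_X0[OF subset_refl] by blast
  have "r = res ?X0 a"
  proof
    fix e
    show "r e = res ?X0 a e"
    proof (cases "e \<in> ?X0")
      case True
      then obtain v where v: "v \<in> ?V" "e \<in> ?B v" unfolding X0_eq by blast
      have "coh_restrict (?B v) (W1 n) 1 \<rho> = coh_restrict (?B v) (W1 n) 1 (H (chi v))"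
        using u v(1) by (simp add: uniform_def)
      then have "res (?B v) r = res (?B v) a"
        unfolding chi[OF v(1)] r(2) coh_restrict_singleton[OF B[OF v(1)]] by simp
      from fun_cong[OF this, of e] show ?thesis using v(2) True by (simp add: res_def)
    next
      case False
      have "r \<in> cochains ?X0 (W1 n) 1" using r(1) by (simp add: cocycles_def)
      then have "r e = 0" by (rule cochains_zero) (use False in simp)
      then show ?thesis using False by (simp add: res_def)
    qed
  qed
  then show "\<rho> = coh_restrict ?X0 (W1 n) 1 (H h)" using r(2) R by simp
qed

end

section \<open>The Itenberg--Viro triangulations are simply integrable\<close>

theorem theorem6p7:
  fixes n d :: nat
  assumes "n \<ge> 2" and "d \<ge> 1"
  shows "simply_integrable n (PP n d) (IV n d) \<and>
         (\<forall>\<rho>. uniform n (PP n d) (IV n d) \<rho> \<longrightarrow>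
               hessian_solution n (PP n d) (IV n d) \<rho> (harnack n))"
proof -
  let ?K = "itenberg_viro n d"
  have IV: "IV n d = ?K" using IV_eq_itenberg_viro assms by simp
  have flat: "affine_mod2 n (insert a (insert b \<tau>)) (\<lambda>x. harnack n x + chi v x)"
    if "insert a \<tau> \<in> ?K" "insert b \<tau> \<in> ?K" "a \<notin> \<tau>" "b \<notin> \<tau>" "a \<noteq> b" "card \<tau> = n" "v \<in> \<tau>"
      "\<forall>j\<le>n. 0 < bcoord n (real d) j (emb v)" for \<tau> a b v
    using harnack_flat_itenberg_viro[of n d] that unfolding harnack_flat_def by blast
  let ?\<rho> = "coh_restrict (X0 (PP n d) ?K) (W1 n) 1 (hessian n (PP n d) ?K (harnack n))"
  have "uniform n (PP n d) ?K ?\<rho>"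
    by (rule flat_imp_uniform(1)[OF fan_itenberg_viro assms(2) unimodular_itenberg_viro flat])
  moreover have "\<rho> = ?\<rho>" if "uniform n (PP n d) ?K \<rho>" for \<rho>
    by (rule flat_imp_uniform(2)[OF fan_itenberg_viro assms(2) unimodular_itenberg_viro flat that])
  ultimately show ?thesis
    unfolding IV simply_integrable_def hessian_solution_def by blast
qed

end
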